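(* Let $k$ be a field and let $\mathscr{C}\in\{\mathrm{FA},\mathrm{OA},\mathrm{CA},\mathrm{BA},\mathrm{SA}\}$. Isomorphism classes of irreducible $\mathscr{C}$-modules are parameterized by pairs $(n,\lambda)$ with $n\in\mathbb{Z}_+$ and $\lambda\in\mathrm{Irr}(G_n)$. If $\lambda$ is regular, the irreducible $\mathscr{C}$-module corresponding to $(n,\lambda)$ is $\overline{\Delta}_{n,\lambda}$; if $\lambda$ is singular, it is the top of $\overline{\Delta}_{n,\lambda}$.
   Context: For $n\geq1$ put $[n]=\{1,\dots,n\}$. All five categories have objects $[n]$, $n\in\mathbb{Z}_{+}=\{1,2,\dots\}$, and morphisms: $\mathrm{FA}$: all maps; $\mathrm{OA}$ (simplex category): weakly order-preserving maps; $\mathrm{CA}$: maps preserving the cyclic order, i.e. maps $\sigma\circ g\circ\rho$ with $\rho,\sigma$ rotations (powers of the standard cyclic permutation) of source and target and $g$ weakly order-preserving; $\mathrm{BA}$: maps preserving linear betweenness, i.e. weakly order-preserving or weakly order-reversing maps; $\mathrm{SA}$: maps preserving the separation relation, i.e. maps $f:[m]\to[n]$ such that $f$ or its composite with the reversal $i\mapsto n+1-i$ of $[n]$ lies in $\mathrm{CA}$. $G_n$ is the automorphism group of $[n]$ in $\mathscr{C}$, and $\mathrm{Irr}(G_n)$ is a complete set of non-isomorphic irreducible $kG_n$-modules. A $\mathscr{C}$-module is a covariant functor $\mathscr{C}\to k\text{-}\mathrm{Mod}$. The standard module $\Delta_n$ is the quotient of the representable functor $P_n=k\mathscr{C}(n,-)$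 by the submodule spanned by all non-injective morphisms with source $[n]$; $G_n$ acts on it from the right by precomposition. For $\lambda\in\mathrm{Irr}(G_n)$ let $e_\lambda\in kG_n$ be a primitive idempotent such that $kG_ne_\lambda$ is the projective cover of $\lambda$, and set $\Delta_{n,\lambda}=\Delta_n\otimes_{kG_n}kG_ne_\lambda$ and $\overline{\Delta}_{n,\lambda}=\Delta_n\otimes_{kG_n}\lambda$. Call $\lambda\in\mathrm{Irr}(G_n)$ singular if there exists a nonzero homomorphism $\Delta_{n+1}\to\Delta_{n,\lambda}$ of $\mathscr{C}$-modules, and regular otherwise. The top of a module is its quotient by its radical. *)

theory Defs
  imports "HOL-Algebra.Module" "HOL-Algebra.AbelCoset" "HOL-Library.FuncSet"
begin

section \<open>The five categories\<close>

text \<open>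
  A category with objects \<open>[n] = {1..n}\<close>, \<open>n \<ge> 1\<close>, whose morphisms are maps, is given by its
  family of hom-sets \<open>C m n\<close> (morphisms \<open>[m] \<rightarrow> [n]\<close>), with composition \<^const>\<open>compose\<close>.
  Morphisms are extensional on \<open>{1..m}\<close>, so that equality of morphisms is equality in HOL.
  The values at the index 0, which is not an object, are never used.
\<close>

type_synonym cat = "nat \<Rightarrow> nat \<Rightarrow> (nat \<Rightarrow> nat) set"

definition FA :: cat where
  "FA m n = {1..m} \<rightarrow>\<^sub>E {1..n}"

definition OA :: cat where
  "OA m n = {f \<in> FA m n. mono_on {1..m} f}"

definition cyc :: "nat \<Rightarrow> nat \<Rightarrow> nat" where
  "cyc n i = i mod n + 1"

definition CA :: cat where
  "CA m n = {restrict ((cyc n ^^ j) \<circ> g \<circ> (cyc m ^^ i)) {1..m} | g i j. g \<in> OA m n}"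

definition BA :: cat where
  "BA m n = {f \<in> FA m n. mono_on {1..m} f \<or> antimono_on {1..m} f}"

definition SA :: cat where
  "SA m n = {f \<in> FA m n. f \<in> CA m n \<or> compose {1..m} (\<lambda>i. n + 1 - i) f \<in> CA m n}"

definition aut :: "cat \<Rightarrow> nat \<Rightarrow> (nat \<Rightarrow> nat) monoid" where
  "aut C n =
     \<lparr>carrier = {f \<in> C n n. \<exists>g \<in> C n n. compose {1..n} g f = (\<lambda>x\<in>{1..n}. x) \<and>
                                          compose {1..n} f g = (\<lambda>x\<in>{1..n}. x)},
      mult = compose {1..n}, one = (\<lambda>x\<in>{1..n}. x)\<rparr>"


section \<open>Modules over a not necessarily commutative ring\<close>

text \<open>The library locale \<^locale>\<open>module\<close> has the same axioms, but over commutative rings only.\<close>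

locale left_module = R?: ring A + M?: abelian_group M for A (structure) and M (structure) +
  assumes smult_closed:
      "\<lbrakk>a \<in> carrier A; x \<in> carrier M\<rbrakk> \<Longrightarrow> a \<odot>\<^bsub>M\<^esub> x \<in> carrier M"
    and smult_l_distr:
      "\<lbrakk>a \<in> carrier A; b \<in> carrier A; x \<in> carrier M\<rbrakk> \<Longrightarrow>
       (a \<oplus>\<^bsub>A\<^esub> b) \<odot>\<^bsub>M\<^esub> x = a \<odot>\<^bsub>M\<^esub> x \<oplus>\<^bsub>M\<^esub> b \<odot>\<^bsub>M\<^esub> x"
    and smult_r_distr:
      "\<lbrakk>a \<in> carrier A; x \<in> carrier M; y \<in> carrier M\<rbrakk> \<Longrightarrow>
       a \<odot>\<^bsub>M\<^esub> (x \<oplus>\<^bsub>M\<^esub> y) = a \<odot>\<^bsub>M\<^esub> x \<oplus>\<^bsub>M\<^esub> a \<odot>\<^bsub>M\<^esub> y"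
    and smult_assoc:
      "\<lbrakk>a \<in> carrier A; b \<in> carrier A; x \<in> carrier M\<rbrakk> \<Longrightarrow>
       (a \<otimes>\<^bsub>A\<^esub> b) \<odot>\<^bsub>M\<^esub> x = a \<odot>\<^bsub>M\<^esub> (b \<odot>\<^bsub>M\<^esub> x)"
    and smult_one:
      "x \<in> carrier M \<Longrightarrow> \<one>\<^bsub>A\<^esub> \<odot>\<^bsub>M\<^esub> x = x"

definition mod_hom :: "'a ring \<Rightarrow> ('a, 'v) module \<Rightarrow> ('a, 'w) module \<Rightarrow> ('v \<Rightarrow> 'w) set" where
  "mod_hom A M N =
     {f \<in> carrier M \<rightarrow> carrier N.
        (\<forall>x \<in> carrier M. \<forall>y \<in> carrier M. f (x \<oplus>\<^bsub>M\<^esub> y) = f x \<oplus>\<^bsub>N\<^esub> f y) \<and>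
        (\<forall>a \<in> carrier A. \<forall>x \<in> carrier M. f (a \<odot>\<^bsub>M\<^esub> x) = a \<odot>\<^bsub>N\<^esub> f x)}"

definition mod_iso :: "'a ring \<Rightarrow> ('a, 'v) module \<Rightarrow> ('a, 'w) module \<Rightarrow> bool" where
  "mod_iso A M N \<longleftrightarrow> (\<exists>f \<in> mod_hom A M N. bij_betw f (carrier M) (carrier N))"

definition irreducible_module :: "'a ring \<Rightarrow> ('a, 'v) module \<Rightarrow> bool" where
  "irreducible_module A M \<longleftrightarrow>
     left_module A M \<and> carrier M \<noteq> {\<zero>\<^bsub>M\<^esub>} \<and>
     (\<forall>W. submodule W A M \<longrightarrow> W = {\<zero>\<^bsub>M\<^esub>} \<or> W = carrier M)"

text \<open>
  A complete set of non-isomorphic irreducible modules. Every irreducible \<open>A\<close>-module (in any type)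
  is isomorphic to \<open>A\<close> modulo a maximal left ideal, which is a module on a set of cosets; so it
  suffices to test completeness on modules with elements of type \<open>'a set\<close>.
\<close>

definition complete_irreducibles :: "'a ring \<Rightarrow> ('a, 'w) module set \<Rightarrow> bool" where
  "complete_irreducibles A S \<longleftrightarrow>
     (\<forall>M \<in> S. irreducible_module A M) \<and>
     (\<forall>M \<in> S. \<forall>N \<in> S. mod_iso A M N \<longrightarrow> M = N) \<and>
     (\<forall>N :: ('a, 'a set) module. irreducible_module A N \<longrightarrow> (\<exists>M \<in> S. mod_iso A N M))"

definition mod_span :: "'a ring \<Rightarrow> ('a, 'v) module \<Rightarrow> 'v set \<Rightarrow> 'v set" where
  "mod_span A M S = \<Inter> {W. submodule W A M \<and> S \<subseteq> W}"

text \<open>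
  The map induced by \<open>f\<close> on cosets, with target the cosets of \<open>W\<close> in \<open>N\<close>: when \<open>f\<close> is compatible
  with the cosets, all members of the union coincide. The fields \<^const>\<open>mult\<close> and \<^const>\<open>one\<close>,
  inherited by module records from ring records, have no meaning for modules.
\<close>

definition quot_map :: "('a, 'w) module \<Rightarrow> 'w set \<Rightarrow> ('v \<Rightarrow> 'w) \<Rightarrow> 'v set \<Rightarrow> 'w set" where
  "quot_map N W f X = (\<Union>x\<in>X. W +>\<^bsub>N\<^esub> f x)"

definition quot_mod :: "('a, 'v) module \<Rightarrow> 'v set \<Rightarrow> ('a, 'v set) module" where
  "quot_mod M W =
     \<lparr>carrier = a_rcosets\<^bsub>M\<^esub> W, mult = undefined, one = undefined,
      zero = W, add = (\<lambda>X Y. X <+>\<^bsub>M\<^esub> Y),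
      smult = (\<lambda>a. quot_map M W (\<lambda>x. a \<odot>\<^bsub>M\<^esub> x))\<rparr>"


section \<open>Free modules, group algebras and tensor products\<close>

definition fin_funs :: "'k ring \<Rightarrow> 'x set \<Rightarrow> ('x \<Rightarrow> 'k) set" where
  "fin_funs k S = {\<phi>. (\<forall>x. \<phi> x \<in> carrier k) \<and> finite {x. \<phi> x \<noteq> \<zero>\<^bsub>k\<^esub>} \<and> {x. \<phi> x \<noteq> \<zero>\<^bsub>k\<^esub>} \<subseteq> S}"

definition free_mod :: "'k ring \<Rightarrow> 'x set \<Rightarrow> ('k, 'x \<Rightarrow> 'k) module" where
  "free_mod k S =
     \<lparr>carrier = fin_funs k S, mult = undefined, one = undefined,
      zero = (\<lambda>x. \<zero>\<^bsub>k\<^esub>), add = (\<lambda>\<phi> \<psi> x. \<phi> x \<oplus>\<^bsub>k\<^esub> \<psi> x),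
      smult = (\<lambda>c \<phi> x. c \<otimes>\<^bsub>k\<^esub> \<phi> x)\<rparr>"

definition single :: "'k ring \<Rightarrow> 'x \<Rightarrow> 'x \<Rightarrow> 'k" where
  "single k x = (\<lambda>y. if y = x then \<one>\<^bsub>k\<^esub> else \<zero>\<^bsub>k\<^esub>)"

text \<open>The linear extension of a map \<open>h\<close> of bases.\<close>

definition lin_ext :: "'k ring \<Rightarrow> ('x \<Rightarrow> 'y) \<Rightarrow> ('x \<Rightarrow> 'k) \<Rightarrow> 'y \<Rightarrow> 'k" where
  "lin_ext k h \<phi> = (\<lambda>y. \<Oplus>\<^bsub>k\<^esub>x \<in> {x. \<phi> x \<noteq> \<zero>\<^bsub>k\<^esub> \<and> h x = y}. \<phi> x)"

text \<open>The bilinear extension of an operation \<open>p\<close> on bases.\<close>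

definition bilin_ext ::
  "'k ring \<Rightarrow> ('x \<Rightarrow> 'y \<Rightarrow> 'z) \<Rightarrow> ('x \<Rightarrow> 'k) \<Rightarrow> ('y \<Rightarrow> 'k) \<Rightarrow> 'z \<Rightarrow> 'k" where
  "bilin_ext k p \<phi> \<psi> = (\<lambda>z.
     finsum k (\<lambda>(x, y). \<phi> x \<otimes>\<^bsub>k\<^esub> \<psi> y)
       {(x, y). \<phi> x \<noteq> \<zero>\<^bsub>k\<^esub> \<and> \<psi> y \<noteq> \<zero>\<^bsub>k\<^esub> \<and> p x y = z})"

definition group_algebra :: "'k ring \<Rightarrow> 'g monoid \<Rightarrow> ('g \<Rightarrow> 'k) ring" where
  "group_algebra k G =
     \<lparr>carrier = fin_funs k (carrier G), mult = bilin_ext k (mult G), one = single k (one G),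
      zero = (\<lambda>x. \<zero>\<^bsub>k\<^esub>), add = (\<lambda>\<phi> \<psi> x. \<phi> x \<oplus>\<^bsub>k\<^esub> \<psi> x)\<rparr>"

text \<open>
  For a \<open>k\<close>-algebra \<open>A\<close>, a \<open>k\<close>-module \<open>M\<close> with a right \<open>A\<close>-action \<open>ract\<close> and a left \<open>A\<close>-module \<open>N\<close>,
  the tensor product of \<open>M\<close> and \<open>N\<close> over \<open>A\<close> as a \<open>k\<close>-module: the free \<open>k\<close>-module on pairs modulo
  the usual relations. The relation for scalars in the second argument is a consequence of the
  last two families.
\<close>

definition tensor_rels ::
  "'k ring \<Rightarrow> 'a ring \<Rightarrow> ('k, 'm) module \<Rightarrow> ('m \<Rightarrow> 'a \<Rightarrow> 'm) \<Rightarrow> ('a, 'n) module \<Rightarrow>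
   ('m \<times> 'n \<Rightarrow> 'k) set" where
  "tensor_rels k A M ract N =
     (let F = free_mod k (carrier M \<times> carrier N) in mod_span k F
       ({single k (x \<oplus>\<^bsub>M\<^esub> x', y) \<ominus>\<^bsub>F\<^esub> (single k (x, y) \<oplus>\<^bsub>F\<^esub> single k (x', y)) | x x' y.
           x \<in> carrier M \<and> x' \<in> carrier M \<and> y \<in> carrier N} \<union>
        {single k (x, y \<oplus>\<^bsub>N\<^esub> y') \<ominus>\<^bsub>F\<^esub> (single k (x, y) \<oplus>\<^bsub>F\<^esub> single k (x, y')) | x y y'.
           x \<in> carrier M \<and> y \<in> carrier N \<and> y' \<in> carrier N} \<union>
        {single k (c \<odot>\<^bsub>M\<^esub> x, y) \<ominus>\<^bsub>F\<^esub> c \<odot>\<^bsub>F\<^esub> single k (x, y) | c x y.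
           c \<in> carrier k \<and> x \<in> carrier M \<and> y \<in> carrier N} \<union>
        {single k (ract x a, y) \<ominus>\<^bsub>F\<^esub> single k (x, a \<odot>\<^bsub>N\<^esub> y) | x a y.
           x \<in> carrier M \<and> a \<in> carrier A \<and> y \<in> carrier N}))"

definition tensor ::
  "'k ring \<Rightarrow> 'a ring \<Rightarrow> ('k, 'm) module \<Rightarrow> ('m \<Rightarrow> 'a \<Rightarrow> 'm) \<Rightarrow> ('a, 'n) module \<Rightarrow>
   ('k, ('m \<times> 'n \<Rightarrow> 'k) set) module" where
  "tensor k A M ract N =
     quot_mod (free_mod k (carrier M \<times> carrier N)) (tensor_rels k A M ract N)"


section \<open>Projective covers and primitive idempotents\<close>

definition left_ideal_of :: "'a ring \<Rightarrow> 'a \<Rightarrow> ('a, 'a) module" where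
  "left_ideal_of A e =
     \<lparr>carrier = {a \<otimes>\<^bsub>A\<^esub> e | a. a \<in> carrier A}, mult = undefined, one = undefined,
      zero = \<zero>\<^bsub>A\<^esub>, add = add A, smult = mult A\<rparr>"

definition primitive_idempotent :: "'a ring \<Rightarrow> 'a \<Rightarrow> bool" where
  "primitive_idempotent A e \<longleftrightarrow>
     e \<in> carrier A \<and> e \<otimes>\<^bsub>A\<^esub> e = e \<and> e \<noteq> \<zero>\<^bsub>A\<^esub> \<and>
     \<not> (\<exists>f \<in> carrier A. \<exists>g \<in> carrier A.
          f \<otimes>\<^bsub>A\<^esub> f = f \<and> g \<otimes>\<^bsub>A\<^esub> g = g \<and> f \<otimes>\<^bsub>A\<^esub> g = \<zero>\<^bsub>A\<^esub> \<and> g \<otimes>\<^bsub>A\<^esub> f = \<zero>\<^bsub>A\<^esub> \<and>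
          f \<noteq> \<zero>\<^bsub>A\<^esub> \<and> g \<noteq> \<zero>\<^bsub>A\<^esub> \<and> e = f \<oplus>\<^bsub>A\<^esub> g)"

text \<open>
  Every epimorphism onto \<open>P\<close> splits. The type \<open>'p \<Rightarrow> 'a\<close> of the test modules is large enough, as it
  accommodates the free \<open>A\<close>-module on the set \<open>P\<close>.
\<close>

definition projective_module :: "'a ring \<Rightarrow> ('a, 'p) module \<Rightarrow> bool" where
  "projective_module A P \<longleftrightarrow>
     left_module A P \<and>
     (\<forall>(M :: ('a, 'p \<Rightarrow> 'a) module) f.
        left_module A M \<and> f \<in> mod_hom A M P \<and> f ` carrier M = carrier P \<longrightarrow>
        (\<exists>s \<in> mod_hom A P M. \<forall>x \<in> carrier P. f (s x) = x))"

definition projective_cover :: "'a ring \<Rightarrow> ('a, 'p) module \<Rightarrow> ('a, 'v) module \<Rightarrow> bool" where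
  "projective_cover A P M \<longleftrightarrow>
     projective_module A P \<and>
     (\<exists>\<pi> \<in> mod_hom A P M. \<pi> ` carrier P = carrier M \<and>
        (\<forall>W. submodule W A P \<and> \<pi> ` W = carrier M \<longrightarrow> W = carrier P))"

definition covering_idempotent :: "'a ring \<Rightarrow> ('a, 'v) module \<Rightarrow> 'a \<Rightarrow> bool" where
  "covering_idempotent A lam e \<longleftrightarrow>
     primitive_idempotent A e \<and> projective_cover A (left_ideal_of A e) lam"


section \<open>Modules over a category\<close>

text \<open>
  \<open>Mor V m n f\<close> is the map \<open>V([m]) \<rightarrow> V([n])\<close> induced by \<open>f : [m] \<rightarrow> [n]\<close>; the indices are needed
  because \<open>f\<close>, as a function, does not determine its target.
\<close>

record ('k, 'v) cmod =
  Ob :: "nat \<Rightarrow> ('k, 'v) module"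
  Mor :: "nat \<Rightarrow> nat \<Rightarrow> (nat \<Rightarrow> nat) \<Rightarrow> 'v \<Rightarrow> 'v"

definition cmodule :: "'k ring \<Rightarrow> cat \<Rightarrow> ('k, 'v) cmod \<Rightarrow> bool" where
  "cmodule k C V \<longleftrightarrow>
     (\<forall>n\<ge>1. module k (Ob V n)) \<and>
     (\<forall>m\<ge>1. \<forall>n\<ge>1. \<forall>f \<in> C m n. Mor V m n f \<in> mod_hom k (Ob V m) (Ob V n)) \<and>
     (\<forall>n\<ge>1. \<forall>x \<in> carrier (Ob V n). Mor V n n (\<lambda>i\<in>{1..n}. i) x = x) \<and>
     (\<forall>l\<ge>1. \<forall>m\<ge>1. \<forall>n\<ge>1. \<forall>f \<in> C l m. \<forall>g \<in> C m n. \<forall>x \<in> carrier (Ob V l).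
        Mor V l n (compose {1..l} g f) x = Mor V m n g (Mor V l m f x))"

definition cmod_hom ::
  "'k ring \<Rightarrow> cat \<Rightarrow> ('k, 'v) cmod \<Rightarrow> ('k, 'w) cmod \<Rightarrow> (nat \<Rightarrow> 'v \<Rightarrow> 'w) set" where
  "cmod_hom k C V W =
     {t. (\<forall>n\<ge>1. t n \<in> mod_hom k (Ob V n) (Ob W n)) \<and>
         (\<forall>m\<ge>1. \<forall>n\<ge>1. \<forall>f \<in> C m n. \<forall>x \<in> carrier (Ob V m).
            t n (Mor V m n f x) = Mor W m n f (t m x))}"

definition cmod_iso :: "'k ring \<Rightarrow> cat \<Rightarrow> ('k, 'v) cmod \<Rightarrow> ('k, 'w) cmod \<Rightarrow> bool" where
  "cmod_iso k C V W \<longleftrightarrow>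
     (\<exists>t \<in> cmod_hom k C V W. \<forall>n\<ge>1. bij_betw (t n) (carrier (Ob V n)) (carrier (Ob W n)))"

definition csubmodule :: "'k ring \<Rightarrow> cat \<Rightarrow> ('k, 'v) cmod \<Rightarrow> (nat \<Rightarrow> 'v set) \<Rightarrow> bool" where
  "csubmodule k C V W \<longleftrightarrow>
     (\<forall>n\<ge>1. submodule (W n) k (Ob V n)) \<and>
     (\<forall>m\<ge>1. \<forall>n\<ge>1. \<forall>f \<in> C m n. Mor V m n f ` W m \<subseteq> W n)"

definition irreducible_cmodule :: "'k ring \<Rightarrow> cat \<Rightarrow> ('k, 'v) cmod \<Rightarrow> bool" where
  "irreducible_cmodule k C V \<longleftrightarrow>
     cmodule k C V \<and>
     (\<exists>n\<ge>1. carrier (Ob V n) \<noteq> {\<zero>\<^bsub>Ob V n\<^esub>}) \<and>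
     (\<forall>W. csubmodule k C V W \<longrightarrow>
        (\<forall>n\<ge>1. W n = {\<zero>\<^bsub>Ob V n\<^esub>}) \<or> (\<forall>n\<ge>1. W n = carrier (Ob V n)))"

definition cmod_quot :: "('k, 'v) cmod \<Rightarrow> (nat \<Rightarrow> 'v set) \<Rightarrow> ('k, 'v set) cmod" where
  "cmod_quot V W =
     \<lparr>Ob = (\<lambda>n. quot_mod (Ob V n) (W n)),
      Mor = (\<lambda>m n f. quot_map (Ob V n) (W n) (Mor V m n f))\<rparr>"

definition maximal_csubmodule :: "'k ring \<Rightarrow> cat \<Rightarrow> ('k, 'v) cmod \<Rightarrow> (nat \<Rightarrow> 'v set) \<Rightarrow> bool" where
  "maximal_csubmodule k C V W \<longleftrightarrow>
     csubmodule k C V W \<and> \<not> (\<forall>n\<ge>1. W n = carrier (Ob V n)) \<and>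
     (\<forall>U. csubmodule k C V U \<and> (\<forall>n\<ge>1. W n \<subseteq> U n) \<longrightarrow>
        (\<forall>n\<ge>1. U n = W n) \<or> (\<forall>n\<ge>1. U n = carrier (Ob V n)))"

definition cmod_rad :: "'k ring \<Rightarrow> cat \<Rightarrow> ('k, 'v) cmod \<Rightarrow> nat \<Rightarrow> 'v set" where
  "cmod_rad k C V n = {x \<in> carrier (Ob V n). \<forall>W. maximal_csubmodule k C V W \<longrightarrow> x \<in> W n}"

definition cmod_top :: "'k ring \<Rightarrow> cat \<Rightarrow> ('k, 'v) cmod \<Rightarrow> ('k, 'v set) cmod" where
  "cmod_top k C V = cmod_quot V (cmod_rad k C V)"


section \<open>Standard modules\<close>

definition Pmod :: "'k ring \<Rightarrow> cat \<Rightarrow> nat \<Rightarrow> ('k, (nat \<Rightarrow> nat) \<Rightarrow> 'k) cmod" where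
  "Pmod k C n =
     \<lparr>Ob = (\<lambda>m. free_mod k (C n m)), Mor = (\<lambda>m l f. lin_ext k (compose {1..n} f))\<rparr>"

definition noninj :: "'k ring \<Rightarrow> cat \<Rightarrow> nat \<Rightarrow> nat \<Rightarrow> ((nat \<Rightarrow> nat) \<Rightarrow> 'k) set" where
  "noninj k C n m =
     mod_span k (Ob (Pmod k C n) m) {single k h | h. h \<in> C n m \<and> \<not> inj_on h {1..n}}"

definition Delta :: "'k ring \<Rightarrow> cat \<Rightarrow> nat \<Rightarrow> ('k, ((nat \<Rightarrow> nat) \<Rightarrow> 'k) set) cmod" where
  "Delta k C n = cmod_quot (Pmod k C n) (noninj k C n)"

text \<open>The right action of \<open>k G\<^sub>n\<close> on \<open>\<Delta>\<^sub>n([m])\<close>, induced by precomposition.\<close>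

definition Delta_ract ::
  "'k ring \<Rightarrow> cat \<Rightarrow> nat \<Rightarrow> nat \<Rightarrow>
   ((nat \<Rightarrow> nat) \<Rightarrow> 'k) set \<Rightarrow> ((nat \<Rightarrow> nat) \<Rightarrow> 'k) \<Rightarrow> ((nat \<Rightarrow> nat) \<Rightarrow> 'k) set" where
  "Delta_ract k C n m X a =
     quot_map (Ob (Pmod k C n) m) (noninj k C n m) (\<lambda>\<phi>. bilin_ext k (compose {1..n}) \<phi> a) X"

text \<open>The functor \<open>\<Delta>\<^sub>n \<otimes> N\<close>, tensor product over \<open>k G\<^sub>n\<close>, for a left \<open>k G\<^sub>n\<close>-module \<open>N\<close>.\<close>

definition Delta_tensor ::
  "'k ring \<Rightarrow> cat \<Rightarrow> nat \<Rightarrow> ((nat \<Rightarrow> nat) \<Rightarrow> 'k, 'n) module \<Rightarrow>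
   ('k, (((nat \<Rightarrow> nat) \<Rightarrow> 'k) set \<times> 'n \<Rightarrow> 'k) set) cmod" where
  "Delta_tensor k C n N =
     (let A = group_algebra k (aut C n); D = Delta k C n in
      \<lparr>Ob = (\<lambda>m. tensor k A (Ob D m) (Delta_ract k C n m) N),
       Mor = (\<lambda>m l f.
         quot_map (free_mod k (carrier (Ob D l) \<times> carrier N))
                  (tensor_rels k A (Ob D l) (Delta_ract k C n l) N)
                  (lin_ext k (\<lambda>(x, y). (Mor D m l f x, y))))\<rparr>)"

text \<open>
  In the next two definitions, \<open>e\<close> is the idempotent chosen for \<open>\<lambda>\<close>: the module
  \<open>Delta_proj k C n e\<close> is \<open>\<Delta>\<^bsub>n,\<lambda>\<^esub>\<close>, and singularity of \<open>\<lambda>\<close> is defined through it.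
\<close>

definition Delta_proj ::
  "'k ring \<Rightarrow> cat \<Rightarrow> nat \<Rightarrow> ((nat \<Rightarrow> nat) \<Rightarrow> 'k) \<Rightarrow>
   ('k, (((nat \<Rightarrow> nat) \<Rightarrow> 'k) set \<times> ((nat \<Rightarrow> nat) \<Rightarrow> 'k) \<Rightarrow> 'k) set) cmod" where
  "Delta_proj k C n e = Delta_tensor k C n (left_ideal_of (group_algebra k (aut C n)) e)"

definition singular :: "'k ring \<Rightarrow> cat \<Rightarrow> nat \<Rightarrow> ((nat \<Rightarrow> nat) \<Rightarrow> 'k) \<Rightarrow> bool" where
  "singular k C n e \<longleftrightarrow>
     (\<exists>t \<in> cmod_hom k C (Delta k C (n + 1)) (Delta_proj k C n e).
        \<exists>m\<ge>1. \<exists>x \<in> carrier (Ob (Delta k C (n + 1)) m). t m x \<noteq> \<zero>\<^bsub>Ob (Delta_proj k C n e) m\<^esub>)"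

abbreviation regular :: "'k ring \<Rightarrow> cat \<Rightarrow> nat \<Rightarrow> ((nat \<Rightarrow> nat) \<Rightarrow> 'k) \<Rightarrow> bool" where
  "regular k C n e \<equiv> \<not> singular k C n e"

abbreviation Delta_bar ::
  "'k ring \<Rightarrow> cat \<Rightarrow> nat \<Rightarrow> ((nat \<Rightarrow> nat) \<Rightarrow> 'k, 'w) module \<Rightarrow>
   ('k, (((nat \<Rightarrow> nat) \<Rightarrow> 'k) set \<times> 'w \<Rightarrow> 'k) set) cmod" where
  "Delta_bar k C n lam \<equiv> Delta_tensor k C n lam"

end

theory Submission
  imports Defs
begin

text \<open>
  Write \<open>T\<close> for the functor \<open>\<Delta>\<^sub>n \<otimes> N\<close>. Since \<open>G\<^sub>n\<close> acts freely on injections, an element of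
  \<open>T([m])\<close> is determined by its coordinates in \<open>N\<close> at the injections \<open>[n] \<rightarrow> [m]\<close>. If \<open>N = \<lambda>\<close> is
  irreducible, then \<open>T\<close> is generated by each nonzero element of \<open>T([n]) = \<lambda>\<close>, so the elements killed
  by all morphisms to \<open>[n]\<close> form the largest proper submodule \<open>K\<close>; hence the top of \<open>T\<close> is irreducible.
  An irreducible module is recovered from its lowest nonzero degree, because the submodule of
  \<open>V \<oplus> V'\<close> generated by the graph of an isomorphism in that degree is again a graph.

  It remains to see that \<open>K \<noteq> 0\<close> makes \<open>\<lambda>\<close> singular. All five categories contain the collapses of
  two adjacent points, and an element of degree at least \<open>n + 2\<close> killed by them is zero; so \<open>K\<close> is
  already nonzero in degree \<open>n + 1\<close>. The group algebra is symmetric, so \<open>\<lambda>\<close> embeds into its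
  projective cover and \<open>\<Delta>\<^bsub>n,\<lambda>\<^esub>\<close> has a nonzero element of degree \<open>n + 1\<close> killed by all noninjective
  morphisms. Such an element is a nonzero homomorphism from \<open>\<Delta>\<^bsub>n+1\<^esub>\<close>.
\<close>

section \<open>Left modules, homomorphisms and quotients\<close>

text \<open>The five categories enter only through three properties: they contain all weakly
  monotone maps, their morphisms are maps between the sets \<open>{1..n}\<close>, and they are
  closed under composition (\<open>shape_category\<close>). These already imply that injective
  endomorphisms are automorphisms and that every noninjective morphism out of \<open>[m]\<close>
  factors through some \<open>[r]\<close> with \<open>r < m\<close>. The factorization is the reason
  why an element of \<open>K\<close> of degree \<open>n + 1\<close> is killed by all noninjective
  morphisms: they pass through degrees below \<open>n\<close>, where \<open>T\<close> is zero, or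
  through degree \<open>n\<close>, where \<open>K\<close> is zero. Singularity refers to the tensor
  product with the projective cover, whereas \<open>K\<close> lives in the tensor product with
  \<lambda> itself. The embedding of \<lambda> into its cover bridges the two, and coordinates show
  that tensoring keeps this embedding injective. The irreducible module attached to a pair is taken
  to be the top in both cases, so only the regular case calls for an argument: there
  \<open>K\<close> is zero and the top is the module itself.\<close>

locale lmodule = left_module A M for A :: "'a ring" (structure) and M :: "('a, 'v) module" (structure)
begin

lemma left_module_axioms': "left_module A M"
  by unfold_locales

lemma smult_l_zero [simp]: "x \<in> carrier M \<Longrightarrow> \<zero>\<^bsub>A\<^esub> \<odot>\<^bsub>M\<^esub> x = \<zero>\<^bsub>M\<^esub>"
  using smult_l_distr[of "\<zero>\<^bsub>A\<^esub>" "\<zero>\<^bsub>A\<^esub>" x] smult_closed[of "\<zero>\<^bsub>A\<^esub>" x]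
  by (metis M.add.l_cancel_one R.l_zero R.zero_closed)

lemma smult_r_zero [simp]: "a \<in> carrier A \<Longrightarrow> a \<odot>\<^bsub>M\<^esub> \<zero>\<^bsub>M\<^esub> = \<zero>\<^bsub>M\<^esub>"
  using smult_r_distr[of a "\<zero>\<^bsub>M\<^esub>" "\<zero>\<^bsub>M\<^esub>"] smult_closed[of a "\<zero>\<^bsub>M\<^esub>"]
  by (metis M.add.l_cancel_one M.l_zero M.zero_closed)

lemma smult_minus_one: "x \<in> carrier M \<Longrightarrow> (\<ominus>\<^bsub>A\<^esub> \<one>\<^bsub>A\<^esub>) \<odot>\<^bsub>M\<^esub> x = \<ominus>\<^bsub>M\<^esub> x"
proof -
  assume x: "x \<in> carrier M"
  have "(\<ominus>\<^bsub>A\<^esub> \<one>\<^bsub>A\<^esub>) \<odot>\<^bsub>M\<^esub> x \<oplus>\<^bsub>M\<^esub> x = (\<ominus>\<^bsub>A\<^esub> \<one>\<^bsub>A\<^esub> \<oplus>\<^bsub>A\<^esub> \<one>\<^bsub>A\<^esub>) \<odot>\<^bsub>M\<^esub> x"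
    using x by (simp add: smult_l_distr smult_one del: R.l_neg)
  also have "\<dots> = \<zero>\<^bsub>M\<^esub>"
    using x by (simp add: R.l_neg)
  finally show ?thesis
    using x by (simp add: M.minus_equality smult_closed)
qed

lemma diff_eq_zero_iff: "x \<in> carrier M \<Longrightarrow> y \<in> carrier M \<Longrightarrow> x \<ominus>\<^bsub>M\<^esub> y = \<zero>\<^bsub>M\<^esub> \<longleftrightarrow> x = y"
  by (metis M.add.inv_solve_right' M.l_zero M.minus_eq M.zero_closed)

text \<open>Closure under negation comes from multiplication by the scalar -1.\<close>

lemma left_submoduleI:
  assumes "W \<subseteq> carrier M" "\<zero>\<^bsub>M\<^esub> \<in> W"
    and "\<And>x y. x \<in> W \<Longrightarrow> y \<in> W \<Longrightarrow> x \<oplus>\<^bsub>M\<^esub> y \<in> W"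
    and "\<And>a x. a \<in> carrier A \<Longrightarrow> x \<in> W \<Longrightarrow> a \<odot>\<^bsub>M\<^esub> x \<in> W"
  shows "submodule W A M"
proof -
  have "\<ominus>\<^bsub>M\<^esub> x \<in> W" if "x \<in> W" for x
    using assms(1) assms(4)[of "\<ominus>\<^bsub>A\<^esub> \<one>\<^bsub>A\<^esub>" x] that by (auto simp: smult_minus_one)
  then show ?thesis
    using assms by unfold_locales (auto simp: a_inv_def)
qed

lemma left_submoduleD:
  assumes "submodule W A M"
  shows "W \<subseteq> carrier M" "\<zero>\<^bsub>M\<^esub> \<in> W"
    and "\<And>x y. x \<in> W \<Longrightarrow> y \<in> W \<Longrightarrow> x \<oplus>\<^bsub>M\<^esub> y \<in> W"
    and "\<And>a x. a \<in> carrier A \<Longrightarrow> x \<in> W \<Longrightarrow> a \<odot>\<^bsub>M\<^esub> x \<in> W"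
    and "\<And>x. x \<in> W \<Longrightarrow> \<ominus>\<^bsub>M\<^esub> x \<in> W"
    and "\<And>x y. x \<in> W \<Longrightarrow> y \<in> W \<Longrightarrow> x \<ominus>\<^bsub>M\<^esub> y \<in> W"
proof -
  interpret W: submodule W A M by fact
  show "W \<subseteq> carrier M" "\<zero>\<^bsub>M\<^esub> \<in> W"
    "\<And>x y. x \<in> W \<Longrightarrow> y \<in> W \<Longrightarrow> x \<oplus>\<^bsub>M\<^esub> y \<in> W"
    "\<And>a x. a \<in> carrier A \<Longrightarrow> x \<in> W \<Longrightarrow> a \<odot>\<^bsub>M\<^esub> x \<in> W"
    using W.subset W.one_closed W.m_closed W.smult_closed by auto
  show neg: "\<And>x. x \<in> W \<Longrightarrow> \<ominus>\<^bsub>M\<^esub> x \<in> W"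
    using W.m_inv_closed by (simp add: a_inv_def)
  show "\<And>x y. x \<in> W \<Longrightarrow> y \<in> W \<Longrightarrow> x \<ominus>\<^bsub>M\<^esub> y \<in> W"
    using neg W.m_closed by (simp add: a_minus_def)
qed

lemma submodule_zero: "submodule {\<zero>\<^bsub>M\<^esub>} A M"
  by (rule left_submoduleI) auto

lemma submodule_carrier: "submodule (carrier M) A M"
  by (rule left_submoduleI) (auto simp: smult_closed)

lemma mod_span_superset: "S \<subseteq> mod_span A M S"
  by (auto simp: mod_span_def)

lemma mod_span_least: "submodule W A M \<Longrightarrow> S \<subseteq> W \<Longrightarrow> mod_span A M S \<subseteq> W"
  by (auto simp: mod_span_def)

lemma submodule_mod_span: "S \<subseteq> carrier M \<Longrightarrow> submodule (mod_span A M S) A M"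
proof (rule left_submoduleI)
  assume "S \<subseteq> carrier M"
  then show "mod_span A M S \<subseteq> carrier M"
    by (intro mod_span_least submodule_carrier)
qed (auto simp: mod_span_def dest: left_submoduleD)

section \<open>Cosets and quotient modules\<close>

lemma coset_eq_iff:
  assumes "submodule W A M" "x \<in> carrier M" "y \<in> carrier M"
  shows "W +>\<^bsub>M\<^esub> x = W +>\<^bsub>M\<^esub> y \<longleftrightarrow> x \<ominus>\<^bsub>M\<^esub> y \<in> W"
proof -
  note W = left_submoduleD[OF assms(1)]
  interpret W: submodule W A M by fact
  have sg: "subgroup W (add_monoid M)" ..
  show ?thesis
  proof
    assume "W +>\<^bsub>M\<^esub> x = W +>\<^bsub>M\<^esub> y"
    moreover have "x \<in> W +>\<^bsub>M\<^esub> x"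
      using W(2) assms(2) by (auto simp: a_r_coset_def' intro!: bexI[of _ "\<zero>\<^bsub>M\<^esub>"])
    ultimately obtain w where "w \<in> W" "x = w \<oplus>\<^bsub>M\<^esub> y"
      by (auto simp: a_r_coset_def')
    then show "x \<ominus>\<^bsub>M\<^esub> y \<in> W"
      using W(1) assms(3) by (auto simp: M.minus_eq M.a_assoc M.r_neg)
  next
    assume *: "x \<ominus>\<^bsub>M\<^esub> y \<in> W"
    have "x = (x \<ominus>\<^bsub>M\<^esub> y) \<oplus>\<^bsub>M\<^esub> y"
      using assms by (simp add: M.minus_eq M.a_assoc M.l_neg)
    then have "x \<in> W +>\<^bsub>M\<^esub> y"
      using * by (auto simp: a_r_coset_def')
    then show "W +>\<^bsub>M\<^esub> x = W +>\<^bsub>M\<^esub> y"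
      using M.a_repr_independence[OF _ assms(3) sg] by simp
  qed
qed

lemma coset_self:
  "submodule W A M \<Longrightarrow> x \<in> carrier M \<Longrightarrow> x \<in> W +>\<^bsub>M\<^esub> x"
  using left_submoduleD(2) by (auto simp: a_r_coset_def' intro!: bexI[of _ "\<zero>\<^bsub>M\<^esub>"])

lemma coset_memD:
  assumes "submodule W A M" "x \<in> carrier M" "y \<in> W +>\<^bsub>M\<^esub> x"
  shows "y \<in> carrier M" "y \<ominus>\<^bsub>M\<^esub> x \<in> W" "W +>\<^bsub>M\<^esub> y = W +>\<^bsub>M\<^esub> x"
proof -
  obtain w where w: "w \<in> W" "y = w \<oplus>\<^bsub>M\<^esub> x"
    using assms(3) by (auto simp: a_r_coset_def')
  then show "y \<in> carrier M" "y \<ominus>\<^bsub>M\<^esub> x \<in> W"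
    using left_submoduleD(1)[OF assms(1)] assms(2)
    by (auto simp: M.minus_eq M.a_assoc M.r_neg)
  then show "W +>\<^bsub>M\<^esub> y = W +>\<^bsub>M\<^esub> x"
    using assms coset_eq_iff by blast
qed

lemma carrier_quot_mod: "carrier (quot_mod M W) = (\<lambda>x. W +>\<^bsub>M\<^esub> x) ` carrier M"
  by (auto simp: quot_mod_def A_RCOSETS_def')

lemma zero_quot_mod: "\<zero>\<^bsub>quot_mod M W\<^esub> = W"
  by (simp add: quot_mod_def)

lemma coset_zero: "submodule W A M \<Longrightarrow> W +>\<^bsub>M\<^esub> \<zero>\<^bsub>M\<^esub> = W"
  by (simp add: left_submoduleD(1))

lemma coset_eq_zero_iff:
  assumes "submodule W A M" "x \<in> carrier M"
  shows "W +>\<^bsub>M\<^esub> x = W \<longleftrightarrow> x \<in> W"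
proof -
  have "\<ominus>\<^bsub>M\<^esub> \<zero>\<^bsub>M\<^esub> = \<zero>\<^bsub>M\<^esub>"
    by (rule M.minus_equality) auto
  then have "x \<ominus>\<^bsub>M\<^esub> \<zero>\<^bsub>M\<^esub> = x"
    using assms(2) M.r_zero by (metis M.minus_eq)
  then show ?thesis
    using coset_eq_iff[OF assms, of "\<zero>\<^bsub>M\<^esub>"] coset_zero[OF assms(1)] by simp
qed

lemma abelian_subgroup_submodule: "submodule W A M \<Longrightarrow> abelian_subgroup W M"
  by (intro abelian_subgroupI3 additive_subgroupI M.abelian_group_axioms)
    (simp add: submodule_def)

lemma add_quot_mod:
  "submodule W A M \<Longrightarrow> x \<in> carrier M \<Longrightarrow> y \<in> carrier M \<Longrightarrow>
   (W +>\<^bsub>M\<^esub> x) \<oplus>\<^bsub>quot_mod M W\<^esub> (W +>\<^bsub>M\<^esub> y) = W +>\<^bsub>M\<^esub> (x \<oplus>\<^bsub>M\<^esub> y)"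
  by (simp add: quot_mod_def abelian_subgroup.a_rcos_sum[OF abelian_subgroup_submodule])

end

text \<open>All cosets in the union agree because members of a coset differ by an element of
  \<open>W\<close>. Only additivity of \<open>f\<close> is assumed: multiplication by a fixed
  element of a noncommutative ring is additive but in general not linear, and it has to pass to the
  quotient too.\<close>

lemma quot_map_coset:
  fixes A :: "'a ring" and B :: "'b ring" and M :: "('a, 'v) module" and N :: "('b, 'w) module"
  assumes M: "left_module A M" "submodule W A M" and N: "left_module B N" "submodule W' B N"
    and f: "f \<in> carrier M \<rightarrow> carrier N"
      "\<And>x y. x \<in> carrier M \<Longrightarrow> y \<in> carrier M \<Longrightarrow> f (x \<oplus>\<^bsub>M\<^esub> y) = f x \<oplus>\<^bsub>N\<^esub> f y" "f ` W \<subseteq> W'"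
    and x: "x \<in> carrier M"
  shows "quot_map N W' f (W +>\<^bsub>M\<^esub> x) = W' +>\<^bsub>N\<^esub> f x"
proof -
  interpret M: lmodule A M by (rule lmodule.intro) fact
  interpret N: lmodule B N by (rule lmodule.intro) fact
  have "W' +>\<^bsub>N\<^esub> f y = W' +>\<^bsub>N\<^esub> f x" if y: "y \<in> W +>\<^bsub>M\<^esub> x" for y
  proof -
    obtain w where w: "w \<in> W" "y = w \<oplus>\<^bsub>M\<^esub> x"
      using y by (auto simp: a_r_coset_def')
    then have "w \<in> carrier M"
      using M.left_submoduleD(1)[OF M(2)] by auto
    then have "f y = f w \<oplus>\<^bsub>N\<^esub> f x" "f w \<in> W'" "f w \<in> carrier N" "f x \<in> carrier N"
      using w x f by auto
    then show ?thesis
      using N.coset_eq_iff[OF N(2), of "f y" "f x"]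
      by (simp add: N.M.minus_eq N.M.a_assoc N.M.r_neg)
  qed
  moreover have "x \<in> W +>\<^bsub>M\<^esub> x"
    using M.coset_self[OF M(2) x] .
  ultimately show ?thesis
    unfolding quot_map_def by blast
qed

context lmodule
begin

lemma smult_quot_mod:
  "submodule W A M \<Longrightarrow> a \<in> carrier A \<Longrightarrow> x \<in> carrier M \<Longrightarrow>
   a \<odot>\<^bsub>quot_mod M W\<^esub> (W +>\<^bsub>M\<^esub> x) = W +>\<^bsub>M\<^esub> (a \<odot>\<^bsub>M\<^esub> x)"
  using quot_map_coset[OF left_module_axioms' _ left_module_axioms', of W W "\<lambda>x. a \<odot>\<^bsub>M\<^esub> x" x]
  by (auto simp: quot_mod_def smult_closed smult_r_distr dest: left_submoduleD)

lemma left_module_quot_mod: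
  assumes W: "submodule W A M"
  shows "left_module A (quot_mod M W)"
proof -
  note simps = carrier_quot_mod smult_quot_mod[OF W] add_quot_mod[OF W]
  have z: "\<zero>\<^bsub>quot_mod M W\<^esub> = W +>\<^bsub>M\<^esub> \<zero>\<^bsub>M\<^esub>"
    using coset_zero[OF W] by (simp add: zero_quot_mod)
  have "abelian_group (quot_mod M W)"
  proof (rule abelian_groupI)
    fix X assume "X \<in> carrier (quot_mod M W)"
    then obtain x where x: "x \<in> carrier M" "X = W +>\<^bsub>M\<^esub> x"
      by (auto simp: simps)
    then have "(W +>\<^bsub>M\<^esub> (\<ominus>\<^bsub>M\<^esub> x)) \<oplus>\<^bsub>quot_mod M W\<^esub> X = \<zero>\<^bsub>quot_mod M W\<^esub>"
      by (simp add: simps z M.l_neg)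
    then show "\<exists>Y\<in>carrier (quot_mod M W). Y \<oplus>\<^bsub>quot_mod M W\<^esub> X = \<zero>\<^bsub>quot_mod M W\<^esub>"
      using x by (intro bexI[of _ "W +>\<^bsub>M\<^esub> (\<ominus>\<^bsub>M\<^esub> x)"]) (auto simp: simps)
  qed (auto simp: z simps M.a_ac)
  then interpret Q: abelian_group "quot_mod M W" .
  show ?thesis
    by unfold_locales
      (auto simp: carrier_quot_mod smult_quot_mod[OF W] add_quot_mod[OF W] smult_closed
        smult_l_distr smult_r_distr smult_assoc smult_one)
qed

lemma quot_proj_hom: "submodule W A M \<Longrightarrow> (\<lambda>x. W +>\<^bsub>M\<^esub> x) \<in> mod_hom A M (quot_mod M W)"
  by (auto simp: mod_hom_def carrier_quot_mod add_quot_mod smult_quot_mod)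

end

section \<open>Homomorphisms, images, preimages and induced maps of quotients\<close>

lemma mod_homD:
  assumes "f \<in> mod_hom A M N"
  shows "x \<in> carrier M \<Longrightarrow> f x \<in> carrier N"
    and "x \<in> carrier M \<Longrightarrow> y \<in> carrier M \<Longrightarrow> f (x \<oplus>\<^bsub>M\<^esub> y) = f x \<oplus>\<^bsub>N\<^esub> f y"
    and "a \<in> carrier A \<Longrightarrow> x \<in> carrier M \<Longrightarrow> f (a \<odot>\<^bsub>M\<^esub> x) = a \<odot>\<^bsub>N\<^esub> f x"
  using assms by (auto simp: mod_hom_def)

lemma mod_homI:
  assumes "\<And>x. x \<in> carrier M \<Longrightarrow> f x \<in> carrier N"
    and "\<And>x y. x \<in> carrier M \<Longrightarrow> y \<in> carrier M \<Longrightarrow> f (x \<oplus>\<^bsub>M\<^esub> y) = f x \<oplus>\<^bsub>N\<^esub> f y"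
    and "\<And>a x. a \<in> carrier A \<Longrightarrow> x \<in> carrier M \<Longrightarrow> f (a \<odot>\<^bsub>M\<^esub> x) = a \<odot>\<^bsub>N\<^esub> f x"
  shows "f \<in> mod_hom A M N"
  using assms by (auto simp: mod_hom_def)

lemma mod_hom_zero:
  assumes "left_module A M" "left_module A N" "f \<in> mod_hom A M N"
  shows "f \<zero>\<^bsub>M\<^esub> = \<zero>\<^bsub>N\<^esub>"
proof -
  interpret M: lmodule A M by (rule lmodule.intro) fact
  interpret N: lmodule A N by (rule lmodule.intro) fact
  show ?thesis
    using mod_homD(3)[OF assms(3), of "\<zero>\<^bsub>A\<^esub>" "\<zero>\<^bsub>M\<^esub>"] mod_homD(1)[OF assms(3), of "\<zero>\<^bsub>M\<^esub>"] by simp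
qed

lemma mod_hom_minus:
  assumes "left_module A M" "left_module A N" "f \<in> mod_hom A M N" "x \<in> carrier M" "y \<in> carrier M"
  shows "f (x \<ominus>\<^bsub>M\<^esub> y) = f x \<ominus>\<^bsub>N\<^esub> f y"
proof -
  interpret M: lmodule A M by (rule lmodule.intro) fact
  interpret N: lmodule A N by (rule lmodule.intro) fact
  have "f (\<ominus>\<^bsub>M\<^esub> y) = \<ominus>\<^bsub>N\<^esub> f y"
    using assms mod_homD[OF assms(3)] by (simp flip: M.smult_minus_one N.smult_minus_one)
  then show ?thesis
    using assms mod_homD[OF assms(3)] by (simp add: M.M.minus_eq N.M.minus_eq)
qed

lemma mod_hom_finsum:
  assumes "left_module A M" "left_module A N" "f \<in> mod_hom A M N" "finite I"
    and "\<And>i. i \<in> I \<Longrightarrow> u i \<in> carrier M"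
  shows "f (finsum M u I) = finsum N (\<lambda>i. f (u i)) I"
proof -
  interpret M: lmodule A M by (rule lmodule.intro) fact
  interpret N: lmodule A N by (rule lmodule.intro) fact
  show ?thesis
    using assms(4,5)
    by (induction I)
      (auto simp: mod_hom_zero[OF assms(1-3)] mod_homD[OF assms(3)] Pi_def)
qed

lemma mod_hom_comp:
  "f \<in> mod_hom A M N \<Longrightarrow> g \<in> mod_hom A N P \<Longrightarrow> (\<lambda>x. g (f x)) \<in> mod_hom A M P"
  by (auto simp: mod_hom_def Pi_def)

lemma submodule_vimage:
  assumes "left_module A M" "left_module A N" "f \<in> mod_hom A M N" "submodule W A N"
  shows "submodule {x \<in> carrier M. f x \<in> W} A M"
proof -
  interpret M: lmodule A M by (rule lmodule.intro) fact
  interpret N: lmodule A N by (rule lmodule.intro) fact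
  show ?thesis
    using N.left_submoduleD[OF assms(4)] mod_homD[OF assms(3)] mod_hom_zero[OF assms(1-3)]
    by (intro M.left_submoduleI) (auto simp: M.smult_closed)
qed

lemma submodule_image:
  assumes "left_module A M" "left_module A N" "f \<in> mod_hom A M N" "submodule W A M"
  shows "submodule (f ` W) A N"
proof -
  interpret M: lmodule A M by (rule lmodule.intro) fact
  interpret N: lmodule A N by (rule lmodule.intro) fact
  note W = M.left_submoduleD[OF assms(4)]
  show ?thesis
  proof (rule N.left_submoduleI)
    show "f ` W \<subseteq> carrier N"
      using W(1) mod_homD(1)[OF assms(3)] by auto
    show "\<zero>\<^bsub>N\<^esub> \<in> f ` W"
      using W(2) mod_hom_zero[OF assms(1-3)] by force
    fix x y assume "x \<in> f ` W" "y \<in> f ` W"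
    then obtain u v where "u \<in> W" "v \<in> W" "x = f u" "y = f v" by auto
    then show "x \<oplus>\<^bsub>N\<^esub> y \<in> f ` W"
      using mod_homD(2)[OF assms(3), of u v] W(1) W(3)[of u v] by force
  next
    fix a x assume "a \<in> carrier A" "x \<in> f ` W"
    then obtain u where "u \<in> W" "x = f u" by auto
    then show "a \<odot>\<^bsub>N\<^esub> x \<in> f ` W"
      using mod_homD(3)[OF assms(3), of a u] W(1) W(4)[of a u] \<open>a \<in> carrier A\<close> by force
  qed
qed

lemma quot_map_hom:
  assumes M: "left_module A M" "submodule W A M" and N: "left_module A N" "submodule W' A N"
    and f: "f \<in> mod_hom A M N" "f ` W \<subseteq> W'"
  shows "quot_map N W' f \<in> mod_hom A (quot_mod M W) (quot_mod N W')"
    and "x \<in> carrier M \<Longrightarrow> quot_map N W' f (W +>\<^bsub>M\<^esub> x) = W' +>\<^bsub>N\<^esub> f x"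
proof -
  interpret M: lmodule A M by (rule lmodule.intro) fact
  interpret N: lmodule A N by (rule lmodule.intro) fact
  have *: "quot_map N W' f (W +>\<^bsub>M\<^esub> x) = W' +>\<^bsub>N\<^esub> f x" if "x \<in> carrier M" for x
    using that mod_homD[OF f(1)] f(2) by (intro quot_map_coset[OF M N]) auto
  show "quot_map N W' f \<in> mod_hom A (quot_mod M W) (quot_mod N W')"
    using mod_homD[OF f(1)]
    by (intro mod_homI)
      (auto simp: M.carrier_quot_mod N.carrier_quot_mod * M.add_quot_mod[OF M(2)]
        N.add_quot_mod[OF N(2)] M.smult_quot_mod[OF M(2)] N.smult_quot_mod[OF N(2)] M.smult_closed)
  show "x \<in> carrier M \<Longrightarrow> quot_map N W' f (W +>\<^bsub>M\<^esub> x) = W' +>\<^bsub>N\<^esub> f x"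
    by (rule *)
qed

text \<open>Universal property of the quotient. The map \<open>h\<close> evaluates \<open>f\<close>
  at a chosen representative; two representatives differ by an element of \<open>W\<close>, where
  \<open>f\<close> vanishes.\<close>

lemma quot_lift:
  assumes M: "left_module A M" "submodule W A M" and N: "left_module A N"
    and f: "f \<in> mod_hom A M N" "\<And>w. w \<in> W \<Longrightarrow> f w = \<zero>\<^bsub>N\<^esub>"
  obtains h where "h \<in> mod_hom A (quot_mod M W) N"
    and "\<And>x. x \<in> carrier M \<Longrightarrow> h (W +>\<^bsub>M\<^esub> x) = f x"
proof -
  interpret M: lmodule A M by (rule lmodule.intro) fact
  interpret N: lmodule A N by (rule lmodule.intro) fact
  define h where "h X = f (SOME x. x \<in> X)" for X
  have *: "h (W +>\<^bsub>M\<^esub> x) = f x" if x: "x \<in> carrier M" for x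
  proof -
    define y where "y = (SOME y. y \<in> W +>\<^bsub>M\<^esub> x)"
    have "y \<in> W +>\<^bsub>M\<^esub> x"
      unfolding y_def using M.coset_self[OF M(2) x] by (rule someI)
    then have y: "y \<in> carrier M" "y \<ominus>\<^bsub>M\<^esub> x \<in> W"
      using M.coset_memD[OF M(2) x] by auto
    then have "f y \<ominus>\<^bsub>N\<^esub> f x = \<zero>\<^bsub>N\<^esub>"
      using f mod_hom_minus[OF M(1) N f(1) y(1) x] by simp
    then show ?thesis
      using x y mod_homD(1)[OF f(1)] by (simp add: h_def y_def[symmetric] N.M.minus_eq)
        (metis N.M.add.inv_solve_right' N.M.l_zero N.M.zero_closed)
  qed
  moreover have "h \<in> mod_hom A (quot_mod M W) N"
    using mod_homD[OF f(1)]
    by (intro mod_homI)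
      (auto simp: M.carrier_quot_mod * M.add_quot_mod[OF M(2)] M.smult_quot_mod[OF M(2)] M.smult_closed)
  ultimately show ?thesis
    using that by blast
qed

lemma module_iff_left_module: "cring k \<Longrightarrow> module k M \<longleftrightarrow> left_module k M"
  by (auto simp: module_def left_module_def module_axioms_def left_module_axioms_def cring.axioms)

section \<open>Free modules and group algebras\<close>

locale scalar_field = field k for k :: "'k ring" (structure)
begin

lemma single_in [simp]: "x \<in> S \<Longrightarrow> single k x \<in> fin_funs k S"
  by (auto simp: fin_funs_def single_def)

lemma fin_funsD:
  assumes "\<phi> \<in> fin_funs k S"
  shows "\<phi> x \<in> carrier k" "finite {x. \<phi> x \<noteq> \<zero>}" "\<phi> x \<noteq> \<zero> \<Longrightarrow> x \<in> S"
  using assms by (auto simp: fin_funs_def)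

lemma carrier_free_mod [simp]: "carrier (free_mod k S) = fin_funs k S"
  by (simp add: free_mod_def)

lemma free_mod_simps:
  "\<zero>\<^bsub>free_mod k S\<^esub> = (\<lambda>x. \<zero>)"
  "\<phi> \<oplus>\<^bsub>free_mod k S\<^esub> \<psi> = (\<lambda>x. \<phi> x \<oplus> \<psi> x)"
  "c \<odot>\<^bsub>free_mod k S\<^esub> \<phi> = (\<lambda>x. c \<otimes> \<phi> x)"
  by (simp_all add: free_mod_def)

lemma fin_funs_zero [simp]: "(\<lambda>x. \<zero>) \<in> fin_funs k S"
  by (auto simp: fin_funs_def)

lemma fin_funs_add:
  assumes "\<phi> \<in> fin_funs k S" "\<psi> \<in> fin_funs k S"
  shows "(\<lambda>x. \<phi> x \<oplus> \<psi> x) \<in> fin_funs k S"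
proof -
  note d = fin_funsD[OF assms(1)] fin_funsD[OF assms(2)]
  have "{x. \<phi> x \<oplus> \<psi> x \<noteq> \<zero>} \<subseteq> {x. \<phi> x \<noteq> \<zero>} \<union> {x. \<psi> x \<noteq> \<zero>}"
    by auto
  then have "finite {x. \<phi> x \<oplus> \<psi> x \<noteq> \<zero>}"
    using d(2,5) finite_subset by blast
  moreover have "\<phi> x = \<zero>" "\<psi> x = \<zero>" if "x \<notin> S" for x
    using d(3,6) that by auto
  ultimately show ?thesis
    using d(1,4) by (auto simp: fin_funs_def) (metis l_zero zero_closed)
qed

lemma fin_funs_smult:
  assumes "c \<in> carrier k" "\<phi> \<in> fin_funs k S"
  shows "(\<lambda>x. c \<otimes> \<phi> x) \<in> fin_funs k S"
proof -
  note d = fin_funsD[OF assms(2)]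
  have "{x. c \<otimes> \<phi> x \<noteq> \<zero>} \<subseteq> {x. \<phi> x \<noteq> \<zero>}"
    using assms(1) by auto
  then have "finite {x. c \<otimes> \<phi> x \<noteq> \<zero>}"
    using d(2) finite_subset by blast
  moreover have "\<phi> x = \<zero>" if "x \<notin> S" for x
    using d(3) that by auto
  ultimately show ?thesis
    using d(1) assms(1) by (auto simp: fin_funs_def) (metis r_null)
qed

lemma left_module_free_mod: "left_module k (free_mod k S)"
proof -
  have "abelian_group (free_mod k S)"
  proof (rule abelian_groupI)
    fix \<phi> assume \<phi>: "\<phi> \<in> carrier (free_mod k S)"
    then show "\<exists>\<psi>\<in>carrier (free_mod k S). \<psi> \<oplus>\<^bsub>free_mod k S\<^esub> \<phi> = \<zero>\<^bsub>free_mod k S\<^esub>"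
      using fin_funs_smult[of "\<ominus> \<one>" \<phi> S] fin_funsD[of \<phi> S]
      by (intro bexI[of _ "\<lambda>x. (\<ominus> \<one>) \<otimes> \<phi> x"]) (auto simp: free_mod_simps l_minus l_neg)
  qed (auto simp: free_mod_simps fin_funs_add fun_eq_iff a_ac fin_funsD(1)[of _ S])
  then interpret F: abelian_group "free_mod k S" .
  show ?thesis
    by unfold_locales
      (auto simp: free_mod_simps fin_funs_smult m_ac l_distr r_distr fun_eq_iff fin_funsD(1)[of _ S])
qed

text \<open>Induction over the support: one point \<open>i\<close> is split off by resetting the
  function to zero there.\<close>

lemma fin_funs_induct [consumes 1, case_names zero add]:
  assumes "\<phi> \<in> fin_funs k S"
    and zero: "P (\<lambda>x. \<zero>)"
    and add: "\<And>c x \<psi>. c \<in> carrier k \<Longrightarrow> x \<in> S \<Longrightarrow> \<psi> \<in> fin_funs k S \<Longrightarrow> P \<psi> \<Longrightarrow>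
      P (\<lambda>y. c \<otimes> single k x y \<oplus> \<psi> y)"
  shows "P \<phi>"
proof -
  define I where "I = {x. \<phi> x \<noteq> \<zero>}"
  have "finite I" using fin_funsD(2)[OF assms(1)] by (simp add: I_def)
  then show ?thesis
    using assms(1) I_def
  proof (induction I arbitrary: \<phi>)
    case empty
    then have "\<phi> = (\<lambda>x. \<zero>)" by auto
    then show ?case using zero by simp
  next
    case (insert i I)
    define \<psi> where "\<psi> = \<phi>(i := \<zero>)"
    note d = fin_funsD[OF insert.prems(1)]
    have i: "\<phi> i \<noteq> \<zero>" using insert.prems(2) by auto
    have I: "I = {x. \<psi> x \<noteq> \<zero>}"
      using insert.hyps(2) insert.prems(2) by (auto simp: \<psi>_def)
    have \<psi>: "\<psi> \<in> fin_funs k S"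
      using d insert.hyps(1) I by (auto simp: fin_funs_def \<psi>_def)
    have "P (\<lambda>y. \<phi> i \<otimes> single k i y \<oplus> \<psi> y)"
      using d i \<psi> insert.IH[OF \<psi> I] by (intro add) auto
    also have "(\<lambda>y. \<phi> i \<otimes> single k i y \<oplus> \<psi> y) = \<phi>"
      using d by (auto simp: single_def \<psi>_def)
    finally show ?case .
  qed
qed

lemma single_smult_closed: "c \<in> carrier k \<Longrightarrow> x \<in> S \<Longrightarrow> (\<lambda>y. c \<otimes> single k x y) \<in> fin_funs k S"
  by (simp add: fin_funs_smult)

text \<open>Linear maps out of a free module are determined on the basis. Nearly every identity
  about convolutions and compositions below is reduced in this way to an identity of maps.\<close>

lemma mod_hom_free_eqI:
  assumes Z: "left_module k Z" and f: "f \<in> mod_hom k (free_mod k S) Z" and g: "g \<in> mod_hom k (free_mod k S) Z"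
    and eq: "\<And>x. x \<in> S \<Longrightarrow> f (single k x) = g (single k x)"
    and \<phi>: "\<phi> \<in> fin_funs k S"
  shows "f \<phi> = g \<phi>"
  using \<phi>
proof (induction rule: fin_funs_induct)
  case zero
  show ?case
    using mod_hom_zero[OF left_module_free_mod Z f] mod_hom_zero[OF left_module_free_mod Z g]
    by (simp add: free_mod_simps)
next
  case (add c x \<psi>)
  then show ?case
    using mod_homD(2)[OF f, of "\<lambda>y. c \<otimes> single k x y" \<psi>] mod_homD(2)[OF g, of "\<lambda>y. c \<otimes> single k x y" \<psi>]
      mod_homD(3)[OF f, of c "single k x"] mod_homD(3)[OF g, of c "single k x"] eq[of x]
    by (simp add: free_mod_simps single_smult_closed)
qed

section \<open>Linear and bilinear extension from bases\<close>

lemma finsum_neutral: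
  assumes "finite U" "V \<subseteq> U" "\<And>x. x \<in> U - V \<Longrightarrow> f x = \<zero>" "\<And>x. x \<in> V \<Longrightarrow> f x = g x"
    and "\<And>x. x \<in> V \<Longrightarrow> g x \<in> carrier k"
  shows "finsum k g V = finsum k f U"
proof (rule add.finprod_mono_neutral_cong_left)
  show "f \<in> U \<rightarrow> carrier k"
    using assms(3-5) by (metis DiffI Pi_I zero_closed)
qed (use assms in auto)

text \<open>The defining sum runs over a set that varies with the function and the point. Padding
  with zeros gives sums over one fixed finite set, which can then be added and scaled term by
  term.\<close>

lemma lin_ext_eq:
  assumes "finite U" "{x. \<phi> x \<noteq> \<zero>} \<subseteq> U" "\<And>x. \<phi> x \<in> carrier k"
  shows "lin_ext k h \<phi> y = finsum k (\<lambda>x. if h x = y then \<phi> x else \<zero>) U"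
  unfolding lin_ext_def using assms by (intro finsum_neutral) auto

lemma bilin_ext_eq:
  assumes "finite U" "{x. \<phi> x \<noteq> \<zero>} \<subseteq> U" "\<And>x. \<phi> x \<in> carrier k"
    and "finite V" "{x. \<psi> x \<noteq> \<zero>} \<subseteq> V" "\<And>x. \<psi> x \<in> carrier k"
  shows "bilin_ext k p \<phi> \<psi> z =
    finsum k (\<lambda>(x, y). if p x y = z then \<phi> x \<otimes> \<psi> y else \<zero>) (U \<times> V)"
  unfolding bilin_ext_def
proof (rule finsum_neutral)
  show "(case a of (x, y) \<Rightarrow> if p x y = z then \<phi> x \<otimes> \<psi> y else \<zero>) = \<zero>"
    if "a \<in> U \<times> V - {(x, y). \<phi> x \<noteq> \<zero> \<and> \<psi> y \<noteq> \<zero> \<and> p x y = z}" for a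
    using that assms(3,6) by (cases a) auto
qed (use assms in auto)

lemma lin_ext_closed:
  assumes "\<phi> \<in> fin_funs k S" "\<And>x. x \<in> S \<Longrightarrow> h x \<in> T"
  shows "lin_ext k h \<phi> \<in> fin_funs k T"
proof -
  note d = fin_funsD[OF assms(1)]
  define U where "U = {x. \<phi> x \<noteq> \<zero>}"
  have eq: "lin_ext k h \<phi> y = finsum k (\<lambda>x. if h x = y then \<phi> x else \<zero>) U" for y
    using d by (intro lin_ext_eq) (auto simp: U_def)
  have "y \<in> h ` U" if "lin_ext k h \<phi> y \<noteq> \<zero>" for y
  proof (rule ccontr)
    assume "y \<notin> h ` U"
    then have "(\<Oplus>x\<in>U. if h x = y then \<phi> x else \<zero>) = \<zero>"
      by (intro add.finprod_one_eqI) auto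
    then show False using that eq by simp
  qed
  then have "{y. lin_ext k h \<phi> y \<noteq> \<zero>} \<subseteq> h ` U" by auto
  moreover have "finite (h ` U)" "h ` U \<subseteq> T"
    using d assms(2) by (auto simp: U_def)
  moreover have "lin_ext k h \<phi> y \<in> carrier k" for y
    using d(1) by (auto simp: eq intro!: finsum_closed)
  ultimately show ?thesis
    unfolding fin_funs_def by (auto intro: finite_subset)
qed

lemma lin_ext_hom:
  assumes "\<And>x. x \<in> S \<Longrightarrow> h x \<in> T"
  shows "lin_ext k h \<in> mod_hom k (free_mod k S) (free_mod k T)"
proof (rule mod_homI)
  show "\<phi> \<in> carrier (free_mod k S) \<Longrightarrow> lin_ext k h \<phi> \<in> carrier (free_mod k T)" for \<phi>
    using lin_ext_closed assms by auto
  fix \<phi> \<psi> assume "\<phi> \<in> carrier (free_mod k S)" "\<psi> \<in> carrier (free_mod k S)"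
  then have \<phi>\<psi>: "\<phi> \<in> fin_funs k S" "\<psi> \<in> fin_funs k S" by auto
  note d = fin_funsD[OF \<phi>\<psi>(1)] fin_funsD[OF \<phi>\<psi>(2)]
  define U where "U = {x. \<phi> x \<noteq> \<zero>} \<union> {x. \<psi> x \<noteq> \<zero>}"
  have U: "finite U" using d by (simp add: U_def)
  show "lin_ext k h (\<phi> \<oplus>\<^bsub>free_mod k S\<^esub> \<psi>) = lin_ext k h \<phi> \<oplus>\<^bsub>free_mod k T\<^esub> lin_ext k h \<psi>"
  proof
    fix y
    have "lin_ext k h (\<lambda>x. \<phi> x \<oplus> \<psi> x) y = finsum k (\<lambda>x. if h x = y then \<phi> x \<oplus> \<psi> x else \<zero>) U"
      using d U by (intro lin_ext_eq) (auto simp: U_def)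
    also have "\<dots> = finsum k (\<lambda>x. (if h x = y then \<phi> x else \<zero>) \<oplus> (if h x = y then \<psi> x else \<zero>)) U"
      using d by (intro finsum_cong') auto
    also have "\<dots> = finsum k (\<lambda>x. if h x = y then \<phi> x else \<zero>) U \<oplus> finsum k (\<lambda>x. if h x = y then \<psi> x else \<zero>) U"
      using d by (intro finsum_addf) auto
    also have "\<dots> = lin_ext k h \<phi> y \<oplus> lin_ext k h \<psi> y"
      using d U lin_ext_eq[of U \<phi> h y] lin_ext_eq[of U \<psi> h y] by (auto simp: U_def)
    finally show "lin_ext k h (\<phi> \<oplus>\<^bsub>free_mod k S\<^esub> \<psi>) y = (lin_ext k h \<phi> \<oplus>\<^bsub>free_mod k T\<^esub> lin_ext k h \<psi>) y"
      by (simp add: free_mod_simps)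
  qed
next
  fix c \<phi> assume c: "c \<in> carrier k" and "\<phi> \<in> carrier (free_mod k S)"
  then have "\<phi> \<in> fin_funs k S" by simp
  note d = fin_funsD[OF this]
  define U where "U = {x. \<phi> x \<noteq> \<zero>}"
  have U: "finite U" using d by (simp add: U_def)
  show "lin_ext k h (c \<odot>\<^bsub>free_mod k S\<^esub> \<phi>) = c \<odot>\<^bsub>free_mod k T\<^esub> lin_ext k h \<phi>"
  proof
    fix y
    have "lin_ext k h (\<lambda>x. c \<otimes> \<phi> x) y = finsum k (\<lambda>x. if h x = y then c \<otimes> \<phi> x else \<zero>) U"
      using c d U by (intro lin_ext_eq) (auto simp: U_def)
    also have "\<dots> = finsum k (\<lambda>x. c \<otimes> (if h x = y then \<phi> x else \<zero>)) U"
      using c d by (intro finsum_cong') auto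
    also have "\<dots> = c \<otimes> finsum k (\<lambda>x. (if h x = y then \<phi> x else \<zero>)) U"
      using c d U by (intro finsum_rdistr[symmetric]) auto
    also have "\<dots> = c \<otimes> lin_ext k h \<phi> y"
      using d U lin_ext_eq[of U \<phi> h y] by (auto simp: U_def)
    finally show "lin_ext k h (c \<odot>\<^bsub>free_mod k S\<^esub> \<phi>) y = (c \<odot>\<^bsub>free_mod k T\<^esub> lin_ext k h \<phi>) y"
      by (simp add: free_mod_simps)
  qed
qed

lemma lin_ext_single [simp]: "lin_ext k h (single k x) = single k (h x)"
proof
  fix y
  show "lin_ext k h (single k x) y = single k (h x) y"
    using lin_ext_eq[of "{x}" "single k x" h y] by (auto simp: single_def)
qed

lemma bilin_ext_single [simp]: "bilin_ext k p (single k x) (single k y) = single k (p x y)"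
proof
  fix z
  show "bilin_ext k p (single k x) (single k y) z = single k (p x y) z"
    using bilin_ext_eq[of "{x}" "single k x" "{y}" "single k y" p z] by (auto simp: single_def)
qed

lemma bilin_ext_closed:
  assumes "\<phi> \<in> fin_funs k S" "\<psi> \<in> fin_funs k T" "\<And>x y. x \<in> S \<Longrightarrow> y \<in> T \<Longrightarrow> p x y \<in> R"
  shows "bilin_ext k p \<phi> \<psi> \<in> fin_funs k R"
proof -
  note d = fin_funsD[OF assms(1)] fin_funsD[OF assms(2)]
  define U where "U = {x. \<phi> x \<noteq> \<zero>}"
  define V where "V = {x. \<psi> x \<noteq> \<zero>}"
  have eq: "bilin_ext k p \<phi> \<psi> z = finsum k (\<lambda>(x, y). if p x y = z then \<phi> x \<otimes> \<psi> y else \<zero>) (U \<times> V)" for z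
    using d by (intro bilin_ext_eq) (auto simp: U_def V_def)
  have "z \<in> (\<lambda>(x, y). p x y) ` (U \<times> V)" if "bilin_ext k p \<phi> \<psi> z \<noteq> \<zero>" for z
  proof (rule ccontr)
    assume "z \<notin> (\<lambda>(x, y). p x y) ` (U \<times> V)"
    then have "finsum k (\<lambda>(x, y). if p x y = z then \<phi> x \<otimes> \<psi> y else \<zero>) (U \<times> V) = \<zero>"
      by (intro add.finprod_one_eqI) auto
    then show False using that eq by simp
  qed
  then have "{z. bilin_ext k p \<phi> \<psi> z \<noteq> \<zero>} \<subseteq> (\<lambda>(x, y). p x y) ` (U \<times> V)" by auto
  moreover have "finite ((\<lambda>(x, y). p x y) ` (U \<times> V))" "(\<lambda>(x, y). p x y) ` (U \<times> V) \<subseteq> R"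
    using d assms(3) by (auto simp: U_def V_def)
  moreover have "bilin_ext k p \<phi> \<psi> z \<in> carrier k" for z
    using d by (auto simp: eq intro!: finsum_closed)
  ultimately show ?thesis
    unfolding fin_funs_def by (auto intro: finite_subset)
qed

lemma bilin_ext_hom:
  assumes \<psi>: "\<psi> \<in> fin_funs k T" and p: "\<And>x y. x \<in> S \<Longrightarrow> y \<in> T \<Longrightarrow> p x y \<in> R"
  shows "(\<lambda>\<phi>. bilin_ext k p \<phi> \<psi>) \<in> mod_hom k (free_mod k S) (free_mod k R)"
proof (rule mod_homI)
  show "\<phi> \<in> carrier (free_mod k S) \<Longrightarrow> bilin_ext k p \<phi> \<psi> \<in> carrier (free_mod k R)" for \<phi>
    using bilin_ext_closed[OF _ \<psi> p] by auto
  define V where "V = {x. \<psi> x \<noteq> \<zero>}"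
  note dp = fin_funsD[OF \<psi>]
  have V: "finite V" using dp by (simp add: V_def)
  {
    fix \<phi> \<phi>' assume "\<phi> \<in> carrier (free_mod k S)" "\<phi>' \<in> carrier (free_mod k S)"
    then have \<phi>: "\<phi> \<in> fin_funs k S" "\<phi>' \<in> fin_funs k S" by auto
    note d = fin_funsD[OF \<phi>(1)] fin_funsD[OF \<phi>(2)]
    define U where "U = {x. \<phi> x \<noteq> \<zero>} \<union> {x. \<phi>' x \<noteq> \<zero>}"
    have U: "finite U" using d by (simp add: U_def)
    let ?f = "\<lambda>\<phi> z (x, y). if p x y = z then \<phi> x \<otimes> \<psi> y else \<zero>"
    show "bilin_ext k p (\<phi> \<oplus>\<^bsub>free_mod k S\<^esub> \<phi>') \<psi> =
      bilin_ext k p \<phi> \<psi> \<oplus>\<^bsub>free_mod k R\<^esub> bilin_ext k p \<phi>' \<psi>"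
    proof
      fix z
      have "bilin_ext k p (\<lambda>x. \<phi> x \<oplus> \<phi>' x) \<psi> z = finsum k (?f (\<lambda>x. \<phi> x \<oplus> \<phi>' x) z) (U \<times> V)"
        using d U V dp by (intro bilin_ext_eq) (auto simp: U_def V_def)
      also have "\<dots> = finsum k (\<lambda>a. ?f \<phi> z a \<oplus> ?f \<phi>' z a) (U \<times> V)"
        using d dp by (intro finsum_cong') (auto simp: l_distr)
      also have "\<dots> = finsum k (?f \<phi> z) (U \<times> V) \<oplus> finsum k (?f \<phi>' z) (U \<times> V)"
        using d dp by (intro finsum_addf) auto
      also have "\<dots> = bilin_ext k p \<phi> \<psi> z \<oplus> bilin_ext k p \<phi>' \<psi> z"
        using d dp U V bilin_ext_eq[of U \<phi> V \<psi> p z] bilin_ext_eq[of U \<phi>' V \<psi> p z]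
        by (auto simp: U_def V_def)
      finally show "bilin_ext k p (\<phi> \<oplus>\<^bsub>free_mod k S\<^esub> \<phi>') \<psi> z =
        (bilin_ext k p \<phi> \<psi> \<oplus>\<^bsub>free_mod k R\<^esub> bilin_ext k p \<phi>' \<psi>) z"
        by (simp add: free_mod_simps)
    qed
  next
    fix c \<phi> assume c: "c \<in> carrier k" and "\<phi> \<in> carrier (free_mod k S)"
    then have "\<phi> \<in> fin_funs k S" by simp
    note d = fin_funsD[OF this]
    define U where "U = {x. \<phi> x \<noteq> \<zero>}"
    have U: "finite U" using d by (simp add: U_def)
    let ?f = "\<lambda>\<phi> z (x, y). if p x y = z then \<phi> x \<otimes> \<psi> y else \<zero>"
    show "bilin_ext k p (c \<odot>\<^bsub>free_mod k S\<^esub> \<phi>) \<psi> = c \<odot>\<^bsub>free_mod k R\<^esub> bilin_ext k p \<phi> \<psi>"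
    proof
      fix z
      have "bilin_ext k p (\<lambda>x. c \<otimes> \<phi> x) \<psi> z = finsum k (?f (\<lambda>x. c \<otimes> \<phi> x) z) (U \<times> V)"
        using c d U V dp by (intro bilin_ext_eq) (auto simp: U_def V_def)
      also have "\<dots> = finsum k (\<lambda>a. c \<otimes> ?f \<phi> z a) (U \<times> V)"
        using c d dp by (intro finsum_cong') (auto simp: m_assoc)
      also have "\<dots> = c \<otimes> finsum k (?f \<phi> z) (U \<times> V)"
        using c d U V dp by (intro finsum_rdistr[symmetric]) auto
      also have "\<dots> = c \<otimes> bilin_ext k p \<phi> \<psi> z"
        using d dp U V bilin_ext_eq[of U \<phi> V \<psi> p z] by (auto simp: U_def V_def)
      finally show "bilin_ext k p (c \<odot>\<^bsub>free_mod k S\<^esub> \<phi>) \<psi> z = (c \<odot>\<^bsub>free_mod k R\<^esub> bilin_ext k p \<phi> \<psi>) z"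
        by (simp add: free_mod_simps)
    qed
  }
qed

text \<open>Commutativity of the field exchanges the arguments, so that linearity in the second
  argument follows from linearity in the first.\<close>

lemma bilin_ext_swap:
  assumes "\<phi> \<in> fin_funs k S" "\<psi> \<in> fin_funs k T"
  shows "bilin_ext k p \<phi> \<psi> = bilin_ext k (\<lambda>y x. p x y) \<psi> \<phi>"
proof
  fix z
  note d = fin_funsD[OF assms(1)] fin_funsD[OF assms(2)]
  define U where "U = {x. \<phi> x \<noteq> \<zero>}"
  define V where "V = {x. \<psi> x \<noteq> \<zero>}"
  have UV: "finite U" "finite V" using d by (simp_all add: U_def V_def)
  have "finsum k (\<lambda>(x, y). if p x y = z then \<phi> x \<otimes> \<psi> y else \<zero>) (prod.swap ` (V \<times> U)) =
    finsum k (\<lambda>a. (\<lambda>(x, y). if p x y = z then \<phi> x \<otimes> \<psi> y else \<zero>) (prod.swap a)) (V \<times> U)"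
    using d by (intro finsum_reindex) auto
  moreover have "prod.swap ` (V \<times> U) = U \<times> V" by auto
  ultimately have "finsum k (\<lambda>(x, y). if p x y = z then \<phi> x \<otimes> \<psi> y else \<zero>) (U \<times> V) =
    finsum k (\<lambda>a. (\<lambda>(x, y). if p x y = z then \<phi> x \<otimes> \<psi> y else \<zero>) (prod.swap a)) (V \<times> U)"
    by simp
  also have "\<dots> = finsum k (\<lambda>(y, x). if p x y = z then \<psi> y \<otimes> \<phi> x else \<zero>) (V \<times> U)"
    using d by (intro finsum_cong') (auto simp: m_comm)
  finally show "bilin_ext k p \<phi> \<psi> z = bilin_ext k (\<lambda>y x. p x y) \<psi> \<phi> z"
    using d UV bilin_ext_eq[of U \<phi> V \<psi> p z] bilin_ext_eq[of V \<psi> U \<phi> "\<lambda>y x. p x y" z]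
    by (simp add: U_def V_def)
qed

lemma bilin_ext_hom2:
  assumes \<phi>: "\<phi> \<in> fin_funs k S" and p: "\<And>x y. x \<in> S \<Longrightarrow> y \<in> T \<Longrightarrow> p x y \<in> R"
  shows "(\<lambda>\<psi>. bilin_ext k p \<phi> \<psi>) \<in> mod_hom k (free_mod k T) (free_mod k R)"
proof -
  have *: "(\<lambda>\<psi>. bilin_ext k (\<lambda>y x. p x y) \<psi> \<phi>) \<in> mod_hom k (free_mod k T) (free_mod k R)"
    using \<phi> p by (intro bilin_ext_hom) auto
  interpret F: lmodule k "free_mod k T"
    by (rule lmodule.intro) (rule left_module_free_mod)
  show ?thesis
    using mod_homD[OF *] bilin_ext_swap[OF \<phi>, of _ T p] F.M.a_closed F.smult_closed
    by (intro mod_homI) auto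
qed

text \<open>Both sides are linear in each argument; the arguments are replaced by basis elements one
  at a time, the third, the second and then the first, until only associativity on the bases
  remains.\<close>

lemma bilin_ext_assoc:
  assumes \<phi>: "\<phi> \<in> fin_funs k S" and \<psi>: "\<psi> \<in> fin_funs k T" and \<chi>: "\<chi> \<in> fin_funs k U"
    and p: "\<And>x y. x \<in> S \<Longrightarrow> y \<in> T \<Longrightarrow> p x y \<in> ST" and q: "\<And>x y. x \<in> ST \<Longrightarrow> y \<in> U \<Longrightarrow> q x y \<in> R"
    and p': "\<And>x y. x \<in> T \<Longrightarrow> y \<in> U \<Longrightarrow> p' x y \<in> TU" and q': "\<And>x y. x \<in> S \<Longrightarrow> y \<in> TU \<Longrightarrow> q' x y \<in> R"
    and assoc: "\<And>x y z. x \<in> S \<Longrightarrow> y \<in> T \<Longrightarrow> z \<in> U \<Longrightarrow> q (p x y) z = q' x (p' y z)"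
  shows "bilin_ext k q (bilin_ext k p \<phi> \<psi>) \<chi> = bilin_ext k q' \<phi> (bilin_ext k p' \<psi> \<chi>)"
proof -
  note lm = left_module_free_mod
  have 1: "bilin_ext k q (bilin_ext k p (single k x) (single k y)) \<chi> =
      bilin_ext k q' (single k x) (bilin_ext k p' (single k y) \<chi>)" if "x \<in> S" "y \<in> T" for x y
  proof (rule mod_hom_free_eqI[OF lm _ _ _ \<chi>])
    show "(\<lambda>\<chi>. bilin_ext k q (bilin_ext k p (single k x) (single k y)) \<chi>) \<in> mod_hom k (free_mod k U) (free_mod k R)"
      using that p q by (intro bilin_ext_hom2[of _ ST]) auto
    show "(\<lambda>\<chi>. bilin_ext k q' (single k x) (bilin_ext k p' (single k y) \<chi>)) \<in> mod_hom k (free_mod k U) (free_mod k R)"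
      using that p' q'
      by (intro mod_hom_comp[OF bilin_ext_hom2[of _ T _ _ TU] bilin_ext_hom2[of _ S]]) auto
  qed (use that assoc in auto)
  have 2: "bilin_ext k q (bilin_ext k p (single k x) \<psi>) \<chi> =
      bilin_ext k q' (single k x) (bilin_ext k p' \<psi> \<chi>)" if "x \<in> S" for x
  proof (rule mod_hom_free_eqI[OF lm _ _ _ \<psi>])
    show "(\<lambda>\<psi>. bilin_ext k q (bilin_ext k p (single k x) \<psi>) \<chi>) \<in> mod_hom k (free_mod k T) (free_mod k R)"
      using that p q \<chi>
      by (intro mod_hom_comp[OF bilin_ext_hom2[of _ S _ _ ST] bilin_ext_hom[of _ U]]) auto
    show "(\<lambda>\<psi>. bilin_ext k q' (single k x) (bilin_ext k p' \<psi> \<chi>)) \<in> mod_hom k (free_mod k T) (free_mod k R)"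
      using that p' q' \<chi>
      by (intro mod_hom_comp[OF bilin_ext_hom[of _ U _ _ TU] bilin_ext_hom2[of _ S]]) auto
  qed (use that 1 in auto)
  show ?thesis
  proof (rule mod_hom_free_eqI[OF lm _ _ _ \<phi>])
    show "(\<lambda>\<phi>. bilin_ext k q (bilin_ext k p \<phi> \<psi>) \<chi>) \<in> mod_hom k (free_mod k S) (free_mod k R)"
      using p q \<psi> \<chi>
      by (intro mod_hom_comp[OF bilin_ext_hom[of _ T _ _ ST] bilin_ext_hom[of _ U]]) auto
    show "(\<lambda>\<phi>. bilin_ext k q' \<phi> (bilin_ext k p' \<psi> \<chi>)) \<in> mod_hom k (free_mod k S) (free_mod k R)"
      using q' bilin_ext_closed[OF \<psi> \<chi> p'] by (intro bilin_ext_hom[of _ TU]) auto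
  qed (use 2 in auto)
qed

text \<open>The linear map with prescribed values on the basis. Unlike \<open>lin_ext\<close>, it
  takes values in an arbitrary module, as needed for maps out of tensor products and for group
  algebra actions.\<close>

definition free_lift :: "('k, 'z) module \<Rightarrow> ('x \<Rightarrow> 'z) \<Rightarrow> ('x \<Rightarrow> 'k) \<Rightarrow> 'z" where
  "free_lift Z \<beta> \<phi> = finsum Z (\<lambda>x. \<phi> x \<odot>\<^bsub>Z\<^esub> \<beta> x) {x. \<phi> x \<noteq> \<zero>}"

lemma free_lift_eq:
  assumes Z: "left_module k Z" and \<phi>: "\<phi> \<in> fin_funs k S" and \<beta>: "\<And>x. x \<in> S \<Longrightarrow> \<beta> x \<in> carrier Z"
    and U: "finite U" "{x. \<phi> x \<noteq> \<zero>} \<subseteq> U" "U \<subseteq> S"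
  shows "free_lift Z \<beta> \<phi> = finsum Z (\<lambda>x. \<phi> x \<odot>\<^bsub>Z\<^esub> \<beta> x) U"
proof -
  interpret Z: lmodule k Z by (rule lmodule.intro) fact
  note d = fin_funsD[OF \<phi>]
  show ?thesis
    unfolding free_lift_def using d U \<beta>
    by (intro Z.M.add.finprod_mono_neutral_cong_left) (auto intro!: Z.smult_closed)
qed

lemma free_lift_hom:
  assumes Z: "left_module k Z" and \<beta>: "\<And>x. x \<in> S \<Longrightarrow> \<beta> x \<in> carrier Z"
  shows "free_lift Z \<beta> \<in> mod_hom k (free_mod k S) Z"
proof -
  interpret Z: lmodule k Z by (rule lmodule.intro) fact
  show ?thesis
  proof (rule mod_homI)
    fix \<phi> assume "\<phi> \<in> carrier (free_mod k S)"
    then have "\<phi> \<in> fin_funs k S" by simp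
    note d = fin_funsD[OF this]
    show "free_lift Z \<beta> \<phi> \<in> carrier Z"
      unfolding free_lift_def using d \<beta> by (intro Z.M.finsum_closed) (auto intro!: Z.smult_closed)
    fix c assume c: "c \<in> carrier k"
    have "free_lift Z \<beta> (\<lambda>x. c \<otimes> \<phi> x) = finsum Z (\<lambda>x. (c \<otimes> \<phi> x) \<odot>\<^bsub>Z\<^esub> \<beta> x) {x. \<phi> x \<noteq> \<zero>}"
      using d c \<open>\<phi> \<in> fin_funs k S\<close> by (intro free_lift_eq[OF Z _ \<beta>] fin_funs_smult) auto
    also have "\<dots> = finsum Z (\<lambda>x. c \<odot>\<^bsub>Z\<^esub> (\<phi> x \<odot>\<^bsub>Z\<^esub> \<beta> x)) {x. \<phi> x \<noteq> \<zero>}"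
      using d c \<beta> by (intro Z.M.finsum_cong') (auto intro!: Z.smult_closed Z.smult_assoc)
    also have "\<dots> = c \<odot>\<^bsub>Z\<^esub> free_lift Z \<beta> \<phi>"
    proof -
      have "(\<lambda>z. c \<odot>\<^bsub>Z\<^esub> z) \<in> mod_hom k Z Z"
        using c by (intro mod_homI) (auto simp: Z.smult_closed Z.smult_r_distr m_comm simp flip: Z.smult_assoc)
      then show ?thesis
        unfolding free_lift_def using d c \<beta> by (intro mod_hom_finsum[OF Z Z, symmetric]) (auto intro!: Z.smult_closed)
    qed
    finally show "free_lift Z \<beta> (c \<odot>\<^bsub>free_mod k S\<^esub> \<phi>) = c \<odot>\<^bsub>Z\<^esub> free_lift Z \<beta> \<phi>"
      by (simp add: free_mod_simps)
  next
    fix \<phi> \<psi> assume "\<phi> \<in> carrier (free_mod k S)" "\<psi> \<in> carrier (free_mod k S)"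
    then have \<phi>\<psi>: "\<phi> \<in> fin_funs k S" "\<psi> \<in> fin_funs k S" by auto
    note d = fin_funsD[OF \<phi>\<psi>(1)] fin_funsD[OF \<phi>\<psi>(2)]
    define U where "U = {x. \<phi> x \<noteq> \<zero>} \<union> {x. \<psi> x \<noteq> \<zero>}"
    have U: "finite U" "U \<subseteq> S" using d by (auto simp add: U_def)
    have "free_lift Z \<beta> (\<lambda>x. \<phi> x \<oplus> \<psi> x) = finsum Z (\<lambda>x. (\<phi> x \<oplus> \<psi> x) \<odot>\<^bsub>Z\<^esub> \<beta> x) U"
      using d U \<phi>\<psi> by (intro free_lift_eq[OF Z _ \<beta>] fin_funs_add) (auto simp: U_def)
    also have "\<dots> = finsum Z (\<lambda>x. \<phi> x \<odot>\<^bsub>Z\<^esub> \<beta> x \<oplus>\<^bsub>Z\<^esub> \<psi> x \<odot>\<^bsub>Z\<^esub> \<beta> x) U"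
      using d U \<beta> by (intro Z.M.finsum_cong') (auto intro!: Z.smult_closed Z.smult_l_distr Z.M.a_closed)
    also have "\<dots> = finsum Z (\<lambda>x. \<phi> x \<odot>\<^bsub>Z\<^esub> \<beta> x) U \<oplus>\<^bsub>Z\<^esub> finsum Z (\<lambda>x. \<psi> x \<odot>\<^bsub>Z\<^esub> \<beta> x) U"
      using d U \<beta> by (intro Z.M.finsum_addf) (auto intro!: Z.smult_closed)
    also have "\<dots> = free_lift Z \<beta> \<phi> \<oplus>\<^bsub>Z\<^esub> free_lift Z \<beta> \<psi>"
      using d U \<phi>\<psi> \<beta> by (subst (1 2) free_lift_eq[OF Z, of _ S \<beta> U]) (auto simp: U_def)
    finally show "free_lift Z \<beta> (\<phi> \<oplus>\<^bsub>free_mod k S\<^esub> \<psi>) = free_lift Z \<beta> \<phi> \<oplus>\<^bsub>Z\<^esub> free_lift Z \<beta> \<psi>"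
      by (simp add: free_mod_simps)
  qed
qed

lemma free_lift_single:
  assumes Z: "left_module k Z" and \<beta>: "\<beta> x \<in> carrier Z"
  shows "free_lift Z \<beta> (single k x) = \<beta> x"
proof -
  interpret Z: lmodule k Z by (rule lmodule.intro) fact
  show ?thesis
    using free_lift_eq[OF Z single_in, of x "{x}" \<beta> "{x}"] \<beta>
    by (simp add: single_def Z.smult_one Z.smult_closed)
qed

section \<open>Units, associativity and the ring structure of the group algebra\<close>

lemma group_algebra_simps:
  "carrier (group_algebra k G) = fin_funs k (carrier G)"
  "\<zero>\<^bsub>group_algebra k G\<^esub> = (\<lambda>x. \<zero>)"
  "\<one>\<^bsub>group_algebra k G\<^esub> = single k \<one>\<^bsub>G\<^esub>"
  "\<phi> \<oplus>\<^bsub>group_algebra k G\<^esub> \<psi> = (\<lambda>x. \<phi> x \<oplus> \<psi> x)"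
  "\<phi> \<otimes>\<^bsub>group_algebra k G\<^esub> \<psi> = bilin_ext k (mult G) \<phi> \<psi>"
  by (simp_all add: group_algebra_def)

lemma bilin_ext_unit:
  assumes \<phi>: "\<phi> \<in> fin_funs k S"
  shows "(\<And>x. x \<in> S \<Longrightarrow> p e x = x) \<Longrightarrow> bilin_ext k p (single k e) \<phi> = \<phi>"
    and "(\<And>x. x \<in> S \<Longrightarrow> p x e = x) \<Longrightarrow> bilin_ext k p \<phi> (single k e) = \<phi>"
proof -
  have id: "(\<lambda>x. x) \<in> mod_hom k (free_mod k S) (free_mod k S)"
    by (intro mod_homI) auto
  show "bilin_ext k p (single k e) \<phi> = \<phi>" if "\<And>x. x \<in> S \<Longrightarrow> p e x = x"
    using that by (intro mod_hom_free_eqI[OF left_module_free_mod bilin_ext_hom2[of _ "{e}"] id _ \<phi>]) auto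
  show "bilin_ext k p \<phi> (single k e) = \<phi>" if "\<And>x. x \<in> S \<Longrightarrow> p x e = x"
    using that by (intro mod_hom_free_eqI[OF left_module_free_mod bilin_ext_hom[of _ "{e}"] id _ \<phi>]) auto
qed

lemma ring_group_algebra:
  assumes "monoid G"
  shows "ring (group_algebra k G)"
proof -
  interpret G: monoid G by fact
  let ?F = "free_mod k (carrier G)"
  interpret F: lmodule k ?F
    by (rule lmodule.intro) (rule left_module_free_mod)
  note h1 = mod_homD[OF bilin_ext_hom[of _ "carrier G" "carrier G" "mult G" "carrier G"]]
  note h2 = mod_homD[OF bilin_ext_hom2[of _ "carrier G" "carrier G" "mult G" "carrier G"]]
  have ab: "abelian_group (group_algebra k G)"
    using F.M.add.l_inv_ex
    by (intro abelian_groupI)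
      (auto simp: group_algebra_simps fin_funs_add a_ac free_mod_simps fun_eq_iff fin_funsD(1)[of _ "carrier G"])
  have mo: "monoid (group_algebra k G)"
    by (intro monoidI)
      (auto simp: group_algebra_simps bilin_ext_closed G.m_assoc
        intro!: bilin_ext_unit bilin_ext_assoc[of _ "carrier G" _ "carrier G" _ "carrier G" _ "carrier G" _ "carrier G" _ "carrier G"])
  show ?thesis
    using h1(2) h2(2) by (intro ringI ab mo) (auto simp: group_algebra_simps free_mod_simps)
qed

end

section \<open>Composition in the five categories\<close>

lemma OA_iff: "f \<in> OA m n \<longleftrightarrow> f \<in> {1..m} \<rightarrow>\<^sub>E {1..n} \<and> (\<forall>x\<in>{1..m}. \<forall>y\<in>{1..m}. x \<le> y \<longrightarrow> f x \<le> f y)"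
  by (simp add: OA_def FA_def monotone_on_def)

lemma OA_I:
  assumes "\<And>x. x \<in> {1..m} \<Longrightarrow> h x \<in> {1..n}"
    and "\<And>x y. x \<in> {1..m} \<Longrightarrow> y \<in> {1..m} \<Longrightarrow> x \<le> y \<Longrightarrow> h x \<le> h y"
  shows "restrict h {1..m} \<in> OA m n"
  using assms by (auto simp: OA_iff)

lemma OA_D:
  assumes "f \<in> OA m n" "x \<in> {1..m}"
  shows "f x \<in> {1..n}" "y \<in> {1..m} \<Longrightarrow> x \<le> y \<Longrightarrow> f x \<le> f y"
  using assms by (auto simp: OA_iff PiE_def)

lemma FA_compose: "f \<in> FA l m \<Longrightarrow> g \<in> FA m n \<Longrightarrow> compose {1..l} g f \<in> FA l n"
  by (auto simp: FA_def compose_def PiE_iff)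

lemma OA_compose: "f \<in> OA l m \<Longrightarrow> g \<in> OA m n \<Longrightarrow> compose {1..l} g f \<in> OA l n"
  unfolding compose_def using OA_D[of f l m] OA_D[of g m n] by (intro OA_I) auto

lemma BA_compose: "f \<in> BA l m \<Longrightarrow> g \<in> BA m n \<Longrightarrow> compose {1..l} g f \<in> BA l n"
  using FA_compose[of f l m g n]
  by (auto simp: BA_def monotone_on_def compose_def FA_def PiE_iff)

section \<open>Rotations and the cyclic order\<close>

lemma cyc_funpow_mod: "x \<in> {1..m} \<Longrightarrow> (cyc m ^^ i) x = (x - 1 + i) mod m + 1"
proof (induction i)
  case (Suc i)
  then show ?case by (simp add: cyc_def mod_Suc_eq)
qed auto

lemma cyc_funpow_mem: "x \<in> {1..m} \<Longrightarrow> (cyc m ^^ i) x \<in> {1..m}"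
  using cyc_funpow_mod[of x m i] mod_less_divisor[of m "x - 1 + i"] by (simp add: Suc_le_eq)

lemma cyc_funpow_mod': "x \<in> {1..m} \<Longrightarrow> (cyc m ^^ i) x = (cyc m ^^ (i mod m)) x"
  by (simp only: cyc_funpow_mod mod_add_right_eq)

lemma cyc_funpow_le:
  assumes "x \<in> {1..m}" "i \<le> m"
  shows "(cyc m ^^ i) x = (if x + i \<le> m then x + i else x + i - m)"
proof (cases "x + i \<le> m")
  case False
  then have "(x - 1 + i) mod m = x - 1 + i - m"
    using assms by (simp add: mod_if)
  then show ?thesis
    using False assms cyc_funpow_mod[of x m i] by auto
qed (use assms cyc_funpow_mod[of x m i] in auto)

text \<open>A rotation of the target cuts a weakly increasing sequence into two blocks; a rotation of
  the source puts the second block in front.\<close>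

lemma cyc_OA:
  assumes g: "g \<in> OA l m"
  obtains i h where "h \<in> OA l m" "\<And>x. x \<in> {1..l} \<Longrightarrow> cyc m (g x) = h ((cyc l ^^ i) x)"
proof -
  \<comment> \<open>By monotonicity the points not sent to \<open>m\<close> form an initial segment,
    and \<open>a\<close> is its last point. The inserted 0 covers the case that every point is sent
    to \<open>m\<close>.\<close>
  define a where "a = Max (insert 0 {x \<in> {1..l}. g x < m})"
  have fin: "finite (insert 0 {x \<in> {1..l}. g x < m})" by simp
  have a: "a \<in> insert 0 {x \<in> {1..l}. g x < m}"
    unfolding a_def by (rule Max_in[OF fin]) simp
  have iff: "g x < m \<longleftrightarrow> x \<le> a" if x: "x \<in> {1..l}" for x
  proof
    assume "g x < m"
    then show "x \<le> a" unfolding a_def using x by (intro Max_ge[OF fin]) auto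
  next
    assume "x \<le> a"
    then have "a \<in> {1..l}" "g a < m" using a x by auto
    then show "g x < m" using OA_D(2)[OF g x, of a] \<open>x \<le> a\<close> by auto
  qed
  have al: "a \<le> l" using a by auto
  \<comment> \<open>The \<open>l - a\<close> points with value \<open>m\<close> get the value 1
    after the rotation of the target and are moved to the front; all other values go up by
    one.\<close>
  define h where "h = (\<lambda>y\<in>{1..l}. if y \<le> l - a then 1 else g (y - (l - a)) + 1)"
  have ar: "y - (l - a) \<in> {1..l} \<and> y - (l - a) \<le> a" if "y \<in> {1..l}" "\<not> y \<le> l - a" for y
    using that al by auto
  have hOA: "h \<in> OA l m"
    unfolding h_def
  proof (rule OA_I)
    fix y assume y: "y \<in> {1..l}"
    have "g y \<in> {1..m}" using OA_D(1)[OF g y] .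
    then show "(if y \<le> l - a then 1 else g (y - (l - a)) + 1) \<in> {1..m}"
      using ar[OF y] iff[of "y - (l - a)"] by auto
  next
    fix x y assume xy: "x \<in> {1..l}" "y \<in> {1..l}" "x \<le> y"
    show "(if x \<le> l - a then 1 else g (x - (l - a)) + 1) \<le> (if y \<le> l - a then 1 else g (y - (l - a)) + 1)"
      using xy ar[OF xy(1)] ar[OF xy(2)] OA_D(2)[OF g, of "x - (l - a)" "y - (l - a)"] by auto
  qed
  have "cyc m (g x) = h ((cyc l ^^ (l - a)) x)" if x: "x \<in> {1..l}" for x
  proof -
    have gx: "g x \<in> {1..m}" using OA_D(1)[OF g x] .
    have e: "(cyc l ^^ (l - a)) x = (if x \<le> a then x + (l - a) else x - a)"
      using x al by (subst cyc_funpow_le) auto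
    show ?thesis
    proof (cases "x \<le> a")
      case True
      then have "g x < m" using iff[OF x] by simp
      moreover have "x + (l - a) \<in> {1..l}" "\<not> x + (l - a) \<le> l - a" "x + (l - a) - (l - a) = x"
        using True x al by auto
      ultimately show ?thesis using True by (simp add: e h_def cyc_def del: diff_add_assoc2)
    next
      case False
      then have "g x = m" using iff[OF x] gx by auto
      then show ?thesis using False x al by (auto simp add: e h_def cyc_def)
    qed
  qed
  then show ?thesis using that[OF hOA] by blast
qed

lemma cyc_funpow_OA:
  assumes "g \<in> OA l m"
  obtains i h where "h \<in> OA l m" "\<And>x. x \<in> {1..l} \<Longrightarrow> (cyc m ^^ j) (g x) = h ((cyc l ^^ i) x)"
proof -
  have "\<exists>i h. h \<in> OA l m \<and> (\<forall>x\<in>{1..l}. (cyc m ^^ j) (g x) = h ((cyc l ^^ i) x))"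
  proof (induction j)
    case 0
    show ?case using assms by (intro exI[of _ 0] exI[of _ g]) auto
  next
    case (Suc j)
    then obtain i h where h: "h \<in> OA l m" "\<forall>x\<in>{1..l}. (cyc m ^^ j) (g x) = h ((cyc l ^^ i) x)"
      by blast
    obtain i' h' where h': "h' \<in> OA l m" "\<And>x. x \<in> {1..l} \<Longrightarrow> cyc m (h x) = h' ((cyc l ^^ i') x)"
      using cyc_OA[OF h(1)] by blast
    have "(cyc m ^^ Suc j) (g x) = h' ((cyc l ^^ (i' + i)) x)" if "x \<in> {1..l}" for x
      using h(2) h'(2)[OF cyc_funpow_mem[OF that, of i]] that by (simp add: funpow_add)
    then show ?case using h'(1) by blast
  qed
  then show ?thesis using that by blast
qed

text \<open>Rotations of the target can be traded for rotations of the source, which leaves a normal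
  form with one rotation and one monotone map. In this form closure under composition needs a single
  further exchange.\<close>

lemma CA_iff: "f \<in> CA m n \<longleftrightarrow> (\<exists>g\<in>OA m n. \<exists>i. f = restrict (\<lambda>x. g ((cyc m ^^ i) x)) {1..m})"
proof
  assume "f \<in> CA m n"
  then obtain g i j where g: "g \<in> OA m n" "f = restrict ((cyc n ^^ j) \<circ> g \<circ> (cyc m ^^ i)) {1..m}"
    unfolding CA_def by blast
  obtain i' h where h: "h \<in> OA m n" "\<And>x. x \<in> {1..m} \<Longrightarrow> (cyc n ^^ j) (g x) = h ((cyc m ^^ i') x)"
    using cyc_funpow_OA[OF g(1)] by metis
  have "f = restrict (\<lambda>x. h ((cyc m ^^ (i' + i)) x)) {1..m}"
    unfolding g(2) using h(2) cyc_funpow_mem by (auto simp: funpow_add)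
  then show "\<exists>g\<in>OA m n. \<exists>i. f = restrict (\<lambda>x. g ((cyc m ^^ i) x)) {1..m}"
    using h(1) by blast
next
  assume "\<exists>g\<in>OA m n. \<exists>i. f = restrict (\<lambda>x. g ((cyc m ^^ i) x)) {1..m}"
  then obtain g i where g: "g \<in> OA m n" "f = restrict (\<lambda>x. g ((cyc m ^^ i) x)) {1..m}"
    by blast
  then have "f = restrict ((cyc n ^^ 0) \<circ> g \<circ> (cyc m ^^ i)) {1..m}"
    by (auto simp: comp_def)
  then show "f \<in> CA m n" unfolding CA_def using g(1) by blast
qed

lemma CA_subset_FA: "CA m n \<subseteq> FA m n"
proof
  fix f assume "f \<in> CA m n"
  then obtain g i where g: "g \<in> OA m n" "f = restrict (\<lambda>x. g ((cyc m ^^ i) x)) {1..m}"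
    unfolding CA_iff by blast
  have "g ((cyc m ^^ i) x) \<in> {1..n}" if "x \<in> {1..m}" for x
    using OA_D(1)[OF g(1) cyc_funpow_mem[OF that]] .
  then show "f \<in> FA m n" unfolding g(2) FA_def by (intro restrict_PiE_iff[THEN iffD2]) auto
qed

lemma CA_compose:
  assumes "f \<in> CA l m" "g \<in> CA m n"
  shows "compose {1..l} g f \<in> CA l n"
proof -
  obtain f' i where f: "f' \<in> OA l m" "f = restrict (\<lambda>x. f' ((cyc l ^^ i) x)) {1..l}"
    using assms(1) unfolding CA_iff by blast
  obtain g' j where g: "g' \<in> OA m n" "g = restrict (\<lambda>x. g' ((cyc m ^^ j) x)) {1..m}"
    using assms(2) unfolding CA_iff by blast
  obtain i' h where h: "h \<in> OA l m" "\<And>x. x \<in> {1..l} \<Longrightarrow> (cyc m ^^ j) (f' x) = h ((cyc l ^^ i') x)"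
    using cyc_funpow_OA[OF f(1)] by metis
  have "compose {1..l} g f = restrict (\<lambda>x. (compose {1..l} g' h) ((cyc l ^^ (i' + i)) x)) {1..l}"
  proof
    fix x
    show "compose {1..l} g f x = restrict (\<lambda>x. (compose {1..l} g' h) ((cyc l ^^ (i' + i)) x)) {1..l} x"
    proof (cases "x \<in> {1..l}")
      case True
      note x = cyc_funpow_mem[OF True, of i]
      note x' = cyc_funpow_mem[OF x, of i']
      show ?thesis
        using True x x' OA_D(1)[OF f(1) x] h(2)[OF x] by (simp add: f(2) g(2) compose_def funpow_add)
    next
      case False
      then show ?thesis by (simp only: compose_def restrict_apply if_False)
    qed
  qed
  then show ?thesis
    unfolding CA_iff using OA_compose[OF h(1) g(1)] by blast
qed

text \<open>Conjugation by the reversals preserves monotone maps and inverts rotations.\<close>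

lemma CA_reverse:
  assumes "f \<in> CA m n"
  shows "restrict (\<lambda>x. n + 1 - f (m + 1 - x)) {1..m} \<in> CA m n"
proof -
  obtain g i where g: "g \<in> OA m n" "f = restrict (\<lambda>x. g ((cyc m ^^ i) x)) {1..m}"
    using assms unfolding CA_iff by blast
  define h where "h = restrict (\<lambda>x. n + 1 - g (m + 1 - x)) {1..m}"
  have h: "h \<in> OA m n"
    unfolding h_def
  proof (rule OA_I)
    fix x assume "x \<in> {1..m}"
    then have "m + 1 - x \<in> {1..m}" by auto
    from OA_D(1)[OF g(1) this] show "n + 1 - g (m + 1 - x) \<in> {1..n}" by auto
  next
    fix x y assume "x \<in> {1..m}" "y \<in> {1..m}" "x \<le> y"
    then have "g (m + 1 - y) \<le> g (m + 1 - x)"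
      by (intro OA_D(2)[OF g(1)]) auto
    then show "n + 1 - g (m + 1 - x) \<le> n + 1 - g (m + 1 - y)" by simp
  qed
  \<comment> \<open>Rotation by \<open>i'\<close> is the inverse of rotation by \<open>i\<close>;
    for \<open>i mod m = 0\<close> it is a full turn.\<close>
  define i' where "i' = m - i mod m"
  have rot: "(cyc m ^^ i) (m + 1 - x) = m + 1 - (cyc m ^^ i') x" if x: "x \<in> {1..m}" for x
  proof -
    have rx: "m + 1 - x \<in> {1..m}" using x by auto
    have im: "i mod m < m" using x by (intro mod_less_divisor) auto
    have "(cyc m ^^ i) (m + 1 - x) = (if i mod m < x then m + 1 - x + i mod m else i mod m + 1 - x)"
      using x im cyc_funpow_le[OF rx, of "i mod m"] cyc_funpow_mod'[OF rx, of i] by auto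
    moreover have "(cyc m ^^ i') x = (if x \<le> i mod m then x + m - i mod m else x - i mod m)"
      using x im cyc_funpow_le[OF x, of i'] by (auto simp: i'_def)
    ultimately show ?thesis
    proof (cases "i mod m < x")
      case False
      then have "m + 1 - (x + m - i mod m) = i mod m + 1 - x"
        using im x unfolding atLeastAtMost_iff by linarith
      with False show ?thesis
        using \<open>(cyc m ^^ i) (m + 1 - x) = _\<close> \<open>(cyc m ^^ i') x = _\<close> by simp
    qed (use x im in auto)
  qed
  have "restrict (\<lambda>x. n + 1 - f (m + 1 - x)) {1..m} = restrict (\<lambda>x. h ((cyc m ^^ i') x)) {1..m}"
  proof (rule restrict_ext)
    fix x assume x: "x \<in> {1..m}"
    then have rx: "m + 1 - x \<in> {1..m}" by auto
    show "n + 1 - f (m + 1 - x) = h ((cyc m ^^ i') x)"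
      using x rx cyc_funpow_mem[OF x, of i'] rot[OF x] by (simp add: g(2) h_def)
  qed
  then show ?thesis unfolding CA_iff using h by blast
qed

text \<open>Each factor lies in \<open>CA\<close> up to a reversal of its target. A reversal after
  \<open>f\<close> is carried past \<open>g\<close> by replacing \<open>g\<close> with its conjugate
  \<open>?c g\<close>; two reversals cancel. This leaves four cases, each a composition in
  \<open>CA\<close>.\<close>

lemma SA_compose:
  assumes f: "f \<in> SA l m" and g: "g \<in> SA m n"
  shows "compose {1..l} g f \<in> SA l n"
proof -
  let ?R = "\<lambda>l n f. compose {1..l} (\<lambda>i. n + 1 - i) f"
  let ?c = "\<lambda>g. restrict (\<lambda>x. n + 1 - g (m + 1 - x)) {1..m}"
  have fF: "f \<in> FA l m" and gF: "g \<in> FA m n"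
    using f g by (auto simp: SA_def)
  then have fm: "f x \<in> {1..m}" if "x \<in> {1..l}" for x
    using that by (auto simp: FA_def PiE_iff)
  have gm: "g x \<in> {1..n}" if "x \<in> {1..m}" for x
    using that gF by (auto simp: FA_def PiE_iff)
  have 1: "?R l n (compose {1..l} g f) = compose {1..l} (?R m n g) f"
    using fm by (auto simp: compose_def)
  have 2: "?R l n (compose {1..l} g f) = compose {1..l} (?c g) (?R l m f)"
  proof
    fix x
    show "?R l n (compose {1..l} g f) x = compose {1..l} (?c g) (?R l m f) x"
      using fm[of x] by (auto simp: compose_def)
  qed
  have 3: "compose {1..l} g f = compose {1..l} (?c (?R m n g)) (?R l m f)"
  proof
    fix x
    show "compose {1..l} g f x = compose {1..l} (?c (?R m n g)) (?R l m f) x"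
      using fm[of x] gm[of "f x"] by (auto simp: compose_def)
  qed
  have "compose {1..l} g f \<in> CA l n \<or> ?R l n (compose {1..l} g f) \<in> CA l n"
    using f g CA_compose[of f l m g n] CA_compose[of f l m "?R m n g" n]
      CA_compose[of "?R l m f" l m "?c g" n] CA_compose[of "?R l m f" l m "?c (?R m n g)" n]
      CA_reverse[of g m n] CA_reverse[of "?R m n g" m n]
    unfolding SA_def 1[symmetric] 2[symmetric] 3[symmetric] by blast
  then show ?thesis
    using FA_compose[OF fF gF] by (auto simp: SA_def)
qed

text \<open>The common features of the five categories on which everything below rests: monotone
  maps supply collapses and factorizations, finiteness of the hom-sets supplies inverses.\<close>

locale shape_category =
  fixes C :: cat
  assumes OA_subset: "OA m n \<subseteq> C m n"
    and subset_FA: "C m n \<subseteq> FA m n"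
    and comp_closed: "f \<in> C l m \<Longrightarrow> g \<in> C m n \<Longrightarrow> compose {1..l} g f \<in> C l n"

lemma OA_subset_CA: "OA m n \<subseteq> CA m n"
proof
  fix g assume g: "g \<in> OA m n"
  then have "g = restrict (\<lambda>x. g ((cyc m ^^ 0) x)) {1..m}"
    by (auto simp: OA_iff PiE_iff extensional_restrict)
  then show "g \<in> CA m n" unfolding CA_iff using g by blast
qed

lemma shape_category_five:
  assumes "C \<in> {FA, OA, CA, BA, SA}"
  shows "shape_category C"
proof -
  have "OA m n \<subseteq> FA m n" "OA m n \<subseteq> BA m n" "OA m n \<subseteq> SA m n" "BA m n \<subseteq> FA m n" "SA m n \<subseteq> FA m n" for m n
    using OA_subset_CA[of m n] by (auto simp: OA_def BA_def SA_def)
  note incl = this OA_subset_CA CA_subset_FA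
  have "shape_category FA" by unfold_locales (use incl FA_compose in auto)
  moreover have "shape_category OA" by unfold_locales (use incl OA_compose in auto)
  moreover have "shape_category CA" by unfold_locales (use incl CA_compose in auto)
  moreover have "shape_category BA" by unfold_locales (use incl BA_compose in auto)
  moreover have "shape_category SA" by unfold_locales (use incl SA_compose in auto)
  ultimately show ?thesis using assms by blast
qed

text \<open>Otherwise the simplifier turns \<open>{1..n}\<close> into \<open>{Suc 0..n}\<close>.\<close>

declare One_nat_def [simp del]

context shape_category
begin

lemma morD: "f \<in> C m n \<Longrightarrow> x \<in> {1..m} \<Longrightarrow> f x \<in> {1..n}" "f \<in> C m n \<Longrightarrow> f \<in> extensional {1..m}"
  using subset_FA[of m n] by (auto simp: FA_def PiE_iff)

lemma mor_eqI: "f \<in> C m n \<Longrightarrow> g \<in> C m n' \<Longrightarrow> (\<And>x. x \<in> {1..m} \<Longrightarrow> f x = g x) \<Longrightarrow> f = g"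
  using morD(2) by (intro extensionalityI[of _ "{1..m}"]) auto

lemma finite_mor: "finite (C m n)"
  using subset_FA[of m n] by (rule finite_subset) (auto simp: FA_def intro!: finite_PiE)

lemma id_mem: "(\<lambda>i\<in>{1..n}. i) \<in> C n n"
  using OA_subset[of n n] OA_I[of n "\<lambda>x. x" n] by auto

lemma compose_id: "f \<in> C m n \<Longrightarrow> compose {1..m} f (\<lambda>i\<in>{1..m}. i) = f"
  using morD by (intro extensionalityI[of _ "{1..m}"]) (auto simp: compose_def)

lemma id_compose: "f \<in> C m n \<Longrightarrow> compose {1..m} (\<lambda>i\<in>{1..n}. i) f = f"
  using morD by (intro extensionalityI[of _ "{1..m}"]) (auto simp: compose_def)

lemma compose_assoc':
  "f \<in> C l m \<Longrightarrow> g \<in> C m n \<Longrightarrow>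
   compose {1..l} h (compose {1..l} g f) = compose {1..l} (compose {1..m} h g) f"
  using morD(1)[of f l m] by (auto simp: compose_def)

lemma inj_on_compose_right: "inj_on (compose {1..l} g f) {1..l} \<Longrightarrow> inj_on f {1..l}"
  by (rule inj_onI) (metis compose_eq inj_onD)

lemma inj_on_compose_iff:
  assumes "f \<in> C l m" "inj_on g {1..m}"
  shows "inj_on (compose {1..l} g f) {1..l} \<longleftrightarrow> inj_on f {1..l}"
proof
  assume f: "inj_on f {1..l}"
  show "inj_on (compose {1..l} g f) {1..l}"
  proof (rule inj_onI)
    fix x y assume xy: "x \<in> {1..l}" "y \<in> {1..l}" "compose {1..l} g f x = compose {1..l} g f y"
    then have "g (f x) = g (f y)" by (simp add: compose_def)
    then have "f x = f y" using inj_onD[OF assms(2)] morD(1)[OF assms(1)] xy by blast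
    then show "x = y" using inj_onD[OF f] xy by blast
  qed
qed (rule inj_on_compose_right)

lemma inj_card: "f \<in> C m n \<Longrightarrow> inj_on f {1..m} \<Longrightarrow> m \<le> n"
  using card_inj_on_le[of f "{1..m}" "{1..n}"] morD(1)[of f m n] by (auto simp: image_subset_iff)

text \<open>The image has fewer than \<open>m\<close> points. Ranking the points of
  \<open>[n]\<close> by the image is a monotone map \<open>q\<close> to \<open>[r]\<close>, and
  enumerating the image is a monotone map \<open>g\<close> back. So \<open>g\<close> and
  \<open>q\<close> belong to every category considered, and the first factor, \<open>q\<close> after
  \<open>f\<close>, does so by closure under composition.\<close>

lemma noninj_factor:
  assumes f: "f \<in> C m n" and ni: "\<not> inj_on f {1..m}"
  obtains r p g where "1 \<le> r" "r < m" "p \<in> C m r" "g \<in> C r n" "f = compose {1..m} g p"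
proof -
  define S where "S = f ` {1..m}"
  define r where "r = card S"
  have m: "m \<ge> 1" using ni by (cases m) auto
  have S: "S \<subseteq> {1..n}" "finite S" using morD(1)[OF f] by (auto simp: S_def)
  have r: "1 \<le> r" "r < m"
    using ni m card_image_le[of "{1..m}" f] inj_on_iff_eq_card[of "{1..m}" f] S(2)
    by (auto simp: r_def S_def One_nat_def Suc_le_eq card_gt_0_iff)
  \<comment> \<open>The rank of \<open>y\<close>: on the image \<open>S\<close> it is the increasing
    bijection onto \<open>{1..r}\<close>.\<close>
  define c where "c y = card {s \<in> S. s \<le> y}" for y
  have c_mono: "c x \<le> c y" if "x \<le> y" for x y
    unfolding c_def using that S(2) by (intro card_mono) auto
  have c_strict: "c x < c y" if "x < y" "y \<in> S" for x y
    unfolding c_def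
  proof (rule psubset_card_mono)
    show "{s \<in> S. s \<le> x} \<subset> {s \<in> S. s \<le> y}"
      using that by (intro psubsetI) (auto simp: set_eq_iff not_le intro!: exI[of _ y])
  qed (use S(2) in auto)
  have c_r: "c y \<le> r" for y
    unfolding c_def r_def using S(2) by (intro card_mono) auto
  have c_1: "c y \<ge> 1" if "y \<in> S" for y
    unfolding c_def using that S(2) by (auto simp: One_nat_def Suc_le_eq card_gt_0_iff)
  have c_inj: "inj_on c S"
    by (intro inj_onI) (metis c_strict less_irrefl linorder_neqE_nat)
  have "c ` S = {1..r}"
    using c_1 c_r card_image[OF c_inj] by (intro card_subset_eq) (auto simp: r_def)
  then have bij: "bij_betw c S {1..r}" using c_inj by (simp add: bij_betw_def)
  \<comment> \<open>Points below the whole image have rank 0, which is not a point of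
    \<open>[r]\<close>; \<open>max\<close> moves them to 1 without spoiling monotonicity.\<close>
  define q where "q = (\<lambda>y\<in>{1..n}. max 1 (c y))"
  define g where "g = (\<lambda>j\<in>{1..r}. inv_into S c j)"
  have g_mem: "inv_into S c j \<in> S" "c (inv_into S c j) = j" if "j \<in> {1..r}" for j
    using bij that by (auto simp: bij_betw_def inv_into_into f_inv_into_f)
  have q: "q \<in> OA n r"
    unfolding q_def using c_r r(1) c_mono by (intro OA_I) (auto simp: max.coboundedI2)
  have g: "g \<in> OA r n"
    unfolding g_def
  proof (rule OA_I)
    show "inv_into S c j \<in> {1..n}" if "j \<in> {1..r}" for j
      using g_mem[OF that] S by auto
    fix i j assume "i \<in> {1..r}" "j \<in> {1..r}" "i \<le> j"
    then have "\<not> c (inv_into S c j) < c (inv_into S c i)" "inv_into S c i \<in> S"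
      using g_mem by auto
    then show "inv_into S c i \<le> inv_into S c j"
      using c_strict not_le by blast
  qed
  have p: "compose {1..m} q f \<in> C m r"
    using comp_closed[OF f] q OA_subset by blast
  have "f = compose {1..m} g (compose {1..m} q f)"
  proof (rule extensionalityI[of _ "{1..m}"])
    fix x assume x: "x \<in> {1..m}"
    then have fx: "f x \<in> S" "f x \<in> {1..n}" using morD(1)[OF f x] by (auto simp: S_def)
    then have "q (f x) = c (f x)" "c (f x) \<in> {1..r}"
      using c_1[OF fx(1)] c_r[of "f x"] by (auto simp: q_def)
    then show "f x = compose {1..m} g (compose {1..m} q f) x"
      using x fx c_inj by (simp add: compose_def g_def inv_into_f_f)
  qed (use morD(2)[OF f] in auto)
  then show ?thesis
    using that[OF r p] g OA_subset by blast
qed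

section \<open>Inverses and automorphism groups\<close>

lemma funpow_mem:
  assumes f: "f \<in> C n n"
  shows "restrict (f ^^ j) {1..n} \<in> C n n"
proof (induction j)
  case 0
  then show ?case using id_mem[of n] by (simp add: id_def restrict_def)
next
  case (Suc j)
  have "(f ^^ j) x \<in> {1..n}" if "x \<in> {1..n}" for x
    using that morD(1)[OF Suc, of x] by simp
  then have "restrict (f ^^ Suc j) {1..n} = compose {1..n} f (restrict (f ^^ j) {1..n})"
    by (auto simp: compose_def)
  then show ?case using comp_closed[OF Suc f] by metis
qed

text \<open>The powers of an injective endomorphism of a finite set cannot all be distinct, and they
  stay in the category; so the inverse is a power.\<close>

lemma inverse_mem:
  assumes f: "f \<in> C n n" and inj: "inj_on f {1..n}"
  obtains g where "g \<in> C n n" "compose {1..n} g f = (\<lambda>x\<in>{1..n}. x)"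
    "compose {1..n} f g = (\<lambda>x\<in>{1..n}. x)"
proof -
  define F where "F j = restrict (f ^^ j) {1..n}" for j
  have "F ` UNIV \<subseteq> C n n" using funpow_mem[OF f] by (auto simp: F_def)
  then have "finite (range F)" using finite_mor finite_subset by blast
  then have "\<not> inj F" using finite_imageD infinite_UNIV_nat by blast
  then obtain a b where ab: "F a = F b" "a < b"
    by (metis injI linorder_neqE_nat)
  have mem: "(f ^^ j) x \<in> {1..n}" if "x \<in> {1..n}" for x j
    using morD(1)[OF funpow_mem[OF f, of j] that] that by simp
  have injp: "inj_on (f ^^ j) {1..n}" for j
  proof (induction j)
    case (Suc j)
    then show ?case using inj mem unfolding inj_on_def by (metis comp_apply funpow.simps(2))
  qed auto
  \<comment> \<open>Two powers \<open>a < b\<close> agree on \<open>{1..n}\<close>; cancelling the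
    injective power \<open>a\<close> leaves the identity as power \<open>Suc d\<close>, so power
    \<open>d\<close> is the inverse.\<close>
  define d where "d = b - a - 1"
  have b: "b = a + Suc d" using ab(2) by (simp add: d_def)
  have per: "(f ^^ Suc d) x = x" if x: "x \<in> {1..n}" for x
  proof -
    have "(f ^^ a) ((f ^^ Suc d) x) = (f ^^ b) x"
      unfolding b funpow_add by simp
    also have "\<dots> = (f ^^ a) x"
      using fun_cong[OF ab(1), of x] x by (simp add: F_def)
    finally show ?thesis using inj_onD[OF injp] mem x by blast
  qed
  show ?thesis
  proof (rule that[of "restrict (f ^^ d) {1..n}"])
    show "restrict (f ^^ d) {1..n} \<in> C n n" using funpow_mem[OF f] .
    show "compose {1..n} (restrict (f ^^ d) {1..n}) f = (\<lambda>x\<in>{1..n}. x)"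
      using per morD(1)[OF f] by (auto simp: compose_def restrict_def funpow_swap1 fun_eq_iff)
    show "compose {1..n} f (restrict (f ^^ d) {1..n}) = (\<lambda>x\<in>{1..n}. x)"
      using per by (auto simp: compose_def restrict_def fun_eq_iff)
  qed
qed

text \<open>The content is that the inverse again belongs to the category. As a consequence, an
  endomorphism of \<open>[n]\<close> is either an automorphism or noninjective, a dichotomy used
  throughout.\<close>

lemma carrier_aut: "carrier (aut C n) = {f \<in> C n n. inj_on f {1..n}}"
proof
  show "carrier (aut C n) \<subseteq> {f \<in> C n n. inj_on f {1..n}}"
  proof
    fix f assume "f \<in> carrier (aut C n)"
    then obtain g where "f \<in> C n n" "compose {1..n} g f = (\<lambda>x\<in>{1..n}. x)"
      by (auto simp: aut_def)
    moreover from this have "inj_on (compose {1..n} g f) {1..n}" by (simp add: inj_on_def)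
    ultimately show "f \<in> {f \<in> C n n. inj_on f {1..n}}" using inj_on_compose_right by blast
  qed
next
  show "{f \<in> C n n. inj_on f {1..n}} \<subseteq> carrier (aut C n)"
  proof safe
    fix f assume "f \<in> C n n" "inj_on f {1..n}"
    then show "f \<in> carrier (aut C n)"
      using inverse_mem[of f n] unfolding aut_def by (simp) blast
  qed
qed

lemma aut_simps: "mult (aut C n) = compose {1..n}" "one (aut C n) = (\<lambda>x\<in>{1..n}. x)"
  by (simp_all add: aut_def)

lemma group_aut: "group (aut C n)"
proof (rule groupI)
  fix f assume "f \<in> carrier (aut C n)"
  then have f: "f \<in> C n n" "inj_on f {1..n}" by (auto simp: carrier_aut)
  obtain g where g: "g \<in> C n n" "compose {1..n} g f = (\<lambda>x\<in>{1..n}. x)" "compose {1..n} f g = (\<lambda>x\<in>{1..n}. x)"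
    using inverse_mem[OF f] .
  have "inj_on (compose {1..n} f g) {1..n}" unfolding g(3) by (simp add: inj_on_def)
  then have "inj_on g {1..n}" by (rule inj_on_compose_right)
  then show "\<exists>g\<in>carrier (aut C n). g \<otimes>\<^bsub>aut C n\<^esub> f = \<one>\<^bsub>aut C n\<^esub>"
    using g by (auto simp: carrier_aut aut_simps)
qed (auto simp: carrier_aut aut_simps id_mem comp_closed inj_on_compose_iff compose_assoc'[symmetric]
      id_compose inj_on_def[of "\<lambda>x\<in>_. x"])

lemma finite_aut: "finite (carrier (aut C n))"
  using finite_mor by (simp add: carrier_aut)

end

section \<open>Adjacent collapses\<close>

definition collapse :: "nat \<Rightarrow> nat \<Rightarrow> nat \<Rightarrow> nat" where
  "collapse m i = (\<lambda>x\<in>{1..Suc m}. if x \<le> i then x else x - 1)"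

lemma collapse_OA: "1 \<le> i \<Longrightarrow> i \<le> m \<Longrightarrow> collapse m i \<in> OA (Suc m) m"
  unfolding collapse_def by (intro OA_I) auto

lemma collapse_eq_iff:
  assumes "x \<in> {1..Suc m}" "y \<in> {1..Suc m}" "1 \<le> i" "i \<le> m"
  shows "collapse m i x = collapse m i y \<longleftrightarrow> x = y \<or> {x, y} = {i, Suc i}"
  using assms by (auto simp: collapse_def doubleton_eq_iff)

section \<open>Modules over a category\<close>

locale cat_rep = scalar_field k + shape_category C for k :: "'k ring" (structure) and C :: cat

locale cat_module = cat_rep k C for k :: "'k ring" (structure) and C :: cat +
  fixes V :: "('k, 'v) cmod"
  assumes cmodule: "cmodule k C V"
begin

lemma left_module_Ob: "n \<ge> 1 \<Longrightarrow> left_module k (Ob V n)"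
  using cmodule cring_axioms by (auto simp: cmodule_def module_iff_left_module)

lemma lmodule_Ob: "n \<ge> 1 \<Longrightarrow> lmodule k (Ob V n)"
  using left_module_Ob by (rule lmodule.intro)

lemma Mor_hom: "m \<ge> 1 \<Longrightarrow> n \<ge> 1 \<Longrightarrow> f \<in> C m n \<Longrightarrow> Mor V m n f \<in> mod_hom k (Ob V m) (Ob V n)"
  using cmodule by (auto simp: cmodule_def)

lemma Mor_id: "n \<ge> 1 \<Longrightarrow> x \<in> carrier (Ob V n) \<Longrightarrow> Mor V n n (\<lambda>i\<in>{1..n}. i) x = x"
  using cmodule by (auto simp: cmodule_def)

lemma Mor_comp:
  "l \<ge> 1 \<Longrightarrow> m \<ge> 1 \<Longrightarrow> n \<ge> 1 \<Longrightarrow> f \<in> C l m \<Longrightarrow> g \<in> C m n \<Longrightarrow> x \<in> carrier (Ob V l) \<Longrightarrow>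
   Mor V m n g (Mor V l m f x) = Mor V l n (compose {1..l} g f) x"
  using cmodule by (auto simp: cmodule_def)

lemma Mor_props:
  assumes "m \<ge> 1" "n \<ge> 1" "f \<in> C m n"
  shows "x \<in> carrier (Ob V m) \<Longrightarrow> Mor V m n f x \<in> carrier (Ob V n)"
    and "x \<in> carrier (Ob V m) \<Longrightarrow> y \<in> carrier (Ob V m) \<Longrightarrow>
      Mor V m n f (x \<oplus>\<^bsub>Ob V m\<^esub> y) = Mor V m n f x \<oplus>\<^bsub>Ob V n\<^esub> Mor V m n f y"
    and "c \<in> carrier k \<Longrightarrow> x \<in> carrier (Ob V m) \<Longrightarrow>
      Mor V m n f (c \<odot>\<^bsub>Ob V m\<^esub> x) = c \<odot>\<^bsub>Ob V n\<^esub> Mor V m n f x"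
    and "Mor V m n f \<zero>\<^bsub>Ob V m\<^esub> = \<zero>\<^bsub>Ob V n\<^esub>"
  using mod_homD[OF Mor_hom[OF assms]] mod_hom_zero[OF left_module_Ob left_module_Ob Mor_hom] assms
  by auto

lemma csubmoduleI:
  assumes "\<And>m. m \<ge> 1 \<Longrightarrow> W m \<subseteq> carrier (Ob V m)" "\<And>m. m \<ge> 1 \<Longrightarrow> \<zero>\<^bsub>Ob V m\<^esub> \<in> W m"
    and "\<And>m x y. m \<ge> 1 \<Longrightarrow> x \<in> W m \<Longrightarrow> y \<in> W m \<Longrightarrow> x \<oplus>\<^bsub>Ob V m\<^esub> y \<in> W m"
    and "\<And>m c x. m \<ge> 1 \<Longrightarrow> c \<in> carrier k \<Longrightarrow> x \<in> W m \<Longrightarrow> c \<odot>\<^bsub>Ob V m\<^esub> x \<in> W m"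
    and "\<And>m l f x. m \<ge> 1 \<Longrightarrow> l \<ge> 1 \<Longrightarrow> f \<in> C m l \<Longrightarrow> x \<in> W m \<Longrightarrow> Mor V m l f x \<in> W l"
  shows "csubmodule k C V W"
  unfolding csubmodule_def using assms
  by (auto intro!: lmodule.left_submoduleI[OF lmodule_Ob])

lemma csubmoduleD:
  assumes "csubmodule k C V W"
  shows "m \<ge> 1 \<Longrightarrow> submodule (W m) k (Ob V m)"
    and "m \<ge> 1 \<Longrightarrow> l \<ge> 1 \<Longrightarrow> f \<in> C m l \<Longrightarrow> x \<in> W m \<Longrightarrow> Mor V m l f x \<in> W l"
  using assms unfolding csubmodule_def by blast+

text \<open>This is the largest submodule that vanishes in degree \<open>n\<close>: it vanishes
  there because of the identity morphism, and it contains any other such submodule. For the tensor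
  products with irreducible coefficients it is the radical.\<close>

definition tors :: "nat \<Rightarrow> nat \<Rightarrow> 'v set" where
  "tors n m = {x \<in> carrier (Ob V m). \<forall>f\<in>C m n. Mor V m n f x = \<zero>\<^bsub>Ob V n\<^esub>}"

lemma csubmodule_tors:
  assumes n: "n \<ge> 1"
  shows "csubmodule k C V (tors n)"
proof (rule csubmoduleI)
  interpret N: lmodule k "Ob V n" using lmodule_Ob[OF n] .
  fix m :: nat assume m: "m \<ge> 1"
  interpret M: lmodule k "Ob V m" using lmodule_Ob[OF m] .
  show "tors n m \<subseteq> carrier (Ob V m)" by (auto simp: tors_def)
  show "\<zero>\<^bsub>Ob V m\<^esub> \<in> tors n m" using Mor_props(4)[OF m n] by (auto simp: tors_def)
  show "x \<oplus>\<^bsub>Ob V m\<^esub> y \<in> tors n m" if "x \<in> tors n m" "y \<in> tors n m" for x y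
    using that Mor_props(2)[OF m n] by (auto simp: tors_def)
  show "c \<odot>\<^bsub>Ob V m\<^esub> x \<in> tors n m" if "c \<in> carrier k" "x \<in> tors n m" for c x
    using that Mor_props(3)[OF m n] by (auto simp: tors_def M.smult_closed)
  show "Mor V m l f x \<in> tors n l" if "l \<ge> 1" "f \<in> C m l" "x \<in> tors n m" for l f x
    using that m n Mor_props(1)[OF m that(1,2)] Mor_comp[OF m that(1) n that(2)] comp_closed[OF that(2)]
    by (auto simp: tors_def)
qed

lemma tors_self: "n \<ge> 1 \<Longrightarrow> tors n n = {\<zero>\<^bsub>Ob V n\<^esub>}"
  using id_mem[of n] Mor_id[of n] Mor_props(4)[of n n] left_module_Ob[of n]
    lmodule.left_submoduleD(2)[OF lmodule_Ob csubmoduleD(1)[OF csubmodule_tors], of n n]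
  by (auto simp: tors_def)

lemma cmodule_quot:
  assumes W: "csubmodule k C V W"
  shows "cmodule k C (cmod_quot V W)"
    and "m \<ge> 1 \<Longrightarrow> l \<ge> 1 \<Longrightarrow> f \<in> C m l \<Longrightarrow> x \<in> carrier (Ob V m) \<Longrightarrow>
      Mor (cmod_quot V W) m l f (W m +>\<^bsub>Ob V m\<^esub> x) = W l +>\<^bsub>Ob V l\<^esub> Mor V m l f x"
proof -
  note S = csubmoduleD(1)[OF W]
  have hom: "quot_map (Ob V l) (W l) (Mor V m l f) \<in> mod_hom k (quot_mod (Ob V m) (W m)) (quot_mod (Ob V l) (W l))"
    and coset: "x \<in> carrier (Ob V m) \<Longrightarrow>
      quot_map (Ob V l) (W l) (Mor V m l f) (W m +>\<^bsub>Ob V m\<^esub> x) = W l +>\<^bsub>Ob V l\<^esub> Mor V m l f x"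
    if "m \<ge> 1" "l \<ge> 1" "f \<in> C m l" for m l f x
  proof -
    have W': "Mor V m l f ` W m \<subseteq> W l" using that csubmoduleD(2)[OF W] by blast
    note Q = quot_map_hom[OF left_module_Ob[OF that(1)] S[OF that(1)] left_module_Ob[OF that(2)]
        S[OF that(2)] Mor_hom[OF that] W']
    show "quot_map (Ob V l) (W l) (Mor V m l f) \<in> mod_hom k (quot_mod (Ob V m) (W m)) (quot_mod (Ob V l) (W l))"
      "x \<in> carrier (Ob V m) \<Longrightarrow>
        quot_map (Ob V l) (W l) (Mor V m l f) (W m +>\<^bsub>Ob V m\<^esub> x) = W l +>\<^bsub>Ob V l\<^esub> Mor V m l f x"
      by (fact Q)+
  qed
  show "cmodule k C (cmod_quot V W)"
    unfolding cmodule_def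
  proof (intro conjI allI impI ballI)
    fix n :: nat assume n: "n \<ge> 1"
    show "Module.module k (Ob (cmod_quot V W) n)"
      using lmodule.left_module_quot_mod[OF lmodule_Ob[OF n] S[OF n]] cring_axioms
      by (simp add: module_iff_left_module cmod_quot_def)
    fix x assume "x \<in> carrier (Ob (cmod_quot V W) n)"
    then obtain y where "y \<in> carrier (Ob V n)" "x = W n +>\<^bsub>Ob V n\<^esub> y"
      by (auto simp: cmod_quot_def lmodule.carrier_quot_mod[OF lmodule_Ob[OF n]])
    then show "Mor (cmod_quot V W) n n (\<lambda>i\<in>{1..n}. i) x = x"
      using coset[OF n n id_mem] Mor_id[OF n] by (simp add: cmod_quot_def)
  next
    fix l m n :: nat and f g x
    assume *: "l \<ge> 1" "m \<ge> 1" "n \<ge> 1" "f \<in> C l m" "g \<in> C m n" "x \<in> carrier (Ob (cmod_quot V W) l)"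
    then obtain y where "y \<in> carrier (Ob V l)" "x = W l +>\<^bsub>Ob V l\<^esub> y"
      by (auto simp: cmod_quot_def lmodule.carrier_quot_mod[OF lmodule_Ob])
    then show "Mor (cmod_quot V W) l n (compose {1..l} g f) x =
      Mor (cmod_quot V W) m n g (Mor (cmod_quot V W) l m f x)"
      using * coset comp_closed[OF *(4,5)] Mor_comp[of l m n f g y] Mor_props(1)
      by (simp add: cmod_quot_def)
  qed (use hom in \<open>auto simp: cmod_quot_def\<close>)
  show "m \<ge> 1 \<Longrightarrow> l \<ge> 1 \<Longrightarrow> f \<in> C m l \<Longrightarrow> x \<in> carrier (Ob V m) \<Longrightarrow>
      Mor (cmod_quot V W) m l f (W m +>\<^bsub>Ob V m\<^esub> x) = W l +>\<^bsub>Ob V l\<^esub> Mor V m l f x"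
    using coset by (simp add: cmod_quot_def)
qed

text \<open>The hypothesis \<open>cosimple\<close> says that \<open>V\<close> is generated by any nonzero element of degree \<open>n\<close>.\<close>

context
  fixes n :: nat
  assumes n: "n \<ge> 1" and nonzero: "carrier (Ob V n) \<noteq> {\<zero>\<^bsub>Ob V n\<^esub>}"
    and cosimple: "\<And>W. csubmodule k C V W \<Longrightarrow>
      W n = {\<zero>\<^bsub>Ob V n\<^esub>} \<or> (\<forall>m\<ge>1. W m = carrier (Ob V m))"
begin

lemma csubmodule_subset_tors:
  assumes W: "csubmodule k C V W" "W n = {\<zero>\<^bsub>Ob V n\<^esub>}" and m: "m \<ge> 1"
  shows "W m \<subseteq> tors n m"
  using csubmoduleD(2)[OF W(1) m n] W(2) lmodule.left_submoduleD(1)[OF lmodule_Ob csubmoduleD(1)[OF W(1)], OF m m]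
  by (auto simp: tors_def)

text \<open>By \<open>cosimple\<close> a proper submodule vanishes in degree \<open>n\<close> and so
  lies in \<open>tors n\<close>. Hence there is exactly one maximal submodule, up to the value at
  index 0, which no condition restricts.\<close>

lemma maximal_csubmodule_iff: "maximal_csubmodule k C V W \<longleftrightarrow> csubmodule k C V W \<and> (\<forall>m\<ge>1. W m = tors n m)"
proof
  assume W: "maximal_csubmodule k C V W"
  then have "W n = {\<zero>\<^bsub>Ob V n\<^esub>}" "csubmodule k C V W"
    using cosimple by (auto simp: maximal_csubmodule_def)
  then have "\<forall>m\<ge>1. W m \<subseteq> tors n m"
    using csubmodule_subset_tors by blast
  moreover have "\<not> (\<forall>m\<ge>1. tors n m = carrier (Ob V m))"
    using tors_self[OF n] nonzero n by auto
  ultimately show "csubmodule k C V W \<and> (\<forall>m\<ge>1. W m = tors n m)"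
    using W csubmodule_tors[OF n] unfolding maximal_csubmodule_def by metis
next
  assume W: "csubmodule k C V W \<and> (\<forall>m\<ge>1. W m = tors n m)"
  have "\<not> (\<forall>m\<ge>1. W m = carrier (Ob V m))"
    using tors_self[OF n] nonzero n W by auto
  moreover have "(\<forall>m\<ge>1. U m = W m) \<or> (\<forall>m\<ge>1. U m = carrier (Ob V m))"
    if "csubmodule k C V U" "\<forall>m\<ge>1. W m \<subseteq> U m" for U
    using cosimple[OF that(1)] csubmodule_subset_tors[OF that(1)] that(2) W by blast
  ultimately show "maximal_csubmodule k C V W"
    using W unfolding maximal_csubmodule_def by blast
qed

lemma cmod_rad_eq_tors: "m \<ge> 1 \<Longrightarrow> cmod_rad k C V m = tors n m"
  using csubmodule_tors[OF n] by (auto simp: cmod_rad_def maximal_csubmodule_iff tors_def)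

lemma csubmodule_rad: "csubmodule k C V (cmod_rad k C V)"
  using csubmodule_tors[OF n] by (simp add: csubmodule_def cmod_rad_eq_tors)

text \<open>A submodule of the top is the image of its preimage \<open>W\<close>, to which
  \<open>cosimple\<close> applies: either \<open>W\<close> vanishes in degree \<open>n\<close> and
  lies in the radical, or it is everything.\<close>

lemma irreducible_cmod_top: "irreducible_cmodule k C (cmod_top k C V)"
  unfolding irreducible_cmodule_def
proof (intro conjI allI impI)
  let ?K = "cmod_rad k C V"
  let ?Q = "cmod_top k C V"
  note Q = cmodule_quot[OF csubmodule_rad]
  show cQ: "cmodule k C ?Q" unfolding cmod_top_def by (rule Q)
  interpret Q: cat_module k C ?Q by unfold_locales (rule cQ)
  note carrQ = lmodule.carrier_quot_mod[OF lmodule_Ob]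
  have ObQ: "Ob ?Q m = quot_mod (Ob V m) (?K m)" for m by (simp add: cmod_top_def cmod_quot_def)
  \<comment> \<open>Degree \<open>n\<close> survives in the quotient, which is therefore
    nonzero.\<close>
  have Kz: "?K n = {\<zero>\<^bsub>Ob V n\<^esub>}" using cmod_rad_eq_tors[OF n] tors_self[OF n] by simp
  show "\<exists>m\<ge>1. carrier (Ob ?Q m) \<noteq> {\<zero>\<^bsub>Ob ?Q m\<^esub>}"
  proof (intro exI[of _ n] conjI n notI)
    assume *: "carrier (Ob ?Q n) = {\<zero>\<^bsub>Ob ?Q n\<^esub>}"
    interpret N: lmodule k "Ob V n" using lmodule_Ob[OF n] .
    have "x \<in> ?K n" if "x \<in> carrier (Ob V n)" for x
      using * that N.coset_eq_zero_iff[OF csubmoduleD(1)[OF csubmodule_rad n] that]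
      by (auto simp: ObQ N.carrier_quot_mod N.zero_quot_mod)
    then have "carrier (Ob V n) \<subseteq> {\<zero>\<^bsub>Ob V n\<^esub>}" unfolding Kz by blast
    then show False using nonzero N.M.zero_closed by blast
  qed
  fix U assume U: "csubmodule k C ?Q U"
  define W where "W m = {x \<in> carrier (Ob V m). ?K m +>\<^bsub>Ob V m\<^esub> x \<in> U m}" for m
  have W: "csubmodule k C V W"
    unfolding csubmodule_def
  proof (intro conjI allI impI ballI)
    fix m :: nat assume m: "m \<ge> 1"
    show "submodule (W m) k (Ob V m)"
      unfolding W_def using Q.csubmoduleD(1)[OF U m] Q.left_module_Ob[OF m]
      by (intro submodule_vimage[OF left_module_Ob[OF m] Q.left_module_Ob[OF m]])
        (auto simp: ObQ intro!: lmodule.quot_proj_hom lmodule_Ob csubmoduleD(1)[OF csubmodule_rad] m)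
    fix l f assume l: "l \<ge> 1" "f \<in> C m l"
    show "Mor V m l f ` W m \<subseteq> W l"
      using Q.csubmoduleD(2)[OF U m l] Q(2)[OF m l] Mor_props(1)[OF m l]
      by (fastforce simp: W_def cmod_top_def)
  qed
  have U_eq: "U m = (\<lambda>x. ?K m +>\<^bsub>Ob V m\<^esub> x) ` W m" if m: "m \<ge> 1" for m
  proof (rule Set.set_eqI)
    fix X
    have "X \<in> U m \<Longrightarrow> X \<in> (\<lambda>x. ?K m +>\<^bsub>Ob V m\<^esub> x) ` carrier (Ob V m)"
      using lmodule.left_submoduleD(1)[OF Q.lmodule_Ob[OF m] Q.csubmoduleD(1)[OF U m]]
      unfolding ObQ carrQ[OF m] by blast
    then show "X \<in> U m \<longleftrightarrow> X \<in> (\<lambda>x. ?K m +>\<^bsub>Ob V m\<^esub> x) ` W m"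
      unfolding W_def by blast
  qed
  show "(\<forall>m\<ge>1. U m = {\<zero>\<^bsub>Ob ?Q m\<^esub>}) \<or> (\<forall>m\<ge>1. U m = carrier (Ob ?Q m))"
    using cosimple[OF W]
  proof
    assume z: "W n = {\<zero>\<^bsub>Ob V n\<^esub>}"
    have "U m = {\<zero>\<^bsub>Ob ?Q m\<^esub>}" if m: "m \<ge> 1" for m
    proof -
      interpret M: lmodule k "Ob V m" using lmodule_Ob[OF m] .
      have "?K m +>\<^bsub>Ob V m\<^esub> x = ?K m" if "x \<in> W m" for x
      proof -
        have "x \<in> ?K m" using csubmodule_subset_tors[OF W z m] that cmod_rad_eq_tors[OF m] by auto
        then show ?thesis
          using M.coset_eq_zero_iff[OF csubmoduleD(1)[OF csubmodule_rad m], of x] that by (auto simp: W_def)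
      qed
      moreover have "\<zero>\<^bsub>Ob V m\<^esub> \<in> W m" using M.left_submoduleD(2)[OF csubmoduleD(1)[OF W m]] .
      ultimately show ?thesis unfolding U_eq[OF m] ObQ M.zero_quot_mod by (auto simp: image_iff)
    qed
    then show ?thesis by blast
  next
    assume "\<forall>m\<ge>1. W m = carrier (Ob V m)"
    then have "U m = carrier (Ob ?Q m)" if "m \<ge> 1" for m
      using U_eq[OF that] that by (simp add: ObQ carrQ)
    then show ?thesis by blast
  qed
qed

end

lemma cmod_iso_quot_zero:
  assumes W: "csubmodule k C V W" "\<And>m. m \<ge> 1 \<Longrightarrow> W m = {\<zero>\<^bsub>Ob V m\<^esub>}"
  shows "cmod_iso k C V (cmod_quot V W)"
  unfolding cmod_iso_def
proof (intro bexI[of _ "\<lambda>m x. W m +>\<^bsub>Ob V m\<^esub> x"] allI impI)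
  note S = csubmoduleD(1)[OF W(1)]
  show "(\<lambda>m x. W m +>\<^bsub>Ob V m\<^esub> x) \<in> cmod_hom k C V (cmod_quot V W)"
    unfolding cmod_hom_def using cmodule_quot(2)[OF W(1)]
    by (auto simp: cmod_quot_def intro!: lmodule.quot_proj_hom lmodule_Ob S)
  fix m :: nat assume m: "m \<ge> 1"
  interpret M: lmodule k "Ob V m" using lmodule_Ob[OF m] .
  have "inj_on (\<lambda>x. W m +>\<^bsub>Ob V m\<^esub> x) (carrier (Ob V m))"
  proof (rule inj_onI)
    fix x y assume xy: "x \<in> carrier (Ob V m)" "y \<in> carrier (Ob V m)" "W m +>\<^bsub>Ob V m\<^esub> x = W m +>\<^bsub>Ob V m\<^esub> y"
    then have "x \<ominus>\<^bsub>Ob V m\<^esub> y = \<zero>\<^bsub>Ob V m\<^esub>" using M.coset_eq_iff[OF S[OF m]] W(2)[OF m] by auto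
    then show "x = y" using xy M.diff_eq_zero_iff by simp
  qed
  then show "bij_betw (\<lambda>x. W m +>\<^bsub>Ob V m\<^esub> x) (carrier (Ob V m)) (carrier (Ob (cmod_quot V W) m))"
    by (simp add: bij_betw_def cmod_quot_def M.carrier_quot_mod)
qed

end

lemma mod_hom_inv_into:
  assumes M: "lmodule A M" and f: "f \<in> mod_hom A M N" "bij_betw f (carrier M) (carrier N)"
  shows "inv_into (carrier M) f \<in> mod_hom A N M"
proof (rule mod_homI)
  interpret M: lmodule A M by fact
  let ?g = "inv_into (carrier M) f"
  have g: "?g y \<in> carrier M" "f (?g y) = y" if "y \<in> carrier N" for y
    using f(2) that by (auto simp: bij_betw_def inv_into_into f_inv_into_f)
  have eqI: "?g y = x" if "x \<in> carrier M" "f x = y" for x y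
    using f(2) that by (auto simp: bij_betw_def inv_into_f_f)
  show "?g x \<in> carrier M" if "x \<in> carrier N" for x using g that by blast
  show "?g (x \<oplus>\<^bsub>N\<^esub> y) = ?g x \<oplus>\<^bsub>M\<^esub> ?g y" if "x \<in> carrier N" "y \<in> carrier N" for x y
    using g that mod_homD(2)[OF f(1)] by (intro eqI) auto
  show "?g (a \<odot>\<^bsub>N\<^esub> x) = a \<odot>\<^bsub>M\<^esub> ?g x" if "a \<in> carrier A" "x \<in> carrier N" for a x
    using g that mod_homD(3)[OF f(1)] by (intro eqI) (auto simp: M.smult_closed)
qed

lemma cmod_homD:
  assumes "t \<in> cmod_hom k C V W"
  shows "n \<ge> 1 \<Longrightarrow> t n \<in> mod_hom k (Ob V n) (Ob W n)"
    and "m \<ge> 1 \<Longrightarrow> n \<ge> 1 \<Longrightarrow> f \<in> C m n \<Longrightarrow> x \<in> carrier (Ob V m) \<Longrightarrow>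
      t n (Mor V m n f x) = Mor W m n f (t m x)"
  using assms by (auto simp: cmod_hom_def)

lemma (in cat_module) cmod_iso_sym:
  assumes "cmod_iso k C V W"
  shows "cmod_iso k C W V"
proof -
  obtain t where t: "t \<in> cmod_hom k C V W" "\<And>n. n \<ge> 1 \<Longrightarrow> bij_betw (t n) (carrier (Ob V n)) (carrier (Ob W n))"
    using assms by (auto simp: cmod_iso_def)
  let ?s = "\<lambda>n. inv_into (carrier (Ob V n)) (t n)"
  have "?s \<in> cmod_hom k C W V"
    unfolding cmod_hom_def
  proof (intro CollectI conjI allI impI ballI)
    fix n :: nat assume n: "n \<ge> 1"
    show "?s n \<in> mod_hom k (Ob W n) (Ob V n)"
      using mod_hom_inv_into[OF lmodule_Ob[OF n] cmod_homD(1)[OF t(1) n] t(2)[OF n]] .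
  next
    fix m n :: nat and f x assume *: "m \<ge> 1" "n \<ge> 1" "f \<in> C m n" "x \<in> carrier (Ob W m)"
    define y where "y = ?s m x"
    have y: "y \<in> carrier (Ob V m)" "t m y = x"
      using *(4) t(2)[OF *(1)] by (auto simp: y_def bij_betw_def inv_into_into f_inv_into_f)
    have "?s n (Mor W m n f x) = ?s n (t n (Mor V m n f y))"
      using cmod_homD(2)[OF t(1) *(1-3) y(1)] y(2) by simp
    also have "\<dots> = Mor V m n f y"
      using t(2)[OF *(2)] Mor_props(1)[OF *(1-3) y(1)] by (simp add: bij_betw_def inv_into_f_f)
    finally show "?s n (Mor W m n f x) = Mor V m n f (?s m x)" by (simp add: y_def)
  qed
  moreover have "\<forall>n\<ge>1. bij_betw (?s n) (carrier (Ob W n)) (carrier (Ob V n))"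
    using t(2) by (simp add: bij_betw_inv_into)
  ultimately show ?thesis unfolding cmod_iso_def by (intro bexI[of _ ?s])
qed

section \<open>Irreducible modules over a category\<close>

text \<open>The submodule of the direct sum generated by the graph of \<theta>, written as a
  relation between the two modules so that no direct sum has to be built. Zero and scalar multiples
  are not among the rules; they are obtained from the generators by linearity.\<close>

inductive graph_gen ::
  "cat \<Rightarrow> ('k, 'v) cmod \<Rightarrow> ('k, 'w) cmod \<Rightarrow> nat \<Rightarrow> ('v \<Rightarrow> 'w) \<Rightarrow> nat \<Rightarrow> 'v \<Rightarrow> 'w \<Rightarrow> bool"
  for C V V' n \<theta> m where
  gen: "v \<in> carrier (Ob V n) \<Longrightarrow> h \<in> C n m \<Longrightarrow>
    graph_gen C V V' n \<theta> m (Mor V n m h v) (Mor V' n m h (\<theta> v))"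
| add: "graph_gen C V V' n \<theta> m x y \<Longrightarrow> graph_gen C V V' n \<theta> m x' y' \<Longrightarrow>
    graph_gen C V V' n \<theta> m (x \<oplus>\<^bsub>Ob V m\<^esub> x') (y \<oplus>\<^bsub>Ob V' m\<^esub> y')"

context cat_rep
begin

text \<open>Schur's lemma for modules over a category: kernel and image are submodules, and one
  nonzero value forces the kernel to vanish and the image to be everything, in every degree.\<close>

lemma irreducible_bij:
  assumes V: "irreducible_cmodule k C V" and W: "irreducible_cmodule k C W" and t: "t \<in> cmod_hom k C V W"
    and n: "n \<ge> 1" "x \<in> carrier (Ob V n)" "t n x \<noteq> \<zero>\<^bsub>Ob W n\<^esub>" and m: "m \<ge> 1"
  shows "bij_betw (t m) (carrier (Ob V m)) (carrier (Ob W m))"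
proof -
  interpret V: cat_module k C V using V by unfold_locales (simp add: irreducible_cmodule_def)
  interpret W: cat_module k C W using W by unfold_locales (simp add: irreducible_cmodule_def)
  note th = cmod_homD[OF t]
  define K where "K m = {x \<in> carrier (Ob V m). t m x \<in> {\<zero>\<^bsub>Ob W m\<^esub>}}" for m
  have K: "csubmodule k C V K"
    unfolding csubmodule_def
  proof (intro conjI allI impI ballI)
    fix m :: nat assume m: "m \<ge> 1"
    show "submodule (K m) k (Ob V m)"
      unfolding K_def
      by (intro submodule_vimage[OF V.left_module_Ob[OF m] W.left_module_Ob[OF m] th(1)[OF m]]
        lmodule.submodule_zero W.lmodule_Ob m)
    fix l f assume l: "l \<ge> 1" "f \<in> C m l"
    show "Mor V m l f ` K m \<subseteq> K l"
      using th(2)[OF m l] V.Mor_props(1)[OF m l] W.Mor_props(4)[OF m l] by (auto simp: K_def)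
  qed
  have "x \<notin> K n" using n by (simp add: K_def)
  then have "\<not> (\<forall>m\<ge>1. K m = carrier (Ob V m))" using n by auto
  then have Kz: "K m = {\<zero>\<^bsub>Ob V m\<^esub>}"
    using V K m unfolding irreducible_cmodule_def by blast
  have I: "csubmodule k C W (\<lambda>m. t m ` carrier (Ob V m))"
    unfolding csubmodule_def
  proof (intro conjI allI impI ballI)
    fix m :: nat assume m: "m \<ge> 1"
    show "submodule (t m ` carrier (Ob V m)) k (Ob W m)"
      by (intro submodule_image[OF V.left_module_Ob[OF m] W.left_module_Ob[OF m] th(1)[OF m]]
        lmodule.submodule_carrier V.lmodule_Ob m)
    fix l f assume l: "l \<ge> 1" "f \<in> C m l"
    show "Mor W m l f ` t m ` carrier (Ob V m) \<subseteq> t l ` carrier (Ob V l)"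
      using th(2)[OF m l] V.Mor_props(1)[OF m l] by (force simp: image_iff)
  qed
  have "t n ` carrier (Ob V n) \<noteq> {\<zero>\<^bsub>Ob W n\<^esub>}" using n by auto
  then have "t m ` carrier (Ob V m) = carrier (Ob W m)"
    using W I m n unfolding irreducible_cmodule_def by blast
  moreover have "inj_on (t m) (carrier (Ob V m))"
  proof (rule inj_onI)
    interpret M: lmodule k "Ob V m" using V.lmodule_Ob[OF m] .
    interpret N: lmodule k "Ob W m" using W.lmodule_Ob[OF m] .
    fix x y assume xy: "x \<in> carrier (Ob V m)" "y \<in> carrier (Ob V m)" "t m x = t m y"
    then have "x \<ominus>\<^bsub>Ob V m\<^esub> y \<in> K m"
      using mod_hom_minus[OF V.left_module_Ob[OF m] W.left_module_Ob[OF m] th(1)[OF m]]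
        mod_homD(1)[OF th(1)[OF m]] N.diff_eq_zero_iff by (simp add: K_def)
    then show "x = y" using xy Kz M.diff_eq_zero_iff by simp
  qed
  ultimately show ?thesis by (simp add: bij_betw_def)
qed

text \<open>The submodule of the direct sum generated by the graph of \<open>\<theta>\<close> meets degree \<open>n\<close> in the
  graph of \<open>\<theta>\<close>, so by irreducibility it is the graph of a morphism.\<close>

lemma irreducible_iso_of_degree:
  assumes V: "irreducible_cmodule k C V" and V': "irreducible_cmodule k C V'"
    and n: "n \<ge> 1" and nonzero: "carrier (Ob V n) \<noteq> {\<zero>\<^bsub>Ob V n\<^esub>}"
    and \<theta>: "\<theta> \<in> mod_hom k (Ob V n) (Ob V' n)" "bij_betw \<theta> (carrier (Ob V n)) (carrier (Ob V' n))"
    and equiv: "\<And>h x. h \<in> C n n \<Longrightarrow> x \<in> carrier (Ob V n) \<Longrightarrow>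
      \<theta> (Mor V n n h x) = Mor V' n n h (\<theta> x)"
  shows "cmod_iso k C V V'"
proof -
  interpret V: cat_module k C V using V by unfold_locales (simp add: irreducible_cmodule_def)
  interpret V': cat_module k C V' using V' by unfold_locales (simp add: irreducible_cmodule_def)
  note th = mod_homD[OF \<theta>(1)]
  interpret N: lmodule k "Ob V n" using V.lmodule_Ob[OF n] .
  interpret N': lmodule k "Ob V' n" using V'.lmodule_Ob[OF n] .
  have \<theta>z: "\<theta> \<zero>\<^bsub>Ob V n\<^esub> = \<zero>\<^bsub>Ob V' n\<^esub>"
    using mod_hom_zero[OF V.left_module_Ob[OF n] V'.left_module_Ob[OF n] \<theta>(1)] .
  let ?R = "graph_gen C V V' n \<theta>"
  have R_in: "x \<in> carrier (Ob V m) \<and> y \<in> carrier (Ob V' m)" if "?R m x y" "m \<ge> 1" for m x y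
    using that(1)
  proof induction
    case (gen v h)
    then show ?case using V.Mor_props(1)[OF n that(2)] V'.Mor_props(1)[OF n that(2)] th(1) by blast
  next
    case (add x y x' y')
    interpret M: lmodule k "Ob V m" using V.lmodule_Ob[OF that(2)] .
    interpret M': lmodule k "Ob V' m" using V'.lmodule_Ob[OF that(2)] .
    show ?case using add by simp
  qed
  have R_zero: "?R m \<zero>\<^bsub>Ob V m\<^esub> \<zero>\<^bsub>Ob V' m\<^esub>" if m: "m \<ge> 1" and ne: "C n m \<noteq> {}" for m
  proof -
    obtain h where h: "h \<in> C n m" using ne by blast
    show ?thesis
      using graph_gen.gen[of "\<zero>\<^bsub>Ob V n\<^esub>" V n h C m V' \<theta>] h V.Mor_props(4)[OF n m h] V'.Mor_props(4)[OF n m h] \<theta>z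
      by simp
  qed
  \<comment> \<open>A constant map is monotone, so there is always a generator whose value at zero
    is the pair of zeros.\<close>
  have C_ne: "C n m \<noteq> {}" if m: "m \<ge> 1" for m
  proof -
    have "(\<lambda>i\<in>{1..n}. 1) \<in> OA n m" using m by (intro OA_I) auto
    then show ?thesis using OA_subset by blast
  qed
  have R_smult: "?R m (c \<odot>\<^bsub>Ob V m\<^esub> x) (c \<odot>\<^bsub>Ob V' m\<^esub> y)"
    if "?R m x y" "m \<ge> 1" "c \<in> carrier k" for m x y c
    using that(1)
  proof induction
    case (gen v h)
    then show ?case
      using graph_gen.gen[of "c \<odot>\<^bsub>Ob V n\<^esub> v" V n h C m V' \<theta>] that(3) V.Mor_props(3)[OF n that(2)]
        V'.Mor_props(3)[OF n that(2)] th by (simp add: N.smult_closed)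
  next
    case (add x y x' y')
    interpret M: lmodule k "Ob V m" using V.lmodule_Ob[OF that(2)] .
    interpret M': lmodule k "Ob V' m" using V'.lmodule_Ob[OF that(2)] .
    show ?case
      using graph_gen.add[OF add.IH] R_in[OF add.hyps(1) that(2)] R_in[OF add.hyps(2) that(2)] that(3)
      by (simp add: M.smult_r_distr M'.smult_r_distr)
  qed
  have R_Mor: "?R l (Mor V m l f x) (Mor V' m l f y)"
    if "?R m x y" "m \<ge> 1" "l \<ge> 1" "f \<in> C m l" for m l f x y
    using that(1)
  proof induction
    case (gen v h)
    then show ?case
      using graph_gen.gen[of v V n "compose {1..n} f h" C l V' \<theta>] comp_closed[OF gen(2) that(4)]
        V.Mor_comp[OF n that(2,3) gen(2) that(4)] V'.Mor_comp[OF n that(2,3) gen(2) that(4)] th(1) by simp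
  next
    case (add x y x' y')
    show ?case
      using graph_gen.add[OF add.IH] R_in[OF add.hyps(1) that(2)] R_in[OF add.hyps(2) that(2)]
        V.Mor_props(2)[OF that(2-4)] V'.Mor_props(2)[OF that(2-4)] by simp
  qed
  \<comment> \<open>Compatibility with all endomorphisms of \<open>[n]\<close>, noninjective ones
    included, keeps every generator of degree \<open>n\<close> on the graph of \<theta>.\<close>
  have R_n: "y = \<theta> x" if "?R n x y" for x y
    using that
  proof induction
    case (gen v h)
    then show ?case using equiv by simp
  next
    case (add x y x' y')
    then show ?case using R_in[OF add.hyps(1) n] R_in[OF add.hyps(2) n] th(2) by simp
  qed
  have R_theta: "?R n x (\<theta> x)" if "x \<in> carrier (Ob V n)" for x
    using graph_gen.gen[of x V n "\<lambda>i\<in>{1..n}. i" C n V' \<theta>] id_mem V.Mor_id[OF n] V'.Mor_id[OF n] that th(1) by simp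
  \<comment> \<open>The domain of the relation is a submodule that contains all of degree
    \<open>n\<close>, hence it is the whole of \<open>V\<close>.\<close>
  have "csubmodule k C V (\<lambda>m. {x. \<exists>y. ?R m x y})"
  proof (rule V.csubmoduleI)
    fix m :: nat assume m: "m \<ge> 1"
    show "{x. \<exists>y. ?R m x y} \<subseteq> carrier (Ob V m)" using R_in m by blast
    show "\<zero>\<^bsub>Ob V m\<^esub> \<in> {x. \<exists>y. ?R m x y}" using R_zero[OF m C_ne[OF m]] by blast
    show "\<And>x y. x \<in> {x. \<exists>y. ?R m x y} \<Longrightarrow> y \<in> {x. \<exists>y. ?R m x y} \<Longrightarrow> x \<oplus>\<^bsub>Ob V m\<^esub> y \<in> {x. \<exists>y. ?R m x y}"
      using graph_gen.add[of C V V' n \<theta>] by blast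
    show "\<And>c x. c \<in> carrier k \<Longrightarrow> x \<in> {x. \<exists>y. ?R m x y} \<Longrightarrow> c \<odot>\<^bsub>Ob V m\<^esub> x \<in> {x. \<exists>y. ?R m x y}"
      using R_smult[OF _ m] by blast
    show "\<And>l f x. l \<ge> 1 \<Longrightarrow> f \<in> C m l \<Longrightarrow> x \<in> {x. \<exists>y. ?R m x y} \<Longrightarrow> Mor V m l f x \<in> {x. \<exists>y. ?R l x y}"
      using R_Mor[OF _ m] by blast
  qed
  moreover have "{x. \<exists>y. ?R n x y} \<noteq> {\<zero>\<^bsub>Ob V n\<^esub>}" using R_theta nonzero N.M.zero_closed by blast
  ultimately have dom: "\<exists>y. ?R m x y" if "m \<ge> 1" "x \<in> carrier (Ob V m)" for m x
    using V n that unfolding irreducible_cmodule_def by blast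
  \<comment> \<open>The values related to zero measure the failure of single-valuedness. They form a
    submodule of \<open>V'\<close> that is zero in degree \<open>n\<close>, so by irreducibility it
    is zero everywhere.\<close>
  have Y: "csubmodule k C V' (\<lambda>m. {y. ?R m \<zero>\<^bsub>Ob V m\<^esub> y})"
  proof (rule V'.csubmoduleI)
    fix m :: nat assume m: "m \<ge> 1"
    interpret M: lmodule k "Ob V m" using V.lmodule_Ob[OF m] .
    show "x \<oplus>\<^bsub>Ob V' m\<^esub> y \<in> {y. ?R m \<zero>\<^bsub>Ob V m\<^esub> y}"
      if "x \<in> {y. ?R m \<zero>\<^bsub>Ob V m\<^esub> y}" "y \<in> {y. ?R m \<zero>\<^bsub>Ob V m\<^esub> y}" for x y
      using that graph_gen.add[of C V V' n \<theta> m "\<zero>\<^bsub>Ob V m\<^esub>" x "\<zero>\<^bsub>Ob V m\<^esub>" y] by simp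
    show "c \<odot>\<^bsub>Ob V' m\<^esub> y \<in> {y. ?R m \<zero>\<^bsub>Ob V m\<^esub> y}"
      if "c \<in> carrier k" "y \<in> {y. ?R m \<zero>\<^bsub>Ob V m\<^esub> y}" for c y
      using R_smult[of m "\<zero>\<^bsub>Ob V m\<^esub>" y c] m that by simp
    show "Mor V' m l f y \<in> {y. ?R l \<zero>\<^bsub>Ob V l\<^esub> y}"
      if "l \<ge> 1" "f \<in> C m l" "y \<in> {y. ?R m \<zero>\<^bsub>Ob V m\<^esub> y}" for l f y
      using R_Mor[of m "\<zero>\<^bsub>Ob V m\<^esub>" y l f] m that V.Mor_props(4)[OF m that(1,2)] by simp
  qed (use R_in R_zero C_ne in auto)
  have "x = y" if "?R n \<zero>\<^bsub>Ob V n\<^esub> x" "?R n \<zero>\<^bsub>Ob V n\<^esub> y" for x y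
    using that R_n by metis
  moreover have "carrier (Ob V' n) \<noteq> {\<zero>\<^bsub>Ob V' n\<^esub>}"
  proof
    assume z: "carrier (Ob V' n) = {\<zero>\<^bsub>Ob V' n\<^esub>}"
    then have "\<theta> x = \<theta> \<zero>\<^bsub>Ob V n\<^esub>" if "x \<in> carrier (Ob V n)" for x
      using th(1)[OF that] \<theta>z by auto
    then have "x = \<zero>\<^bsub>Ob V n\<^esub>" if "x \<in> carrier (Ob V n)" for x
      using \<theta>(2) that N.M.zero_closed unfolding bij_betw_def inj_on_def by blast
    then show False using nonzero N.M.zero_closed by blast
  qed
  ultimately have "{y. ?R n \<zero>\<^bsub>Ob V n\<^esub> y} \<noteq> carrier (Ob V' n)"
    using N'.M.zero_closed by blast
  then have fun0: "y = \<zero>\<^bsub>Ob V' m\<^esub>" if "m \<ge> 1" "?R m \<zero>\<^bsub>Ob V m\<^esub> y" for m y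
    using V' n Y that unfolding irreducible_cmodule_def by blast
  have func: "y = y'" if m: "m \<ge> 1" and R: "?R m x y" "?R m x y'" for m x y y'
  proof -
    interpret M: lmodule k "Ob V m" using V.lmodule_Ob[OF m] .
    interpret M': lmodule k "Ob V' m" using V'.lmodule_Ob[OF m] .
    have "?R m (x \<oplus>\<^bsub>Ob V m\<^esub> (\<ominus> \<one>) \<odot>\<^bsub>Ob V m\<^esub> x) (y \<oplus>\<^bsub>Ob V' m\<^esub> (\<ominus> \<one>) \<odot>\<^bsub>Ob V' m\<^esub> y')"
      using R_smult[OF R(2) m, of "\<ominus> \<one>"] by (intro graph_gen.add R) auto
    then have "?R m \<zero>\<^bsub>Ob V m\<^esub> (y \<ominus>\<^bsub>Ob V' m\<^esub> y')"
      using R_in[OF R(1) m] R_in[OF R(2) m]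
      by (simp add: M.smult_minus_one M'.smult_minus_one M.M.r_neg M'.M.minus_eq)
    then show ?thesis
      using fun0[OF m] R_in[OF R(1) m] R_in[OF R(2) m] M'.diff_eq_zero_iff by blast
  qed
  define t where "t m x = (THE y. ?R m x y)" for m x
  have t: "?R m x (t m x)" if "m \<ge> 1" "x \<in> carrier (Ob V m)" for m x
    unfolding t_def using dom[OF that] func[OF that(1)] by (metis theI)
  have t_eq: "t m x = y" if "m \<ge> 1" "?R m x y" for m x y
    using func[OF that(1) t that(2)] R_in[OF that(2,1)] that(1) by simp
  have th: "t \<in> cmod_hom k C V V'"
    unfolding cmod_hom_def
  proof (intro CollectI conjI allI impI ballI mod_homI)
    fix m :: nat and x assume m: "m \<ge> 1" and x: "x \<in> carrier (Ob V m)"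
    show "t m x \<in> carrier (Ob V' m)" using R_in[OF t m] m x by blast
    show "t m (x \<oplus>\<^bsub>Ob V m\<^esub> y) = t m x \<oplus>\<^bsub>Ob V' m\<^esub> t m y" if "y \<in> carrier (Ob V m)" for y
      using m x that by (intro t_eq graph_gen.add t)
    show "t m (c \<odot>\<^bsub>Ob V m\<^esub> x) = c \<odot>\<^bsub>Ob V' m\<^esub> t m x" if "c \<in> carrier k" for c
      using m x that by (intro t_eq R_smult t)
    show "t l (Mor V m l f x) = Mor V' m l f (t m x)" if "l \<ge> 1" "f \<in> C m l" for l f
      using m x that by (intro t_eq R_Mor t)
  qed
  obtain x where x: "x \<in> carrier (Ob V n)" "x \<noteq> \<zero>\<^bsub>Ob V n\<^esub>"
    using nonzero N.M.zero_closed by blast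
  then have "t n x \<noteq> \<zero>\<^bsub>Ob V' n\<^esub>"
    using t_eq[OF n R_theta[OF x(1)]] \<theta>z \<theta>(2) N.M.zero_closed unfolding bij_betw_def inj_on_def by metis
  then have "\<forall>m\<ge>1. bij_betw (t m) (carrier (Ob V m)) (carrier (Ob V' m))"
    using irreducible_bij[OF V V' th n x(1)] by blast
  then show ?thesis unfolding cmod_iso_def using th by blast
qed

end

section \<open>Tensor products\<close>

context scalar_field
begin

lemma lmodule_free_mod: "lmodule k (free_mod k S)"
  by (rule lmodule.intro) (rule left_module_free_mod)

lemma single_span:
  assumes W: "submodule W k (free_mod k S)" and "\<And>x. x \<in> S \<Longrightarrow> single k x \<in> W" and \<phi>: "\<phi> \<in> fin_funs k S"
  shows "\<phi> \<in> W"
  using \<phi>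
proof (induction rule: fin_funs_induct)
  case zero
  then show ?case using lmodule.left_submoduleD(2)[OF lmodule_free_mod W] by (simp add: free_mod_simps)
next
  case (add c x \<psi>)
  note D = lmodule.left_submoduleD[OF lmodule_free_mod W]
  have "c \<odot>\<^bsub>free_mod k S\<^esub> single k x \<oplus>\<^bsub>free_mod k S\<^esub> \<psi> \<in> W"
    using add assms(2) by (intro D(3,4)) auto
  then show ?case by (simp add: free_mod_simps)
qed

end

locale tensor_data = scalar_field k + M: lmodule k M + N: lmodule A N
  for k :: "'k ring" (structure) and A :: "'a ring" and M :: "('k, 'm) module" and N :: "('a, 'n) module" +
  fixes ract :: "'m \<Rightarrow> 'a \<Rightarrow> 'm"
  assumes ract_closed: "x \<in> carrier M \<Longrightarrow> a \<in> carrier A \<Longrightarrow> ract x a \<in> carrier M"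
begin

abbreviation "F \<equiv> free_mod k (carrier M \<times> carrier N)"
abbreviation "rels \<equiv> tensor_rels k A M ract N"
abbreviation "T \<equiv> tensor k A M ract N"

text \<open>The generators inside \<open>tensor_rels\<close>, named so that one can argue by cases
  on the four families of relations.\<close>

definition rel_gens :: "('m \<times> 'n \<Rightarrow> 'k) set" where
  "rel_gens =
     {single k (x \<oplus>\<^bsub>M\<^esub> x', y) \<ominus>\<^bsub>F\<^esub> (single k (x, y) \<oplus>\<^bsub>F\<^esub> single k (x', y)) | x x' y.
        x \<in> carrier M \<and> x' \<in> carrier M \<and> y \<in> carrier N} \<union>
     {single k (x, y \<oplus>\<^bsub>N\<^esub> y') \<ominus>\<^bsub>F\<^esub> (single k (x, y) \<oplus>\<^bsub>F\<^esub> single k (x, y')) | x y y'.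
        x \<in> carrier M \<and> y \<in> carrier N \<and> y' \<in> carrier N} \<union>
     {single k (c \<odot>\<^bsub>M\<^esub> x, y) \<ominus>\<^bsub>F\<^esub> c \<odot>\<^bsub>F\<^esub> single k (x, y) | c x y.
        c \<in> carrier k \<and> x \<in> carrier M \<and> y \<in> carrier N} \<union>
     {single k (ract x a, y) \<ominus>\<^bsub>F\<^esub> single k (x, a \<odot>\<^bsub>N\<^esub> y) | x a y.
        x \<in> carrier M \<and> a \<in> carrier A \<and> y \<in> carrier N}"

sublocale F: lmodule k F
  by (rule lmodule_free_mod)

lemma rels_eq: "rels = mod_span k F rel_gens"
  by (simp only: tensor_rels_def rel_gens_def Let_def)

lemma rel_gensI:
  "x \<in> carrier M \<Longrightarrow> x' \<in> carrier M \<Longrightarrow> y \<in> carrier N \<Longrightarrow>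
     single k (x \<oplus>\<^bsub>M\<^esub> x', y) \<ominus>\<^bsub>F\<^esub> (single k (x, y) \<oplus>\<^bsub>F\<^esub> single k (x', y)) \<in> rel_gens"
  "x \<in> carrier M \<Longrightarrow> y \<in> carrier N \<Longrightarrow> y' \<in> carrier N \<Longrightarrow>
     single k (x, y \<oplus>\<^bsub>N\<^esub> y') \<ominus>\<^bsub>F\<^esub> (single k (x, y) \<oplus>\<^bsub>F\<^esub> single k (x, y')) \<in> rel_gens"
  "c \<in> carrier k \<Longrightarrow> x \<in> carrier M \<Longrightarrow> y \<in> carrier N \<Longrightarrow>
     single k (c \<odot>\<^bsub>M\<^esub> x, y) \<ominus>\<^bsub>F\<^esub> c \<odot>\<^bsub>F\<^esub> single k (x, y) \<in> rel_gens"
  "x \<in> carrier M \<Longrightarrow> a \<in> carrier A \<Longrightarrow> y \<in> carrier N \<Longrightarrow>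
     single k (ract x a, y) \<ominus>\<^bsub>F\<^esub> single k (x, a \<odot>\<^bsub>N\<^esub> y) \<in> rel_gens"
  unfolding rel_gens_def by blast+

lemma rel_gens_cases:
  assumes "u \<in> rel_gens"
  obtains (1) x x' y where
      "u = single k (x \<oplus>\<^bsub>M\<^esub> x', y) \<ominus>\<^bsub>F\<^esub> (single k (x, y) \<oplus>\<^bsub>F\<^esub> single k (x', y))"
      "x \<in> carrier M" "x' \<in> carrier M" "y \<in> carrier N"
    | (2) x y y' where
      "u = single k (x, y \<oplus>\<^bsub>N\<^esub> y') \<ominus>\<^bsub>F\<^esub> (single k (x, y) \<oplus>\<^bsub>F\<^esub> single k (x, y'))"
      "x \<in> carrier M" "y \<in> carrier N" "y' \<in> carrier N"
    | (3) c x y where "u = single k (c \<odot>\<^bsub>M\<^esub> x, y) \<ominus>\<^bsub>F\<^esub> c \<odot>\<^bsub>F\<^esub> single k (x, y)"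
      "c \<in> carrier k" "x \<in> carrier M" "y \<in> carrier N"
    | (4) x a y where "u = single k (ract x a, y) \<ominus>\<^bsub>F\<^esub> single k (x, a \<odot>\<^bsub>N\<^esub> y)"
      "x \<in> carrier M" "a \<in> carrier A" "y \<in> carrier N"
  using assms unfolding rel_gens_def
  by - (elim UnE CollectE exE conjE, (rule 1; assumption), (rule 2; assumption), (rule 3; assumption),
      (rule 4; assumption))

lemma single_F: "x \<in> carrier M \<Longrightarrow> y \<in> carrier N \<Longrightarrow> single k (x, y) \<in> carrier F"
  by simp

lemma rel_gens_subset: "rel_gens \<subseteq> carrier F"
proof
  fix u assume "u \<in> rel_gens"
  then show "u \<in> carrier F"
    by (cases rule: rel_gens_cases)
      (simp_all only: F.M.minus_closed F.M.a_closed F.smult_closed single_F M.M.a_closed N.M.a_closed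
        M.smult_closed N.smult_closed ract_closed)
qed

lemma submodule_rels: "submodule rels k F"
  unfolding rels_eq using rel_gens_subset by (rule F.submodule_mod_span)

definition tens :: "'m \<Rightarrow> 'n \<Rightarrow> ('m \<times> 'n \<Rightarrow> 'k) set" where
  "tens x y = rels +>\<^bsub>F\<^esub> single k (x, y)"

lemma tensor_eq: "T = quot_mod F rels"
  by (simp add: tensor_def)

sublocale T: lmodule k T
  unfolding tensor_eq by (rule lmodule.intro) (rule F.left_module_quot_mod[OF submodule_rels])

lemma tens_closed [simp]: "x \<in> carrier M \<Longrightarrow> y \<in> carrier N \<Longrightarrow> tens x y \<in> carrier T"
  unfolding tensor_eq F.carrier_quot_mod tens_def by (simp add: image_iff) (metis SigmaI single_in)

lemma rel_coset: "u \<in> carrier F \<Longrightarrow> v \<in> carrier F \<Longrightarrow> u \<ominus>\<^bsub>F\<^esub> v \<in> rel_gens \<Longrightarrow> rels +>\<^bsub>F\<^esub> u = rels +>\<^bsub>F\<^esub> v"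
  using F.coset_eq_iff[OF submodule_rels] F.mod_span_superset[of rel_gens] rels_eq by auto

lemma tens_add_left:
  assumes "x \<in> carrier M" "x' \<in> carrier M" "y \<in> carrier N"
  shows "tens (x \<oplus>\<^bsub>M\<^esub> x') y = tens x y \<oplus>\<^bsub>T\<^esub> tens x' y"
  unfolding tens_def tensor_eq F.add_quot_mod[OF submodule_rels single_F[OF assms(1,3)] single_F[OF assms(2,3)]]
  using assms by (intro rel_coset rel_gensI) (auto intro: F.M.a_closed simp del: carrier_free_mod intro!: single_F)

lemma tens_add_right:
  assumes "x \<in> carrier M" "y \<in> carrier N" "y' \<in> carrier N"
  shows "tens x (y \<oplus>\<^bsub>N\<^esub> y') = tens x y \<oplus>\<^bsub>T\<^esub> tens x y'"
  unfolding tens_def tensor_eq F.add_quot_mod[OF submodule_rels single_F[OF assms(1,2)] single_F[OF assms(1,3)]]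
  using assms by (intro rel_coset rel_gensI) (auto intro: F.M.a_closed simp del: carrier_free_mod intro!: single_F)

lemma tens_smult:
  assumes "c \<in> carrier k" "x \<in> carrier M" "y \<in> carrier N"
  shows "tens (c \<odot>\<^bsub>M\<^esub> x) y = c \<odot>\<^bsub>T\<^esub> tens x y"
  unfolding tens_def tensor_eq F.smult_quot_mod[OF submodule_rels assms(1) single_F[OF assms(2,3)]]
  using assms by (intro rel_coset rel_gensI)
    (auto simp del: carrier_free_mod intro!: single_F F.smult_closed M.smult_closed)

lemma tens_balanced:
  assumes "x \<in> carrier M" "a \<in> carrier A" "y \<in> carrier N"
  shows "tens (ract x a) y = tens x (a \<odot>\<^bsub>N\<^esub> y)"
  unfolding tens_def
  using assms by (intro rel_coset rel_gensI)
    (auto simp del: carrier_free_mod intro!: single_F ract_closed N.smult_closed)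

text \<open>Scalars are absorbed into the left factor, so every element is a finite sum of pure
  tensors without coefficients.\<close>

lemma tensor_induct [consumes 1, case_names zero add]:
  assumes "z \<in> carrier T" and zero: "P \<zero>\<^bsub>T\<^esub>"
    and add: "\<And>x y z. x \<in> carrier M \<Longrightarrow> y \<in> carrier N \<Longrightarrow> z \<in> carrier T \<Longrightarrow> P z \<Longrightarrow> P (tens x y \<oplus>\<^bsub>T\<^esub> z)"
  shows "P z"
proof -
  obtain \<phi> where \<phi>: "\<phi> \<in> fin_funs k (carrier M \<times> carrier N)" "z = rels +>\<^bsub>F\<^esub> \<phi>"
    using assms(1) by (auto simp: tensor_eq F.carrier_quot_mod)
  have "P (rels +>\<^bsub>F\<^esub> \<phi>)"
    using \<phi>(1)
  proof (induction rule: fin_funs_induct)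
    case zero
    have "rels +>\<^bsub>F\<^esub> (\<lambda>x. \<zero>) = \<zero>\<^bsub>T\<^esub>"
      using F.coset_zero[OF submodule_rels] by (simp add: tensor_eq F.zero_quot_mod free_mod_simps)
    then show ?case using assms(2) by simp
  next
    case (add c p \<psi>)
    obtain x y where p: "p = (x, y)" "x \<in> carrier M" "y \<in> carrier N" using add by auto
    have \<psi>: "rels +>\<^bsub>F\<^esub> \<psi> \<in> carrier T" using add by (auto simp: tensor_eq F.carrier_quot_mod)
    have "rels +>\<^bsub>F\<^esub> (\<lambda>y. c \<otimes> single k p y \<oplus> \<psi> y) = rels +>\<^bsub>F\<^esub> (c \<odot>\<^bsub>F\<^esub> single k p \<oplus>\<^bsub>F\<^esub> \<psi>)"
      by (simp add: free_mod_simps)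
    also have "\<dots> = c \<odot>\<^bsub>T\<^esub> tens x y \<oplus>\<^bsub>T\<^esub> (rels +>\<^bsub>F\<^esub> \<psi>)"
      unfolding tens_def tensor_eq p(1)
      using add p F.smult_closed[of c "single k (x, y)"] F.smult_quot_mod[OF submodule_rels add(1), of "single k (x, y)"]
      by (subst F.add_quot_mod[OF submodule_rels, symmetric]) auto
    also have "c \<odot>\<^bsub>T\<^esub> tens x y = tens (c \<odot>\<^bsub>M\<^esub> x) y" using tens_smult add(1) p by simp
    finally show ?case
      using assms(3)[of "c \<odot>\<^bsub>M\<^esub> x" y] add p \<psi> M.smult_closed by simp
  qed
  then show ?thesis using \<phi> by simp
qed

text \<open>Universal property of the tensor product; the last four hypotheses correspond to the
  four families of relations, which the linear extension of \<beta> to the free module must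
  kill.\<close>

lemma tensor_lift:
  assumes Z: "left_module k Z"
    and closed: "\<And>x y. x \<in> carrier M \<Longrightarrow> y \<in> carrier N \<Longrightarrow> \<beta> x y \<in> carrier Z"
    and add1: "\<And>x x' y. x \<in> carrier M \<Longrightarrow> x' \<in> carrier M \<Longrightarrow> y \<in> carrier N \<Longrightarrow>
      \<beta> (x \<oplus>\<^bsub>M\<^esub> x') y = \<beta> x y \<oplus>\<^bsub>Z\<^esub> \<beta> x' y"
    and add2: "\<And>x y y'. x \<in> carrier M \<Longrightarrow> y \<in> carrier N \<Longrightarrow> y' \<in> carrier N \<Longrightarrow>
      \<beta> x (y \<oplus>\<^bsub>N\<^esub> y') = \<beta> x y \<oplus>\<^bsub>Z\<^esub> \<beta> x y'"
    and smult: "\<And>c x y. c \<in> carrier k \<Longrightarrow> x \<in> carrier M \<Longrightarrow> y \<in> carrier N \<Longrightarrow>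
      \<beta> (c \<odot>\<^bsub>M\<^esub> x) y = c \<odot>\<^bsub>Z\<^esub> \<beta> x y"
    and bal: "\<And>x a y. x \<in> carrier M \<Longrightarrow> a \<in> carrier A \<Longrightarrow> y \<in> carrier N \<Longrightarrow>
      \<beta> (ract x a) y = \<beta> x (a \<odot>\<^bsub>N\<^esub> y)"
  obtains h where "h \<in> mod_hom k T Z" "\<And>x y. x \<in> carrier M \<Longrightarrow> y \<in> carrier N \<Longrightarrow> h (tens x y) = \<beta> x y"
proof -
  interpret Z: lmodule k Z by (rule lmodule.intro) fact
  let ?f = "free_lift Z (\<lambda>(x, y). \<beta> x y)"
  have f: "?f \<in> mod_hom k F Z" using closed by (intro free_lift_hom[OF Z]) auto
  have fs: "?f (single k (x, y)) = \<beta> x y" if "x \<in> carrier M" "y \<in> carrier N" for x y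
    using free_lift_single[OF Z, of "\<lambda>(x, y). \<beta> x y" "(x, y)"] closed that by simp
  have "submodule {u \<in> carrier F. ?f u \<in> {\<zero>\<^bsub>Z\<^esub>}} k F"
    by (rule submodule_vimage[OF F.left_module_axioms' Z f Z.submodule_zero])
  moreover have "rel_gens \<subseteq> {u \<in> carrier F. ?f u \<in> {\<zero>\<^bsub>Z\<^esub>}}"
  proof
    note fm = mod_hom_minus[OF F.left_module_axioms' Z f] mod_homD[OF f]
    fix u assume u: "u \<in> rel_gens"
    then have "?f u = \<zero>\<^bsub>Z\<^esub>"
    proof (cases rule: rel_gens_cases)
      case (1 x x' y)
      then show ?thesis
        using add1[of x x' y] closed[of x y] closed[of x' y]
        by (simp add: fm single_F fs Z.diff_eq_zero_iff F.M.a_closed[simplified] del: carrier_free_mod)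
    next
      case (2 x y y')
      then show ?thesis
        using add2[of x y y'] closed[of x y] closed[of x y']
        by (simp add: fm single_F fs Z.diff_eq_zero_iff del: carrier_free_mod)
    next
      case (3 c x y)
      then show ?thesis
        using smult[of c x y] closed[of x y]
        by (simp add: fm single_F fs Z.diff_eq_zero_iff F.smult_closed M.smult_closed Z.smult_closed del: carrier_free_mod)
    next
      case (4 x a y)
      then show ?thesis
        using bal[of x a y] closed
        by (simp add: fm single_F fs Z.diff_eq_zero_iff ract_closed N.smult_closed del: carrier_free_mod)
    qed
    then show "u \<in> {u \<in> carrier F. ?f u \<in> {\<zero>\<^bsub>Z\<^esub>}}" using u rel_gens_subset by auto
  qed
  ultimately have "rels \<subseteq> {u \<in> carrier F. ?f u \<in> {\<zero>\<^bsub>Z\<^esub>}}"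
    unfolding rels_eq by (rule F.mod_span_least)
  then obtain h where "h \<in> mod_hom k T Z" "\<And>u. u \<in> carrier F \<Longrightarrow> h (rels +>\<^bsub>F\<^esub> u) = ?f u"
    using quot_lift[OF F.left_module_axioms' submodule_rels Z f] unfolding tensor_eq by blast
  then show ?thesis
    using that[of h] fs single_F unfolding tens_def by metis
qed

end

text \<open>Functoriality in the left factor. The formula for \<open>U\<close> is the one by which
  \<open>Delta_tensor\<close> acts on morphisms; equivariance of \<open>u\<close> is what carries
  balancing relations to balancing relations.\<close>

lemma tensor_quot_map:
  assumes "tensor_data k A M N ract" "tensor_data k A M' N ract'"
    and u: "u \<in> mod_hom k M M'"
    and bal: "\<And>x a. x \<in> carrier M \<Longrightarrow> a \<in> carrier A \<Longrightarrow> u (ract x a) = ract' (u x) a"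
  defines "U \<equiv> quot_map (free_mod k (carrier M' \<times> carrier N)) (tensor_rels k A M' ract' N) (lin_ext k (\<lambda>(x, y). (u x, y)))"
  shows "U \<in> mod_hom k (tensor k A M ract N) (tensor k A M' ract' N)"
    and "x \<in> carrier M \<Longrightarrow> y \<in> carrier N \<Longrightarrow>
      U (tensor_data.tens k A M N ract x y) = tensor_data.tens k A M' N ract' (u x) y"
proof -
  interpret D: tensor_data k A M N ract by fact
  interpret D': tensor_data k A M' N ract' by fact
  note uD = mod_homD[OF u]
  let ?g = "lin_ext k (\<lambda>(x, y). (u x, y))"
  have g: "?g \<in> mod_hom k D.F D'.F" using uD(1) by (intro D.lin_ext_hom) auto
  note gD = mod_homD[OF g] mod_hom_minus[OF D.F.left_module_axioms' D'.F.left_module_axioms' g]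
  have gs: "?g (single k (x, y)) = single k (u x, y)" for x y by simp
  have "D.rel_gens \<subseteq> {v \<in> carrier D.F. ?g v \<in> D'.rels}"
  proof
    fix v assume v: "v \<in> D.rel_gens"
    then have "?g v \<in> D'.rel_gens"
    proof (cases rule: D.rel_gens_cases)
      case (1 x x' y)
      then show ?thesis
        using D'.rel_gensI(1)[of "u x" "u x'" y] uD
        by (simp add: gD gs D.single_F del: D.carrier_free_mod)
    next
      case (2 x y y')
      then show ?thesis
        using D'.rel_gensI(2)[of "u x" y y'] uD
        by (simp add: gD gs D.single_F del: D.carrier_free_mod)
    next
      case (3 c x y)
      then show ?thesis
        using D'.rel_gensI(3)[of c "u x" y] uD
        by (simp add: gD gs D.single_F D.F.smult_closed D.M.smult_closed del: D.carrier_free_mod)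
    next
      case (4 x a y)
      then show ?thesis
        using D'.rel_gensI(4)[of "u x" a y] uD bal
        by (simp add: gD gs D.single_F D.ract_closed D.N.smult_closed del: D.carrier_free_mod)
    qed
    then show "v \<in> {v \<in> carrier D.F. ?g v \<in> D'.rels}"
      using v D.rel_gens_subset D'.F.mod_span_superset[of D'.rel_gens] D'.rels_eq by auto
  qed
  then have "D.rels \<subseteq> {v \<in> carrier D.F. ?g v \<in> D'.rels}"
    unfolding D.rels_eq
    by (intro D.F.mod_span_least submodule_vimage[OF D.F.left_module_axioms' D'.F.left_module_axioms' g D'.submodule_rels])
  then have W: "?g ` D.rels \<subseteq> D'.rels" by auto
  note Q = quot_map_hom[OF D.F.left_module_axioms' D.submodule_rels D'.F.left_module_axioms' D'.submodule_rels g W]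
  show "U \<in> mod_hom k (tensor k A M ract N) (tensor k A M' ract' N)"
    unfolding U_def D.tensor_eq D'.tensor_eq by (rule Q(1))
  show "x \<in> carrier M \<Longrightarrow> y \<in> carrier N \<Longrightarrow>
      U (tensor_data.tens k A M N ract x y) = tensor_data.tens k A M' N ract' (u x) y"
    unfolding U_def D.tens_def D'.tens_def using Q(2)[OF D.single_F] by simp
qed

section \<open>Standard modules\<close>

context cat_rep
begin

abbreviation kG :: "nat \<Rightarrow> ((nat \<Rightarrow> nat) \<Rightarrow> 'k) ring" where
  "kG n \<equiv> group_algebra k (aut C n)"

lemma ring_kG: "ring (kG n)"
  using group_aut group.is_monoid by (intro ring_group_algebra) blast

lemma Pmod_simps:
  "Ob (Pmod k C n) m = free_mod k (C n m)"
  "Mor (Pmod k C n) m l f = lin_ext k (compose {1..n} f)"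
  by (simp_all add: Pmod_def)

lemma Pmod_Mor_hom: "f \<in> C m l \<Longrightarrow> lin_ext k (compose {1..n} f) \<in> mod_hom k (free_mod k (C n m)) (free_mod k (C n l))"
  using comp_closed by (intro lin_ext_hom) auto

lemma id_hom: "(\<lambda>x. x) \<in> mod_hom A M M"
  by (intro mod_homI) auto

lemma cmodule_Pmod: "cmodule k C (Pmod k C n)"
  unfolding cmodule_def Pmod_simps
proof (intro conjI allI impI ballI)
  show "Module.module k (free_mod k (C n m))" for m
    using left_module_free_mod cring_axioms by (simp add: module_iff_left_module)
  show "lin_ext k (compose {1..n} f) \<in> mod_hom k (free_mod k (C n m)) (free_mod k (C n l))" if "f \<in> C m l" for m l f
    using that by (rule Pmod_Mor_hom)
  show "lin_ext k (compose {1..n} (\<lambda>i\<in>{1..m}. i)) x = x" if "x \<in> carrier (free_mod k (C n m))" for m x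
  proof (rule mod_hom_free_eqI[OF left_module_free_mod Pmod_Mor_hom[OF id_mem] id_hom])
    show "x \<in> fin_funs k (C n m)" using that by simp
  qed (simp add: id_compose)
  show "lin_ext k (compose {1..n} (compose {1..l} g f)) x =
      lin_ext k (compose {1..n} g) (lin_ext k (compose {1..n} f) x)"
    if "f \<in> C l m" "g \<in> C m r" "x \<in> carrier (free_mod k (C n l))" for l m r f g x
  proof (rule mod_hom_free_eqI[OF left_module_free_mod, where f = "lin_ext k (compose {1..n} (compose {1..l} g f))"
        and g = "\<lambda>x. lin_ext k (compose {1..n} g) (lin_ext k (compose {1..n} f) x)"])
    show "lin_ext k (compose {1..n} (compose {1..l} g f)) \<in> mod_hom k (free_mod k (C n l)) (free_mod k (C n r))"
      using that comp_closed by (intro Pmod_Mor_hom) auto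
    show "(\<lambda>x. lin_ext k (compose {1..n} g) (lin_ext k (compose {1..n} f) x)) \<in>
        mod_hom k (free_mod k (C n l)) (free_mod k (C n r))"
      by (rule mod_hom_comp[OF Pmod_Mor_hom[OF that(1)] Pmod_Mor_hom[OF that(2)]])
    show "x \<in> fin_funs k (C n l)" using that by simp
  qed (simp add: compose_assoc'[OF _ that(1)])
qed

lemma noninj_eq: "noninj k C n m = mod_span k (free_mod k (C n m)) {single k h | h. h \<in> C n m \<and> \<not> inj_on h {1..n}}"
  by (simp add: noninj_def Pmod_simps)

lemma submodule_noninj: "submodule (noninj k C n m) k (free_mod k (C n m))"
  unfolding noninj_eq by (intro lmodule.submodule_mod_span[OF lmodule_free_mod]) auto

lemma single_noninj: "h \<in> C n m \<Longrightarrow> \<not> inj_on h {1..n} \<Longrightarrow> single k h \<in> noninj k C n m"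
  unfolding noninj_eq by (rule subsetD[OF lmodule.mod_span_superset[OF lmodule_free_mod]]) blast

lemma noninj_image:
  assumes M: "left_module k M" and f: "f \<in> mod_hom k (free_mod k (C n m)) M" and W: "submodule W k M"
    and "\<And>h. h \<in> C n m \<Longrightarrow> \<not> inj_on h {1..n} \<Longrightarrow> f (single k h) \<in> W"
  shows "f ` noninj k C n m \<subseteq> W"
proof -
  have "noninj k C n m \<subseteq> {\<phi> \<in> carrier (free_mod k (C n m)). f \<phi> \<in> W}"
    unfolding noninj_eq
  proof (rule lmodule.mod_span_least[OF lmodule_free_mod])
    show "submodule {\<phi> \<in> carrier (free_mod k (C n m)). f \<phi> \<in> W} k (free_mod k (C n m))"
      by (rule submodule_vimage[OF left_module_free_mod M f W])
    show "{single k h | h. h \<in> C n m \<and> \<not> inj_on h {1..n}} \<subseteq> {\<phi> \<in> carrier (free_mod k (C n m)). f \<phi> \<in> W}"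
    proof
      fix u assume "u \<in> {single k h | h. h \<in> C n m \<and> \<not> inj_on h {1..n}}"
      then obtain h where "u = single k h" "h \<in> C n m" "\<not> inj_on h {1..n}" by blast
      then show "u \<in> {\<phi> \<in> carrier (free_mod k (C n m)). f \<phi> \<in> W}" using assms(4) by simp
    qed
  qed
  then show ?thesis by auto
qed

lemma csubmodule_noninj: "csubmodule k C (Pmod k C n) (noninj k C n)"
  unfolding csubmodule_def Pmod_simps
proof (intro conjI allI impI ballI)
  fix m l f assume f: "f \<in> C m l"
  show "lin_ext k (compose {1..n} f) ` noninj k C n m \<subseteq> noninj k C n l"
    using comp_closed[OF _ f]
    by (intro noninj_image[OF left_module_free_mod Pmod_Mor_hom[OF f] submodule_noninj])
      (auto intro!: single_noninj dest: inj_on_compose_right)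
qed (rule submodule_noninj)

text \<open>Evaluation at an injective \<open>f\<close> is linear and kills the generators. This is
  what makes coefficients at injections well defined on the standard module.\<close>

lemma noninj_vanish:
  assumes "\<phi> \<in> noninj k C n m" "f \<in> C n m" "inj_on f {1..n}"
  shows "\<phi> f = \<zero>"
proof -
  have "submodule {\<phi> \<in> carrier (free_mod k (C n m)). \<phi> f = \<zero>} k (free_mod k (C n m))"
    using lmodule_free_mod
    by (intro lmodule.left_submoduleI[OF lmodule_free_mod])
      (auto simp: free_mod_simps fin_funs_add fin_funs_smult)
  then have "noninj k C n m \<subseteq> {\<phi> \<in> carrier (free_mod k (C n m)). \<phi> f = \<zero>}"
    unfolding noninj_eq
  proof (rule lmodule.mod_span_least[OF lmodule_free_mod])
    show "{single k h | h. h \<in> C n m \<and> \<not> inj_on h {1..n}} \<subseteq>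
      {\<phi> \<in> carrier (free_mod k (C n m)). \<phi> f = \<zero>}"
    proof
      fix u assume "u \<in> {single k h | h. h \<in> C n m \<and> \<not> inj_on h {1..n}}"
      then obtain h where "u = single k h" "h \<in> C n m" "\<not> inj_on h {1..n}" by blast
      then show "u \<in> {\<phi> \<in> carrier (free_mod k (C n m)). \<phi> f = \<zero>}"
        using assms(3) by (cases "f = h") (simp_all add: single_def[of k h, THEN fun_cong, of f])
    qed
  qed
  then show ?thesis using assms(1) by auto
qed

definition dbasis :: "nat \<Rightarrow> nat \<Rightarrow> (nat \<Rightarrow> nat) \<Rightarrow> ((nat \<Rightarrow> nat) \<Rightarrow> 'k) set" where
  "dbasis n m h = noninj k C n m +>\<^bsub>free_mod k (C n m)\<^esub> single k h"

lemma cmodule_Delta: "cmodule k C (Delta k C n)"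
  unfolding Delta_def
  using cat_module.cmodule_quot(1)[OF cat_module.intro[OF cat_rep_axioms cat_module_axioms.intro[OF cmodule_Pmod]] csubmodule_noninj] .

lemma cat_module_Delta: "cat_module k C (Delta k C n)"
  by (intro cat_module.intro cat_rep_axioms cat_module_axioms.intro cmodule_Delta)

lemma Ob_Delta: "Ob (Delta k C n) m = quot_mod (free_mod k (C n m)) (noninj k C n m)"
  by (simp add: Delta_def cmod_quot_def Pmod_simps)

lemma Delta_coset_closed: "\<phi> \<in> fin_funs k (C n m) \<Longrightarrow> noninj k C n m +>\<^bsub>free_mod k (C n m)\<^esub> \<phi> \<in> carrier (Ob (Delta k C n) m)"
  by (simp add: Ob_Delta lmodule.carrier_quot_mod[OF lmodule_free_mod])

lemma Delta_cosetE:
  assumes "X \<in> carrier (Ob (Delta k C n) m)"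
  obtains \<phi> where "\<phi> \<in> fin_funs k (C n m)" "X = noninj k C n m +>\<^bsub>free_mod k (C n m)\<^esub> \<phi>"
  using assms by (auto simp: Ob_Delta lmodule.carrier_quot_mod[OF lmodule_free_mod])

lemma dbasis_closed: "h \<in> C n m \<Longrightarrow> dbasis n m h \<in> carrier (Ob (Delta k C n) m)"
  unfolding dbasis_def by (rule Delta_coset_closed) simp

lemma dbasis_noninj: "h \<in> C n m \<Longrightarrow> \<not> inj_on h {1..n} \<Longrightarrow> dbasis n m h = \<zero>\<^bsub>Ob (Delta k C n) m\<^esub>"
  unfolding dbasis_def Ob_Delta lmodule.zero_quot_mod[OF lmodule_free_mod]
  using lmodule.coset_eq_zero_iff[OF lmodule_free_mod submodule_noninj] single_noninj by simp

lemma Mor_Delta_coset: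
  "m \<ge> 1 \<Longrightarrow> l \<ge> 1 \<Longrightarrow> d \<in> C m l \<Longrightarrow> \<phi> \<in> fin_funs k (C n m) \<Longrightarrow>
   Mor (Delta k C n) m l d (noninj k C n m +>\<^bsub>free_mod k (C n m)\<^esub> \<phi>) =
   noninj k C n l +>\<^bsub>free_mod k (C n l)\<^esub> lin_ext k (compose {1..n} d) \<phi>"
  using cat_module.cmodule_quot(2)[OF cat_module.intro[OF cat_rep_axioms cat_module_axioms.intro[OF cmodule_Pmod]] csubmodule_noninj, of m l d \<phi> n]
  by (simp add: Delta_def Pmod_simps)

lemma Mor_Delta_dbasis:
  "m \<ge> 1 \<Longrightarrow> l \<ge> 1 \<Longrightarrow> d \<in> C m l \<Longrightarrow> h \<in> C n m \<Longrightarrow>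
   Mor (Delta k C n) m l d (dbasis n m h) = dbasis n l (compose {1..n} d h)"
  by (simp add: dbasis_def Mor_Delta_coset)

section \<open>The right action of the group algebra and restriction to scalars\<close>

lemma aut_mem: "g \<in> carrier (aut C n) \<Longrightarrow> g \<in> C n n \<and> inj_on g {1..n}"
  by (simp add: carrier_aut)

lemma aut_comp: "h \<in> C n m \<Longrightarrow> g \<in> carrier (aut C n) \<Longrightarrow> compose {1..n} h g \<in> C n m"
  using aut_mem comp_closed by blast

lemma fin_funs_aut: "a \<in> carrier (kG n) \<Longrightarrow> a \<in> fin_funs k (carrier (aut C n))"
  by (simp add: group_algebra_simps)

lemma conv_hom:
  assumes "a \<in> carrier (kG n)"
  shows "(\<lambda>\<phi>. bilin_ext k (compose {1..n}) \<phi> a) \<in> mod_hom k (free_mod k (C n m)) (free_mod k (C n m))"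
  using aut_comp by (intro bilin_ext_hom[OF fin_funs_aut[OF assms]]) blast

text \<open>An automorphism \<open>g\<close> is onto \<open>[n]\<close>, so if \<open>h\<close>
  after \<open>g\<close> were injective then \<open>h\<close> would be. Hence precomposition keeps
  noninjective maps noninjective and the right action passes to the quotient.\<close>

lemma conv_noninj:
  assumes a: "a \<in> carrier (kG n)"
  shows "(\<lambda>\<phi>. bilin_ext k (compose {1..n}) \<phi> a) ` noninj k C n m \<subseteq> noninj k C n m"
proof (rule noninj_image[OF left_module_free_mod conv_hom[OF a] submodule_noninj])
  fix h assume h: "h \<in> C n m" "\<not> inj_on h {1..n}"
  have hom: "(\<lambda>a. bilin_ext k (compose {1..n}) (single k h) a) \<in> mod_hom k (free_mod k (carrier (aut C n))) (free_mod k (C n m))"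
    using h aut_comp by (intro bilin_ext_hom2[of _ "{h}"]) auto
  have "a \<in> {a \<in> carrier (free_mod k (carrier (aut C n))). bilin_ext k (compose {1..n}) (single k h) a \<in> noninj k C n m}"
  proof (rule single_span[OF _ _ fin_funs_aut[OF a]])
    show "submodule {a \<in> carrier (free_mod k (carrier (aut C n))). bilin_ext k (compose {1..n}) (single k h) a \<in> noninj k C n m}
      k (free_mod k (carrier (aut C n)))"
      by (rule submodule_vimage[OF left_module_free_mod left_module_free_mod hom submodule_noninj])
    fix g assume g: "g \<in> carrier (aut C n)"
    have "\<not> inj_on (compose {1..n} h g) {1..n}"
    proof
      assume inj: "inj_on (compose {1..n} h g) {1..n}"
      have bij: "g ` {1..n} = {1..n}"
        using aut_mem[OF g] morD(1)[of g n n] by (intro card_subset_eq) (auto simp: card_image simp del: atLeastAtMost_iff)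
      have "inj_on (compose {1..n} h g) {1..n} \<longleftrightarrow> inj_on (h \<circ> g) {1..n}"
        by (rule inj_on_cong) (simp add: compose_def)
      then have "inj_on (h \<circ> g) {1..n}" using inj by blast
      then have "inj_on h (g ` {1..n})" by (rule inj_on_imageI)
      then show False using h bij by simp
    qed
    then show "single k g \<in> {a \<in> carrier (free_mod k (carrier (aut C n))). bilin_ext k (compose {1..n}) (single k h) a \<in> noninj k C n m}"
      using g h aut_mem[OF g] comp_closed by (auto intro!: single_noninj)
  qed
  then show "bilin_ext k (compose {1..n}) (single k h) a \<in> noninj k C n m" by simp
qed

lemma Delta_ract_coset:
  assumes "a \<in> carrier (kG n)" "\<phi> \<in> fin_funs k (C n m)"
  shows "Delta_ract k C n m (noninj k C n m +>\<^bsub>free_mod k (C n m)\<^esub> \<phi>) a =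
    noninj k C n m +>\<^bsub>free_mod k (C n m)\<^esub> bilin_ext k (compose {1..n}) \<phi> a"
  unfolding Delta_ract_def Pmod_simps using assms(2)
  by (intro quot_map_hom(2)[OF left_module_free_mod submodule_noninj left_module_free_mod submodule_noninj
        conv_hom[OF assms(1)] conv_noninj[OF assms(1)]]) simp

lemma Delta_ract_closed:
  assumes "X \<in> carrier (Ob (Delta k C n) m)" "a \<in> carrier (kG n)"
  shows "Delta_ract k C n m X a \<in> carrier (Ob (Delta k C n) m)"
proof -
  obtain \<phi> where \<phi>: "\<phi> \<in> fin_funs k (C n m)" "X = noninj k C n m +>\<^bsub>free_mod k (C n m)\<^esub> \<phi>"
    using assms(1) by (rule Delta_cosetE)
  show ?thesis
    unfolding \<phi>(2) Delta_ract_coset[OF assms(2) \<phi>(1)]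
    using mod_homD(1)[OF conv_hom[OF assms(2)]] \<phi>(1) by (intro Delta_coset_closed) simp
qed

lemma Delta_ract_dbasis:
  "h \<in> C n m \<Longrightarrow> g \<in> carrier (aut C n) \<Longrightarrow>
   Delta_ract k C n m (dbasis n m h) (single k g) = dbasis n m (compose {1..n} h g)"
  unfolding dbasis_def by (subst Delta_ract_coset) (auto simp: group_algebra_simps)

text \<open>Postcomposition commutes with precomposition; on basis elements this is associativity of
  composition.\<close>

lemma Mor_Delta_ract:
  assumes ml: "m \<ge> 1" "l \<ge> 1" "d \<in> C m l" and X: "X \<in> carrier (Ob (Delta k C n) m)" and a: "a \<in> carrier (kG n)"
  shows "Mor (Delta k C n) m l d (Delta_ract k C n m X a) = Delta_ract k C n l (Mor (Delta k C n) m l d X) a"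
proof -
  obtain \<phi> where \<phi>: "\<phi> \<in> fin_funs k (C n m)" "X = noninj k C n m +>\<^bsub>free_mod k (C n m)\<^esub> \<phi>"
    using X by (rule Delta_cosetE)
  let ?c = "bilin_ext k (compose {1..n})"
  let ?d = "lin_ext k (compose {1..n} d)"
  note lm = left_module_free_mod
  have 1: "?d (?c (single k h) a) = ?c (?d (single k h)) a" if h: "h \<in> C n m" for h
  proof (rule mod_hom_free_eqI[OF lm _ _ _ fin_funs_aut[OF a]])
    show "(\<lambda>a. ?d (?c (single k h) a)) \<in> mod_hom k (free_mod k (carrier (aut C n))) (free_mod k (C n l))"
      using h aut_comp by (intro mod_hom_comp[OF bilin_ext_hom2[of _ "{h}" _ _ "C n m"] Pmod_Mor_hom[OF ml(3)]]) auto
    show "(\<lambda>a. ?c (?d (single k h)) a) \<in> mod_hom k (free_mod k (carrier (aut C n))) (free_mod k (C n l))"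
      using comp_closed[OF h ml(3)] aut_comp by (intro bilin_ext_hom2[of _ "C n l"]) auto
    fix g assume "g \<in> carrier (aut C n)"
    then show "?d (?c (single k h) (single k g)) = ?c (?d (single k h)) (single k g)"
      using compose_assoc'[of g n n h m d] aut_mem h by simp
  qed
  have 2: "?d (?c \<phi> a) = ?c (?d \<phi>) a"
    using 1
    by (rule mod_hom_free_eqI[OF lm mod_hom_comp[OF conv_hom[OF a] Pmod_Mor_hom[OF ml(3)]]
          mod_hom_comp[OF Pmod_Mor_hom[OF ml(3)] conv_hom[OF a]] _ \<phi>(1)])
  have "?c \<phi> a \<in> fin_funs k (C n m)" "?d \<phi> \<in> fin_funs k (C n l)"
    using mod_homD(1)[OF conv_hom[OF a]] mod_homD(1)[OF Pmod_Mor_hom[OF ml(3)]] \<phi>(1) by auto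
  then show ?thesis
    unfolding \<phi>(2) using 2 \<phi>(1) by (simp add: Mor_Delta_coset[OF ml] Delta_ract_coset[OF a])
qed

text \<open>The scalar \<open>c\<close> as the element \<open>c\<close> times 1 of the group
  algebra. It is central, by \<open>sc_mult\<close>, and links the two kinds of scalars on a module
  over the group algebra.\<close>

definition sc :: "nat \<Rightarrow> 'k \<Rightarrow> (nat \<Rightarrow> nat) \<Rightarrow> 'k" where
  "sc n c = (\<lambda>g. c \<otimes> \<one>\<^bsub>kG n\<^esub> g)"

lemma one_kG_closed: "\<one>\<^bsub>kG n\<^esub> \<in> fin_funs k (carrier (aut C n))"
  using ring.ring_simprules(6)[OF ring_kG] by (rule fin_funs_aut)

lemma sc_closed: "c \<in> carrier k \<Longrightarrow> sc n c \<in> carrier (kG n)"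
  unfolding sc_def group_algebra_simps(1) by (rule fin_funs_smult) (use one_kG_closed in auto)

lemma aut_monoid: "monoid (aut C n)"
  using group_aut group.is_monoid by blast

lemma sc_mult:
  assumes c: "c \<in> carrier k" and a: "a \<in> carrier (kG n)"
  shows "sc n c \<otimes>\<^bsub>kG n\<^esub> a = (\<lambda>g. c \<otimes> a g)" "a \<otimes>\<^bsub>kG n\<^esub> sc n c = (\<lambda>g. c \<otimes> a g)"
proof -
  interpret R: ring "kG n" by (rule ring_kG)
  interpret G: monoid "aut C n" by (rule aut_monoid)
  note a' = fin_funs_aut[OF a]
  have 1: "(\<lambda>\<phi>. \<phi> \<otimes>\<^bsub>kG n\<^esub> a) \<in> mod_hom k (free_mod k (carrier (aut C n))) (free_mod k (carrier (aut C n)))"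
    unfolding group_algebra_simps by (rule bilin_ext_hom[OF a']) simp
  have 2: "(\<lambda>\<phi>. a \<otimes>\<^bsub>kG n\<^esub> \<phi>) \<in> mod_hom k (free_mod k (carrier (aut C n))) (free_mod k (carrier (aut C n)))"
    unfolding group_algebra_simps by (rule bilin_ext_hom2[OF a']) simp
  show "sc n c \<otimes>\<^bsub>kG n\<^esub> a = (\<lambda>g. c \<otimes> a g)" "a \<otimes>\<^bsub>kG n\<^esub> sc n c = (\<lambda>g. c \<otimes> a g)"
    using mod_homD(3)[OF 1 c, of "\<one>\<^bsub>kG n\<^esub>"] mod_homD(3)[OF 2 c, of "\<one>\<^bsub>kG n\<^esub>"] a one_kG_closed
    by (simp_all add: free_mod_simps sc_def)
qed

lemma ract_sc:
  assumes "h \<in> C n m" "c \<in> carrier k"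
  shows "Delta_ract k C n m (dbasis n m h) (sc n c) = c \<odot>\<^bsub>Ob (Delta k C n) m\<^esub> dbasis n m h"
proof -
  have hom: "(\<lambda>a. bilin_ext k (compose {1..n}) (single k h) a) \<in> mod_hom k (free_mod k (carrier (aut C n))) (free_mod k (C n m))"
    using assms(1) aut_comp by (intro bilin_ext_hom2[of _ "{h}"]) auto
  have "bilin_ext k (compose {1..n}) (single k h) (sc n c) = c \<odot>\<^bsub>free_mod k (C n m)\<^esub> single k h"
    using mod_homD(3)[OF hom assms(2), of "\<one>\<^bsub>kG n\<^esub>"] one_kG_closed compose_id[OF assms(1)]
    by (simp add: free_mod_simps sc_def group_algebra_simps aut_simps)
  then show ?thesis
    unfolding dbasis_def Ob_Delta
    using assms by (simp add: Delta_ract_coset[OF sc_closed] lmodule.smult_quot_mod[OF lmodule_free_mod submodule_noninj])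
qed

lemma kG_induct [consumes 1, case_names zero add]:
  assumes "a \<in> carrier (kG n)" "P \<zero>\<^bsub>kG n\<^esub>"
    and "\<And>c g b. c \<in> carrier k \<Longrightarrow> g \<in> carrier (aut C n) \<Longrightarrow> b \<in> carrier (kG n) \<Longrightarrow> P b \<Longrightarrow>
      P (sc n c \<otimes>\<^bsub>kG n\<^esub> single k g \<oplus>\<^bsub>kG n\<^esub> b)"
  shows "P a"
  using fin_funs_aut[OF assms(1)]
proof (induction rule: fin_funs_induct)
  case zero
  then show ?case using assms(2) by (simp add: group_algebra_simps)
next
  case (add c g b)
  then show ?case
    using assms(3)[of c g b] sc_mult(1)[of c "single k g" n] by (simp add: group_algebra_simps)
qed

lemma single_kG: "g \<in> carrier (aut C n) \<Longrightarrow> single k g \<in> carrier (kG n)"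
  by (simp add: group_algebra_simps)

lemma single_mult_kG: "single k g \<otimes>\<^bsub>kG n\<^esub> single k h = single k (compose {1..n} g h)"
  by (simp add: group_algebra_simps aut_simps)

text \<open>Restriction of scalars from the group algebra to the field. The tensor products are only
  modules over the field, and their coordinates have to be linear maps into a module of the same
  kind.\<close>

definition res_k :: "nat \<Rightarrow> ((nat \<Rightarrow> nat) \<Rightarrow> 'k, 'x) module \<Rightarrow> ('k, 'x) module" where
  "res_k n N = \<lparr>carrier = carrier N, mult = undefined, one = undefined, zero = zero N, add = add N,
     smult = (\<lambda>c v. sc n c \<odot>\<^bsub>N\<^esub> v)\<rparr>"

lemma res_k_simps [simp]:
  "carrier (res_k n N) = carrier N" "zero (res_k n N) = zero N" "add (res_k n N) = add N"
  "smult (res_k n N) c v = sc n c \<odot>\<^bsub>N\<^esub> v"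
  by (simp_all add: res_k_def)

lemma left_module_res_k:
  assumes "left_module (kG n) N"
  shows "left_module k (res_k n N)"
proof -
  interpret N: lmodule "kG n" N by (rule lmodule.intro) fact
  have "abelian_group (res_k n N)"
    by (intro abelian_groupI) (auto simp: N.M.a_ac intro: N.M.l_neg bexI[of _ "\<ominus>\<^bsub>N\<^esub> _"] dest: N.M.add.l_inv_ex)
  then interpret Nk: abelian_group "res_k n N" .
  have "sc n (c \<oplus> d) = sc n c \<oplus>\<^bsub>kG n\<^esub> sc n d" if "c \<in> carrier k" "d \<in> carrier k" for c d
    using that fin_funsD(1)[OF one_kG_closed] by (simp add: sc_def group_algebra_simps(4) l_distr)
  moreover have "sc n (c \<otimes> d) = sc n c \<otimes>\<^bsub>kG n\<^esub> sc n d" if "c \<in> carrier k" "d \<in> carrier k" for c d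
    using that fin_funsD(1)[OF one_kG_closed] sc_mult(1)[OF that(1) sc_closed[OF that(2)]] by (simp add: sc_def m_assoc)
  moreover have "sc n \<one> = \<one>\<^bsub>kG n\<^esub>"
    using fin_funsD(1)[OF one_kG_closed] by (simp add: sc_def)
  ultimately show ?thesis
    by unfold_locales
      (auto simp: N.smult_closed N.smult_l_distr N.smult_r_distr N.smult_assoc N.smult_one sc_closed)
qed

text \<open>The group algebra is spanned over the field by group elements, so linearity over the
  field together with equivariance suffices.\<close>

lemma kG_homI:
  assumes N: "left_module (kG n) N" and N': "left_module (kG n) N'"
    and f: "f \<in> mod_hom k (res_k n N) (res_k n N')"
    and eq: "\<And>g v. g \<in> carrier (aut C n) \<Longrightarrow> v \<in> carrier N \<Longrightarrow>
      f (single k g \<odot>\<^bsub>N\<^esub> v) = single k g \<odot>\<^bsub>N'\<^esub> f v"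
  shows "f \<in> mod_hom (kG n) N N'"
proof (rule mod_homI)
  interpret N: lmodule "kG n" N by (rule lmodule.intro) fact
  interpret N': lmodule "kG n" N' by (rule lmodule.intro) fact
  note fD = mod_homD[OF f, simplified]
  show "f x \<in> carrier N'" if "x \<in> carrier N" for x using fD that by blast
  show "f (x \<oplus>\<^bsub>N\<^esub> y) = f x \<oplus>\<^bsub>N'\<^esub> f y" if "x \<in> carrier N" "y \<in> carrier N" for x y using fD that by blast
  fix a v assume a: "a \<in> carrier (kG n)" and v: "v \<in> carrier N"
  show "f (a \<odot>\<^bsub>N\<^esub> v) = a \<odot>\<^bsub>N'\<^esub> f v"
    using a
  proof (induction rule: kG_induct)
    case zero
    show ?case using mod_hom_zero[OF left_module_res_k[OF N] left_module_res_k[OF N'] f] v fD(1) by simp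
  next
    case (add c g b)
    have cl: "single k g \<odot>\<^bsub>N\<^esub> v \<in> carrier N" "sc n c \<odot>\<^bsub>N\<^esub> (single k g \<odot>\<^bsub>N\<^esub> v) \<in> carrier N" "b \<odot>\<^bsub>N\<^esub> v \<in> carrier N"
      "sc n c \<otimes>\<^bsub>kG n\<^esub> single k g \<in> carrier (kG n)" "f v \<in> carrier N'"
      using add v N.smult_closed single_kG sc_closed N.R.m_closed fD(1) by auto
    show ?case
      using add v cl fD(2,3) eq sc_closed single_kG
      by (simp add: N.smult_l_distr N'.smult_l_distr N.smult_assoc N'.smult_assoc)
  qed
qed

lemma kG_submoduleI:
  assumes N: "left_module (kG n) N" and S: "submodule S k (res_k n N)"
    and g: "\<And>g v. g \<in> carrier (aut C n) \<Longrightarrow> v \<in> S \<Longrightarrow> single k g \<odot>\<^bsub>N\<^esub> v \<in> S"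
  shows "submodule S (kG n) N"
proof -
  interpret N: lmodule "kG n" N by (rule lmodule.intro) fact
  note D = lmodule.left_submoduleD[OF lmodule.intro[OF left_module_res_k[OF N]] S, simplified]
  show ?thesis
  proof (rule N.left_submoduleI)
    fix a v assume a: "a \<in> carrier (kG n)" and v: "v \<in> S"
    then have v': "v \<in> carrier N" using D(1) by auto
    show "a \<odot>\<^bsub>N\<^esub> v \<in> S"
      using a
    proof (induction rule: kG_induct)
      case (add c h b)
      have "sc n c \<odot>\<^bsub>N\<^esub> (single k h \<odot>\<^bsub>N\<^esub> v) \<in> S" using D(4) g add v by blast
      then have "sc n c \<odot>\<^bsub>N\<^esub> (single k h \<odot>\<^bsub>N\<^esub> v) \<oplus>\<^bsub>N\<^esub> b \<odot>\<^bsub>N\<^esub> v \<in> S" using D(3) add by blast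
      then show ?case
        using add v' sc_closed single_kG by (simp add: N.smult_l_distr N.smult_assoc)
    qed (use D(2) v' in simp)
  qed (use D in auto)
qed

end

section \<open>Coordinates on the tensor products of standard modules\<close>

locale Delta_rep = cat_rep k C + N: lmodule "group_algebra k (aut C n)" N
  for k :: "'k ring" (structure) and C :: cat and n :: nat
    and N :: "((nat \<Rightarrow> nat) \<Rightarrow> 'k, 'n) module"
begin

abbreviation "\<Delta> \<equiv> Delta k C n"
abbreviation "T \<equiv> Delta_tensor k C n N"
abbreviation "Nk \<equiv> res_k n N"
abbreviation act :: "(nat \<Rightarrow> nat) \<Rightarrow> 'n \<Rightarrow> 'n" where "act g v \<equiv> single k g \<odot>\<^bsub>N\<^esub> v"
abbreviation inj_mor :: "nat \<Rightarrow> (nat \<Rightarrow> nat) set" where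
  "inj_mor m \<equiv> {f \<in> C n m. inj_on f {1..n}}"

lemma tensor_data: "m \<ge> 1 \<Longrightarrow> tensor_data k (kG n) (Ob \<Delta> m) N (Delta_ract k C n m)"
  using cat_module.lmodule_Ob[OF cat_module_Delta] N.lmodule_axioms Delta_ract_closed scalar_field_axioms
  by (auto simp: tensor_data_def tensor_data_axioms_def)

lemma Ob_T: "Ob T m = tensor k (kG n) (Ob \<Delta> m) (Delta_ract k C n m) N"
  by (simp add: Delta_tensor_def Let_def)

lemma lmodule_T: "m \<ge> 1 \<Longrightarrow> lmodule k (Ob T m)"
proof -
  assume m: "m \<ge> 1"
  interpret D: tensor_data k "kG n" "Ob \<Delta> m" N "Delta_ract k C n m" by (rule tensor_data[OF m])
  show "lmodule k (Ob T m)" unfolding Ob_T by (rule D.T.lmodule_axioms)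
qed

lemma lmodule_Nk: "lmodule k Nk"
  by (rule lmodule.intro) (rule left_module_res_k[OF N.left_module_axioms'])

text \<open>The pure tensor of the class of the morphism \<open>h\<close> with \<open>v\<close>.
  Those with injective \<open>h\<close> generate, since the class of a noninjective \<open>h\<close>
  is zero.\<close>

definition gen :: "nat \<Rightarrow> (nat \<Rightarrow> nat) \<Rightarrow> 'n \<Rightarrow> (((nat \<Rightarrow> nat) \<Rightarrow> 'k) set \<times> 'n \<Rightarrow> 'k) set" where
  "gen m h v = tensor_data.tens k (kG n) (Ob \<Delta> m) N (Delta_ract k C n m) (dbasis n m h) v"

lemma act_closed: "g \<in> carrier (aut C n) \<Longrightarrow> v \<in> carrier N \<Longrightarrow> act g v \<in> carrier N"
  by (simp add: N.smult_closed single_kG)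

lemma act_id: "v \<in> carrier N \<Longrightarrow> act (\<lambda>i\<in>{1..n}. i) v = v"
  using N.smult_one by (simp add: group_algebra_simps aut_simps)

lemma gen_props:
  assumes m: "m \<ge> 1" and h: "h \<in> C n m"
  shows "v \<in> carrier N \<Longrightarrow> gen m h v \<in> carrier (Ob T m)"
    and "v \<in> carrier N \<Longrightarrow> w \<in> carrier N \<Longrightarrow> gen m h (v \<oplus>\<^bsub>N\<^esub> w) = gen m h v \<oplus>\<^bsub>Ob T m\<^esub> gen m h w"
    and "c \<in> carrier k \<Longrightarrow> v \<in> carrier N \<Longrightarrow> gen m h (sc n c \<odot>\<^bsub>N\<^esub> v) = c \<odot>\<^bsub>Ob T m\<^esub> gen m h v"
    and "g \<in> carrier (aut C n) \<Longrightarrow> v \<in> carrier N \<Longrightarrow> gen m (compose {1..n} h g) v = gen m h (act g v)"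
    and "v \<in> carrier N \<Longrightarrow> \<not> inj_on h {1..n} \<Longrightarrow> gen m h v = \<zero>\<^bsub>Ob T m\<^esub>"
proof -
  interpret D: tensor_data k "kG n" "Ob \<Delta> m" N "Delta_ract k C n m" by (rule tensor_data[OF m])
  note hc = dbasis_closed[OF h]
  note [simp] = gen_def Ob_T
  show "v \<in> carrier N \<Longrightarrow> gen m h v \<in> carrier (Ob T m)" using hc by simp
  show "v \<in> carrier N \<Longrightarrow> w \<in> carrier N \<Longrightarrow> gen m h (v \<oplus>\<^bsub>N\<^esub> w) = gen m h v \<oplus>\<^bsub>Ob T m\<^esub> gen m h w"
    using D.tens_add_right[OF hc] by simp
  show "c \<in> carrier k \<Longrightarrow> v \<in> carrier N \<Longrightarrow> gen m h (sc n c \<odot>\<^bsub>N\<^esub> v) = c \<odot>\<^bsub>Ob T m\<^esub> gen m h v"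
    using D.tens_balanced[OF hc sc_closed, of c v] D.tens_smult[OF _ hc, of c v] ract_sc[OF h, of c] by simp
  show "g \<in> carrier (aut C n) \<Longrightarrow> v \<in> carrier N \<Longrightarrow> gen m (compose {1..n} h g) v = gen m h (act g v)"
    using D.tens_balanced[OF hc single_kG, of g v] Delta_ract_dbasis[OF h, of g] by simp
  show "gen m h v = \<zero>\<^bsub>Ob T m\<^esub>" if v: "v \<in> carrier N" and "\<not> inj_on h {1..n}"
  proof -
    have z: "dbasis n m h = \<zero> \<odot>\<^bsub>Ob \<Delta> m\<^esub> dbasis n m h" using dbasis_noninj[OF h] that hc by simp
    show ?thesis
      unfolding gen_def by (subst z) (use D.tens_smult[OF zero_closed hc v] hc v in simp)
  qed
qed

lemma T_induct [consumes 2, case_names zero add]: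
  assumes m: "m \<ge> 1" and x: "x \<in> carrier (Ob T m)"
    and zero: "P \<zero>\<^bsub>Ob T m\<^esub>"
    and add: "\<And>h v z. h \<in> C n m \<Longrightarrow> inj_on h {1..n} \<Longrightarrow> v \<in> carrier N \<Longrightarrow> z \<in> carrier (Ob T m) \<Longrightarrow> P z \<Longrightarrow>
      P (gen m h v \<oplus>\<^bsub>Ob T m\<^esub> z)"
  shows "P x"
proof -
  interpret D: tensor_data k "kG n" "Ob \<Delta> m" N "Delta_ract k C n m" by (rule tensor_data[OF m])
  interpret F: lmodule k "free_mod k (C n m)" by (rule lmodule_free_mod)
  have "x \<in> carrier D.T" using x by (simp add: Ob_T)
  then show ?thesis
  proof (induction rule: D.tensor_induct)
    case zero
    show ?case using assms(3) by (simp add: Ob_T)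
  next
    case (add X v z)
    obtain \<phi> where \<phi>: "\<phi> \<in> fin_funs k (C n m)" "X = noninj k C n m +>\<^bsub>free_mod k (C n m)\<^esub> \<phi>"
      using add(1) by (rule Delta_cosetE)
    have "P (D.tens (noninj k C n m +>\<^bsub>free_mod k (C n m)\<^esub> \<phi>) v \<oplus>\<^bsub>D.T\<^esub> z)"
      using \<phi>(1) add(3,4)
    proof (induction arbitrary: z rule: fin_funs_induct)
      case zero
      have z: "noninj k C n m +>\<^bsub>free_mod k (C n m)\<^esub> (\<lambda>x. \<zero>) = \<zero> \<odot>\<^bsub>Ob \<Delta> m\<^esub> \<zero>\<^bsub>Ob \<Delta> m\<^esub>"
        using F.coset_zero[OF submodule_noninj] by (simp add: free_mod_simps) (simp add: Ob_Delta F.zero_quot_mod)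
      show ?case unfolding z using zero add(2) by (subst D.tens_smult) auto
    next
      case (add c h \<psi>)
      let ?W = "noninj k C n m"
      have e: "?W +>\<^bsub>free_mod k (C n m)\<^esub> (\<lambda>y. c \<otimes> single k h y \<oplus> \<psi> y) =
        c \<odot>\<^bsub>Ob \<Delta> m\<^esub> dbasis n m h \<oplus>\<^bsub>Ob \<Delta> m\<^esub> (?W +>\<^bsub>free_mod k (C n m)\<^esub> \<psi>)"
        unfolding Ob_Delta dbasis_def using add
        by (simp add: F.smult_quot_mod[OF submodule_noninj] F.add_quot_mod[OF submodule_noninj] single_smult_closed free_mod_simps)
      have \<psi>c: "?W +>\<^bsub>free_mod k (C n m)\<^esub> \<psi> \<in> carrier (Ob \<Delta> m)" using add(3) by (rule Delta_coset_closed)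
      have v': "sc n c \<odot>\<^bsub>N\<^esub> v \<in> carrier N" using add(1) \<open>v \<in> carrier N\<close> N.smult_closed sc_closed by blast
      define u where "u = D.tens (?W +>\<^bsub>free_mod k (C n m)\<^esub> \<psi>) v \<oplus>\<^bsub>D.T\<^esub> z"
      have u: "u \<in> carrier D.T" "P u"
        unfolding u_def using add \<psi>c \<open>v \<in> carrier N\<close> by auto
      have "D.tens (c \<odot>\<^bsub>Ob \<Delta> m\<^esub> dbasis n m h) v = gen m h (sc n c \<odot>\<^bsub>N\<^esub> v)"
        using D.tens_balanced[OF dbasis_closed[OF add(2)] sc_closed[OF add(1)] \<open>v \<in> carrier N\<close>] ract_sc[OF add(2,1)]
        by (simp add: gen_def)
      then have "D.tens (?W +>\<^bsub>free_mod k (C n m)\<^esub> (\<lambda>y. c \<otimes> single k h y \<oplus> \<psi> y)) v \<oplus>\<^bsub>D.T\<^esub> z =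
        gen m h (sc n c \<odot>\<^bsub>N\<^esub> v) \<oplus>\<^bsub>D.T\<^esub> u"
        unfolding e u_def using add \<psi>c \<open>v \<in> carrier N\<close> dbasis_closed[OF add(2)] D.M.smult_closed
          gen_props(1)[OF m add(2) v']
        by (simp add: D.tens_add_left D.T.M.a_assoc Ob_T)
      moreover have "P (gen m h (sc n c \<odot>\<^bsub>N\<^esub> v) \<oplus>\<^bsub>D.T\<^esub> u)"
      proof (cases "inj_on h {1..n}")
        case True
        then show ?thesis using assms(4)[OF add(2) True v'] u by (simp add: Ob_T)
      next
        case False
        then show ?thesis using gen_props(5)[OF m add(2) v'] u by (simp add: Ob_T)
      qed
      ultimately show ?case by simp
    qed
    then show ?case using \<phi>(2) by simp
  qed
qed

lemma T_hom_eqI: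
  assumes m: "m \<ge> 1" and Z: "left_module k Z" and f: "f \<in> mod_hom k (Ob T m) Z" "g \<in> mod_hom k (Ob T m) Z"
    and eq: "\<And>h v. h \<in> C n m \<Longrightarrow> inj_on h {1..n} \<Longrightarrow> v \<in> carrier N \<Longrightarrow> f (gen m h v) = g (gen m h v)"
    and x: "x \<in> carrier (Ob T m)"
  shows "f x = g x"
  using m x
proof (induction rule: T_induct)
  case zero
  show ?case
    using mod_hom_zero[OF lmodule.left_module_axioms'[OF lmodule_T[OF m]] Z f(1)]
      mod_hom_zero[OF lmodule.left_module_axioms'[OF lmodule_T[OF m]] Z f(2)] by simp
next
  case (add h v z)
  then show ?case using eq mod_homD(2)[OF f(1)] mod_homD(2)[OF f(2)] gen_props(1)[OF m add(1,3)] by simp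
qed

lemma Mor_T_hom:
  assumes ml: "m \<ge> 1" "l \<ge> 1" "d \<in> C m l"
  shows "Mor T m l d \<in> mod_hom k (Ob T m) (Ob T l)"
    and "h \<in> C n m \<Longrightarrow> v \<in> carrier N \<Longrightarrow> Mor T m l d (gen m h v) = gen l (compose {1..n} d h) v"
proof -
  have bal: "Mor \<Delta> m l d (Delta_ract k C n m X a) = Delta_ract k C n l (Mor \<Delta> m l d X) a"
    if "X \<in> carrier (Ob \<Delta> m)" "a \<in> carrier (kG n)" for X a
    using Mor_Delta_ract[OF ml that] .
  note Q = tensor_quot_map[where u = "Mor \<Delta> m l d" and M = "Ob \<Delta> m" and M' = "Ob \<Delta> l" and N = N
      and A = "kG n" and k = k and ract = "Delta_ract k C n m" and ract' = "Delta_ract k C n l",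
      OF tensor_data[OF ml(1)] tensor_data[OF ml(2)] cat_module.Mor_hom[OF cat_module_Delta[of n] ml] bal]
  have M: "Mor T m l d = quot_map (free_mod k (carrier (Ob \<Delta> l) \<times> carrier N))
    (tensor_rels k (kG n) (Ob \<Delta> l) (Delta_ract k C n l) N) (lin_ext k (\<lambda>(x, y). (Mor \<Delta> m l d x, y)))"
    by (simp add: Delta_tensor_def Let_def)
  show "Mor T m l d \<in> mod_hom k (Ob T m) (Ob T l)"
    unfolding M Ob_T by (rule Q(1))
  show "h \<in> C n m \<Longrightarrow> v \<in> carrier N \<Longrightarrow> Mor T m l d (gen m h v) = gen l (compose {1..n} d h) v"
    unfolding M gen_def using Q(2) dbasis_closed by (simp add: Mor_Delta_dbasis[OF ml])
qed

lemma cmodule_T: "cmodule k C T"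
  unfolding cmodule_def
proof (intro conjI allI impI ballI)
  fix m :: nat assume m: "m \<ge> 1"
  note lm = lmodule.left_module_axioms'[OF lmodule_T]
  show "Module.module k (Ob T m)" using lm[OF m] cring_axioms by (simp add: module_iff_left_module)
  show "Mor T m l d \<in> mod_hom k (Ob T m) (Ob T l)" if "l \<ge> 1" "d \<in> C m l" for l d
    using Mor_T_hom(1)[OF m that] .
  show "Mor T m m (\<lambda>i\<in>{1..m}. i) x = x" if "x \<in> carrier (Ob T m)" for x
  proof (rule T_hom_eqI[OF m lm[OF m] Mor_T_hom(1)[OF m m id_mem] id_hom _ that])
    fix h v assume "h \<in> C n m" "v \<in> carrier N"
    then show "Mor T m m (\<lambda>i\<in>{1..m}. i) (gen m h v) = gen m h v"
      using Mor_T_hom(2)[OF m m id_mem, of h v] id_compose[of h n m] by simp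
  qed
  fix l r :: nat and d d' x
  assume *: "l \<ge> 1" "r \<ge> 1" "d \<in> C m l" "d' \<in> C l r" "x \<in> carrier (Ob T m)"
  show "Mor T m r (compose {1..m} d' d) x = Mor T l r d' (Mor T m l d x)"
  proof (rule T_hom_eqI[OF m lm[OF *(2)] Mor_T_hom(1)[OF m *(2) comp_closed[OF *(3,4)]]
        mod_hom_comp[OF Mor_T_hom(1)[OF m *(1,3)] Mor_T_hom(1)[OF *(1,2,4)]] _ *(5)])
    fix h v assume h: "h \<in> C n m" and v: "v \<in> carrier N"
    show "Mor T m r (compose {1..m} d' d) (gen m h v) = Mor T l r d' (Mor T m l d (gen m h v))"
      using Mor_T_hom(2)[OF m *(2) comp_closed[OF *(3,4)] h v] Mor_T_hom(2)[OF m *(1,3) h v]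
        Mor_T_hom(2)[OF *(1,2,4) comp_closed[OF h *(3)] v] compose_assoc'[OF h *(3), of d'] by simp
  qed
qed

sublocale T: cat_module k C T
  by unfold_locales (rule cmodule_T)

text \<open>The part of a combination of morphisms that is supported on the orbit of
  \<open>f\<close> under precomposition, read as an element of the group algebra. For injective
  \<open>f\<close> distinct automorphisms give distinct orbit members, so nothing is counted
  twice.\<close>

definition alpha :: "(nat \<Rightarrow> nat) \<Rightarrow> ((nat \<Rightarrow> nat) \<Rightarrow> 'k) \<Rightarrow> (nat \<Rightarrow> nat) \<Rightarrow> 'k" where
  "alpha f \<phi> = (\<lambda>g. if g \<in> carrier (aut C n) then \<phi> (compose {1..n} f g) else \<zero>)"

lemma alpha_hom: "alpha f \<in> mod_hom k (free_mod k (C n m)) (free_mod k (carrier (aut C n)))"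
proof (rule mod_homI)
  show "alpha f \<phi> \<in> carrier (free_mod k (carrier (aut C n)))" if "\<phi> \<in> carrier (free_mod k (C n m))" for \<phi>
  proof -
    have "{x. alpha f \<phi> x \<noteq> \<zero>} \<subseteq> carrier (aut C n)" by (auto simp: alpha_def)
    moreover have "alpha f \<phi> x \<in> carrier k" for x
      using fin_funsD(1)[of \<phi> "C n m"] that by (simp add: alpha_def)
    ultimately show ?thesis
      using finite_aut[of n] finite_subset by (auto simp: fin_funs_def)
  qed
qed (auto simp: free_mod_simps alpha_def)

lemma aut_cancel:
  assumes "f \<in> C n m" "inj_on f {1..n}" "g \<in> C n n" "g' \<in> C n n" "compose {1..n} f g = compose {1..n} f g'"
  shows "g = g'"
proof (rule mor_eqI[OF assms(3,4)])
  fix x assume x: "x \<in> {1..n}"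
  then have "f (g x) = f (g' x)" using fun_cong[OF assms(5), of x] by (simp add: compose_def)
  then show "g x = g' x" using inj_onD[OF assms(2)] morD(1)[OF assms(3) x] morD(1)[OF assms(4) x] by blast
qed

lemma alpha_orbit:
  assumes "f \<in> C n m" "inj_on f {1..n}" "g \<in> carrier (aut C n)"
  shows "alpha f (single k (compose {1..n} f g)) = single k g"
proof
  fix x show "alpha f (single k (compose {1..n} f g)) x = single k g x"
    using aut_cancel[OF assms(1,2), of x g] aut_mem assms(3) by (auto simp: alpha_def single_def)
qed

lemma alpha_other:
  assumes "\<And>g. g \<in> carrier (aut C n) \<Longrightarrow> h \<noteq> compose {1..n} f g"
  shows "alpha f (single k h) = (\<lambda>x. \<zero>)"
proof
  fix g show "alpha f (single k h) g = \<zero>"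
    using assms[of g] by (auto simp: alpha_def single_def)
qed

lemma aut_inverse:
  assumes "g \<in> carrier (aut C n)"
  obtains g' where "g' \<in> carrier (aut C n)" "compose {1..n} g g' = (\<lambda>i\<in>{1..n}. i)" "compose {1..n} g' g = (\<lambda>i\<in>{1..n}. i)"
  using group.r_inv[OF group_aut assms] group.l_inv[OF group_aut assms] group.inv_closed[OF group_aut assms]
  by (simp add: aut_simps)

text \<open>Right linearity of \<open>alpha f\<close> over the group algebra. It holds because
  precomposition with automorphisms permutes each orbit: a basis element on the orbit of
  \<open>f\<close> is multiplied as in the group, and one off the orbit stays off it.\<close>

lemma alpha_conv:
  assumes f: "f \<in> C n m" "inj_on f {1..n}" and \<phi>: "\<phi> \<in> fin_funs k (C n m)" and a: "a \<in> carrier (kG n)"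
  shows "alpha f (bilin_ext k (compose {1..n}) \<phi> a) = alpha f \<phi> \<otimes>\<^bsub>kG n\<^esub> a"
proof -
  let ?c = "bilin_ext k (compose {1..n})"
  let ?G = "carrier (aut C n)"
  note lm = left_module_free_mod
  have GG: "compose {1..n} g g' \<in> ?G" if "g \<in> ?G" "g' \<in> ?G" for g g'
    using that monoid.m_closed[OF aut_monoid] by (simp add: aut_simps)
  have 1: "alpha f (?c (single k h) a) = ?c (alpha f (single k h)) a" if h: "h \<in> C n m" for h
  proof (rule mod_hom_free_eqI[OF lm _ _ _ fin_funs_aut[OF a]])
    show "(\<lambda>a. alpha f (?c (single k h) a)) \<in> mod_hom k (free_mod k ?G) (free_mod k ?G)"
      using h aut_comp by (intro mod_hom_comp[OF bilin_ext_hom2[of _ "{h}" _ _ "C n m"] alpha_hom]) auto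
    show "(\<lambda>a. ?c (alpha f (single k h)) a) \<in> mod_hom k (free_mod k ?G) (free_mod k ?G)"
      using mod_homD(1)[OF alpha_hom, of "single k h" m f] h GG by (intro bilin_ext_hom2[of _ ?G]) auto
    fix g assume g: "g \<in> ?G"
    show "alpha f (?c (single k h) (single k g)) = ?c (alpha f (single k h)) (single k g)"
    proof (cases "\<exists>g'\<in>?G. h = compose {1..n} f g'")
      case True
      then obtain g' where g': "g' \<in> ?G" "h = compose {1..n} f g'" by blast
      have "compose {1..n} h g = compose {1..n} f (compose {1..n} g' g)"
        using compose_assoc'[of g n n g' n f] aut_mem[OF g] aut_mem[OF g'(1)] g'(2) by simp
      then show ?thesis
        using alpha_orbit[OF f g'(1)] alpha_orbit[OF f GG[OF g'(1) g]] g'(2) by simp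
    next
      case False
      obtain g1 where g1: "g1 \<in> ?G" "compose {1..n} g g1 = (\<lambda>i\<in>{1..n}. i)"
        using aut_inverse[OF g] by blast
      \<comment> \<open>Otherwise composing with the inverse \<open>g1\<close> would put
        \<open>h\<close> itself on the orbit.\<close>
      have "compose {1..n} h g \<noteq> compose {1..n} f g'" if g': "g' \<in> ?G" for g'
      proof
        assume e: "compose {1..n} h g = compose {1..n} f g'"
        have "h = compose {1..n} (compose {1..n} h g) g1"
          using compose_assoc'[of g1 n n g n h] aut_mem[OF g] aut_mem[OF g1(1)] g1(2) compose_id[OF h] by simp
        also have "\<dots> = compose {1..n} f (compose {1..n} g' g1)"
          unfolding e using compose_assoc'[of g1 n n g' n f] aut_mem[OF g'] aut_mem[OF g1(1)] by simp
        finally show False using False GG[OF g' g1(1)] by blast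
      qed
      then have "alpha f (single k (compose {1..n} h g)) = (\<lambda>x. \<zero>)" "alpha f (single k h) = (\<lambda>x. \<zero>)"
        using False by (intro alpha_other; blast)+
      moreover have "?c (\<lambda>x :: nat \<Rightarrow> nat. \<zero>) (single k g) = (\<lambda>x. \<zero>)"
      proof -
        have "(\<lambda>\<phi>. ?c \<phi> (single k g)) \<in> mod_hom k (free_mod k ?G) (free_mod k ?G)"
          using g GG by (intro bilin_ext_hom[of _ "{g}"]) auto
        from mod_hom_zero[OF lm lm this] show ?thesis by (simp add: free_mod_simps)
      qed
      ultimately show ?thesis by simp
    qed
  qed
  have "(\<lambda>\<phi>. ?c (alpha f \<phi>) a) \<in> mod_hom k (free_mod k (C n m)) (free_mod k ?G)"
    using GG by (intro mod_hom_comp[OF alpha_hom bilin_ext_hom[OF fin_funs_aut[OF a]]]) auto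
  from mod_hom_free_eqI[OF lm mod_hom_comp[OF conv_hom[OF a] alpha_hom] this 1 \<phi>]
  show ?thesis by (simp add: group_algebra_simps aut_simps)
qed

text \<open>The coordinate at \<open>f\<close> sends the tensor of the class of \<phi> with
  \<open>v\<close> to \<open>alpha f \<phi>\<close> applied to \<open>v\<close>. It respects the
  quotient since the orbit of an injection consists of injections, and it is balanced by
  \<open>alpha_conv\<close>.\<close>

lemma coord_exists:
  assumes m: "m \<ge> 1" and f: "f \<in> C n m" "inj_on f {1..n}"
  shows "\<exists>c \<in> mod_hom k (Ob T m) Nk. \<forall>h\<in>C n m. \<forall>v\<in>carrier N. c (gen m h v) = alpha f (single k h) \<odot>\<^bsub>N\<^esub> v"
proof -
  interpret D: tensor_data k "kG n" "Ob \<Delta> m" N "Delta_ract k C n m" by (rule tensor_data[OF m])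
  interpret Nk: lmodule k Nk by (rule lmodule_Nk)
  let ?G = "carrier (aut C n)"
  have "alpha f \<phi> = \<zero>\<^bsub>free_mod k ?G\<^esub>" if "\<phi> \<in> noninj k C n m" for \<phi>
  proof
    fix g
    show "alpha f \<phi> g = \<zero>\<^bsub>free_mod k ?G\<^esub> g"
      using noninj_vanish[OF that, of "compose {1..n} f g"] aut_comp[OF f(1), of g] aut_mem[of g] f(2)
        inj_on_compose_iff[of g n n f]
      by (simp add: alpha_def free_mod_simps)
  qed
  then obtain q where q: "q \<in> mod_hom k (Ob \<Delta> m) (free_mod k ?G)"
    and qa: "\<And>\<phi>. \<phi> \<in> fin_funs k (C n m) \<Longrightarrow> q (noninj k C n m +>\<^bsub>free_mod k (C n m)\<^esub> \<phi>) = alpha f \<phi>"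
    using quot_lift[OF left_module_free_mod submodule_noninj left_module_free_mod alpha_hom]
    unfolding Ob_Delta by (metis carrier_free_mod)
  note qD = mod_homD[OF q]
  have qG: "q X \<in> carrier (kG n)" if "X \<in> carrier (Ob \<Delta> m)" for X
    using qD(1)[OF that] by (simp add: group_algebra_simps)
  obtain c where c: "c \<in> mod_hom k D.T Nk"
    "\<And>X v. X \<in> carrier (Ob \<Delta> m) \<Longrightarrow> v \<in> carrier N \<Longrightarrow> c (D.tens X v) = q X \<odot>\<^bsub>N\<^esub> v"
  proof (rule D.tensor_lift[OF Nk.left_module_axioms', of "\<lambda>X v. q X \<odot>\<^bsub>N\<^esub> v"])
    show "q X \<odot>\<^bsub>N\<^esub> v \<in> carrier Nk" if "X \<in> carrier (Ob \<Delta> m)" "v \<in> carrier N" for X v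
      using qG that N.smult_closed by simp
    show "q (X \<oplus>\<^bsub>Ob \<Delta> m\<^esub> Y) \<odot>\<^bsub>N\<^esub> v = q X \<odot>\<^bsub>N\<^esub> v \<oplus>\<^bsub>Nk\<^esub> q Y \<odot>\<^bsub>N\<^esub> v"
      if "X \<in> carrier (Ob \<Delta> m)" "Y \<in> carrier (Ob \<Delta> m)" "v \<in> carrier N" for X Y v
      using qD(2)[OF that(1,2)] N.smult_l_distr[OF qG qG] that by (simp add: free_mod_simps group_algebra_simps)
    show "q X \<odot>\<^bsub>N\<^esub> (v \<oplus>\<^bsub>N\<^esub> w) = q X \<odot>\<^bsub>N\<^esub> v \<oplus>\<^bsub>Nk\<^esub> q X \<odot>\<^bsub>N\<^esub> w"
      if "X \<in> carrier (Ob \<Delta> m)" "v \<in> carrier N" "w \<in> carrier N" for X v w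
      using N.smult_r_distr qG that by simp
    show "q (c \<odot>\<^bsub>Ob \<Delta> m\<^esub> X) \<odot>\<^bsub>N\<^esub> v = c \<odot>\<^bsub>Nk\<^esub> (q X \<odot>\<^bsub>N\<^esub> v)"
      if "c \<in> carrier k" "X \<in> carrier (Ob \<Delta> m)" "v \<in> carrier N" for c X v
      using qD(3)[OF that(1,2)] N.smult_assoc[OF sc_closed[OF that(1)] qG[OF that(2)] that(3)]
        sc_mult(1)[OF that(1) qG[OF that(2)]]
      by (simp add: free_mod_simps)
    show "q (Delta_ract k C n m X a) \<odot>\<^bsub>N\<^esub> v = q X \<odot>\<^bsub>N\<^esub> (a \<odot>\<^bsub>N\<^esub> v)"
      if X: "X \<in> carrier (Ob \<Delta> m)" and a: "a \<in> carrier (kG n)" and v: "v \<in> carrier N" for X a v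
    proof -
      obtain \<phi> where \<phi>: "\<phi> \<in> fin_funs k (C n m)" "X = noninj k C n m +>\<^bsub>free_mod k (C n m)\<^esub> \<phi>"
        using X by (rule Delta_cosetE)
      have "q (Delta_ract k C n m X a) = q X \<otimes>\<^bsub>kG n\<^esub> a"
        unfolding \<phi>(2) Delta_ract_coset[OF a \<phi>(1)]
        using mod_homD(1)[OF conv_hom[OF a]] \<phi>(1) by (simp add: qa alpha_conv[OF f \<phi>(1) a])
      then show ?thesis using N.smult_assoc[OF qG a] X v by simp
    qed
  qed blast
  show ?thesis
  proof (intro bexI[of _ c] ballI)
    show "c \<in> mod_hom k (Ob T m) Nk" using c(1) by (simp add: Ob_T)
    fix h v assume h: "h \<in> C n m" and v: "v \<in> carrier N"
    show "c (gen m h v) = alpha f (single k h) \<odot>\<^bsub>N\<^esub> v"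
      using c(2)[OF dbasis_closed[OF h] v] qa[of "single k h"] h by (simp add: gen_def dbasis_def)
  qed
qed

text \<open>The choice is harmless: \<open>T_hom_eqI\<close> shows that a linear map on
  \<open>T([m])\<close> is determined by its values on the elements
  \<open>gen m h v\<close>.\<close>

definition coord :: "nat \<Rightarrow> (nat \<Rightarrow> nat) \<Rightarrow> (((nat \<Rightarrow> nat) \<Rightarrow> 'k) set \<times> 'n \<Rightarrow> 'k) set \<Rightarrow> 'n" where
  "coord m f = (SOME c. c \<in> mod_hom k (Ob T m) Nk \<and>
     (\<forall>h\<in>C n m. \<forall>v\<in>carrier N. c (gen m h v) = alpha f (single k h) \<odot>\<^bsub>N\<^esub> v))"

lemma coord_props:
  assumes m: "m \<ge> 1" and f: "f \<in> C n m" "inj_on f {1..n}"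
  shows "coord m f \<in> mod_hom k (Ob T m) Nk"
    and "v \<in> carrier N \<Longrightarrow> g \<in> carrier (aut C n) \<Longrightarrow> coord m f (gen m (compose {1..n} f g) v) = act g v"
    and "v \<in> carrier N \<Longrightarrow> coord m f (gen m f v) = v"
    and "v \<in> carrier N \<Longrightarrow> h \<in> C n m \<Longrightarrow> (\<And>g. g \<in> carrier (aut C n) \<Longrightarrow> h \<noteq> compose {1..n} f g) \<Longrightarrow>
      coord m f (gen m h v) = \<zero>\<^bsub>N\<^esub>"
proof -
  have c: "coord m f \<in> mod_hom k (Ob T m) Nk \<and>
     (\<forall>h\<in>C n m. \<forall>v\<in>carrier N. coord m f (gen m h v) = alpha f (single k h) \<odot>\<^bsub>N\<^esub> v)"
    unfolding coord_def using coord_exists[OF m f] by (rule someI2_bex) blast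
  then show "coord m f \<in> mod_hom k (Ob T m) Nk" by blast
  show *: "coord m f (gen m (compose {1..n} f g) v) = act g v" if "v \<in> carrier N" "g \<in> carrier (aut C n)" for g v
    using c that aut_comp[OF f(1) that(2)] alpha_orbit[OF f that(2)] by simp
  have "(\<lambda>i\<in>{1..n}. i) \<in> carrier (aut C n)"
    using monoid.one_closed[OF aut_monoid] by (simp add: aut_simps)
  then show "v \<in> carrier N \<Longrightarrow> coord m f (gen m f v) = v"
    using *[of v "\<lambda>i\<in>{1..n}. i"] compose_id[OF f(1)] act_id by simp
  show "coord m f (gen m h v) = \<zero>\<^bsub>N\<^esub>"
    if "v \<in> carrier N" "h \<in> C n m" "\<And>g. g \<in> carrier (aut C n) \<Longrightarrow> h \<noteq> compose {1..n} f g"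
    using c that alpha_other[OF that(3)] N.smult_l_zero by (simp add: group_algebra_simps)
qed

lemma orbit_sym:
  assumes "f \<in> C n m" "g \<in> carrier (aut C n)" "f' = compose {1..n} f g"
  obtains g' where "g' \<in> carrier (aut C n)" "f = compose {1..n} f' g'"
proof -
  obtain g' where g': "g' \<in> carrier (aut C n)" "compose {1..n} g g' = (\<lambda>i\<in>{1..n}. i)"
    using aut_inverse[OF assms(2)] by blast
  have "f = compose {1..n} f' g'"
    using compose_assoc'[of g' n n g n f] aut_mem[OF g'(1)] aut_mem[OF assms(2)] g'(2) compose_id[OF assms(1)] assms(3)
    by simp
  then show ?thesis using that g'(1) by blast
qed

text \<open>A chosen member of the orbit of \<open>h\<close>. The choice depends only on the orbit
  as a set, which gives \<open>rep_cong\<close>; so the image of \<open>rep\<close> is a system of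
  representatives.\<close>

definition rep :: "(nat \<Rightarrow> nat) \<Rightarrow> nat \<Rightarrow> nat" where
  "rep h = (SOME f. \<exists>g\<in>carrier (aut C n). f = compose {1..n} h g)"

lemma rep_orbit: "\<exists>g\<in>carrier (aut C n). rep h = compose {1..n} h g"
  unfolding rep_def
  by (rule someI_ex[of "\<lambda>f. \<exists>g\<in>carrier (aut C n). f = compose {1..n} h g"])
    (use monoid.one_closed[OF aut_monoid] in blast)

lemma rep_cong:
  assumes "h \<in> C n m" "g \<in> carrier (aut C n)"
  shows "rep (compose {1..n} h g) = rep h"
proof -
  obtain g' where g': "g' \<in> carrier (aut C n)" "h = compose {1..n} (compose {1..n} h g) g'"
    using orbit_sym[OF assms refl] by blast
  have GG: "compose {1..n} a b \<in> carrier (aut C n)" if "a \<in> carrier (aut C n)" "b \<in> carrier (aut C n)" for a b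
    using that monoid.m_closed[OF aut_monoid] by (simp add: aut_simps)
  have "(\<exists>b\<in>carrier (aut C n). f = compose {1..n} (compose {1..n} h g) b) \<longleftrightarrow>
    (\<exists>b\<in>carrier (aut C n). f = compose {1..n} h b)" for f
  proof safe
    fix b assume b: "b \<in> carrier (aut C n)"
    show "\<exists>b'\<in>carrier (aut C n). compose {1..n} (compose {1..n} h g) b = compose {1..n} h b'"
      using compose_assoc'[of b n n g n h] aut_mem[OF b] aut_mem[OF assms(2)] GG[OF assms(2) b] by metis
    show "\<exists>b'\<in>carrier (aut C n). compose {1..n} h b = compose {1..n} (compose {1..n} h g) b'"
      using compose_assoc'[of b n n g' n "compose {1..n} h g"] aut_mem[OF b] aut_mem[OF g'(1)] GG[OF g'(1) b] g'(2)
      by metis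
  qed
  then show ?thesis unfolding rep_def by simp
qed

text \<open>An element is the sum, over one injection \<open>f\<close> from each orbit, of the
  generators at \<open>f\<close> with its own coordinate as coefficient. This expansion replaces a
  basis of the standard module over the group algebra.\<close>

lemma coord_zero_imp_zero:
  assumes m: "m \<ge> 1" and x: "x \<in> carrier (Ob T m)"
    and z: "\<And>f. f \<in> C n m \<Longrightarrow> inj_on f {1..n} \<Longrightarrow> coord m f x = \<zero>\<^bsub>N\<^esub>"
  shows "x = \<zero>\<^bsub>Ob T m\<^esub>"
proof -
  interpret M: lmodule k "Ob T m" by (rule lmodule_T[OF m])
  interpret Nk: lmodule k Nk by (rule lmodule_Nk)
  define R where "R = rep ` inj_mor m"
  have R: "finite R" using finite_mor[of n m] by (simp add: R_def)
  have rep_in: "rep h \<in> inj_mor m" if "h \<in> inj_mor m" for h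
  proof -
    obtain g where g: "g \<in> carrier (aut C n)" "rep h = compose {1..n} h g" using rep_orbit by blast
    show ?thesis
      using that g(2) aut_comp[OF _ g(1), of h m] aut_mem[OF g(1)] inj_on_compose_iff[of g n n h] by simp
  qed
  then have R_in: "f \<in> C n m" "inj_on f {1..n}" if "f \<in> R" for f
    using that by (auto simp: R_def)
  have gc: "gen m f (coord m f y) \<in> carrier (Ob T m)" "coord m f y \<in> carrier N"
    if "f \<in> R" "y \<in> carrier (Ob T m)" for f y
    using mod_homD(1)[OF coord_props(1)[OF m R_in[OF that(1)]] that(2)] gen_props(1)[OF m R_in(1)[OF that(1)]] by auto
  have "x = finsum (Ob T m) (\<lambda>f. gen m f (coord m f x)) R"
    using m x
  proof (induction rule: T_induct)
    case zero
    have "gen m f (coord m f \<zero>\<^bsub>Ob T m\<^esub>) = \<zero>\<^bsub>Ob T m\<^esub>" if "f \<in> R" for f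
    proof -
      \<comment> \<open>Zero is written as a multiple by the scalar zero, so that linearity of
        \<open>gen\<close> in its last argument makes the generator vanish.\<close>
      have "coord m f \<zero>\<^bsub>Ob T m\<^esub> = sc n \<zero> \<odot>\<^bsub>N\<^esub> \<zero>\<^bsub>N\<^esub>"
        using mod_hom_zero[OF M.left_module_axioms' Nk.left_module_axioms' coord_props(1)[OF m R_in[OF that]]]
          sc_closed[OF zero_closed] by simp
      then show ?thesis using gen_props(1,3)[OF m R_in(1)[OF that]] by simp
    qed
    then show ?case by (simp add: M.M.add.finprod_one_eqI)
  next
    case (add h v y)
    define r where "r = rep h"
    have r: "r \<in> R" using add by (simp add: r_def R_def)
    obtain g where g: "g \<in> carrier (aut C n)" "r = compose {1..n} h g" using rep_orbit unfolding r_def by blast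
    obtain g' where g': "g' \<in> carrier (aut C n)" "h = compose {1..n} r g'"
      using orbit_sym[OF add(1) g] by blast
    have hv: "gen m h v \<in> carrier (Ob T m)" using gen_props(1)[OF m add(1,3)] .
    \<comment> \<open>Only the representative of the orbit of \<open>h\<close> sees
      \<open>gen m h v\<close>, and there the coordinate returns the generator, with the
      automorphism moved across the tensor sign.\<close>
    have other: "gen m f (coord m f (gen m h v)) = (if r = f then gen m h v else \<zero>\<^bsub>Ob T m\<^esub>)" if f: "f \<in> R" for f
    proof (cases "r = f")
      case True
      then show ?thesis
        using coord_props(2)[OF m R_in[OF r] add(3) g'(1)] gen_props(4)[OF m R_in(1)[OF r] g'(1) add(3)] g'(2) by simp
    next
      case False
      have "h \<noteq> compose {1..n} f b" if b: "b \<in> carrier (aut C n)" for b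
      proof
        assume "h = compose {1..n} f b"
        then have "r = rep f" using rep_cong[OF R_in(1)[OF f] b] by (simp add: r_def)
        also have "rep f = f"
        proof -
          obtain f' where f': "f' \<in> C n m" "f = rep f'" using f by (auto simp: R_def)
          then obtain b' where "b' \<in> carrier (aut C n)" "f = compose {1..n} f' b'" using rep_orbit by metis
          then show ?thesis using rep_cong f' by metis
        qed
        finally show False using False by simp
      qed
      then have "coord m f (gen m h v) = sc n \<zero> \<odot>\<^bsub>N\<^esub> \<zero>\<^bsub>N\<^esub>"
        using coord_props(4)[OF m R_in[OF f] add(3,1)] sc_closed[OF zero_closed] by simp
      then show ?thesis using False gen_props(1,3)[OF m R_in(1)[OF f]] by simp
    qed
    have "finsum (Ob T m) (\<lambda>f. gen m f (coord m f (gen m h v \<oplus>\<^bsub>Ob T m\<^esub> y))) R =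
      finsum (Ob T m) (\<lambda>f. (if r = f then gen m h v else \<zero>\<^bsub>Ob T m\<^esub>) \<oplus>\<^bsub>Ob T m\<^esub> gen m f (coord m f y)) R"
    proof (rule M.M.finsum_cong')
      fix f assume f: "f \<in> R"
      have "coord m f (gen m h v \<oplus>\<^bsub>Ob T m\<^esub> y) = coord m f (gen m h v) \<oplus>\<^bsub>N\<^esub> coord m f y"
        using mod_homD(2)[OF coord_props(1)[OF m R_in[OF f]] hv add(4)] by simp
      then show "gen m f (coord m f (gen m h v \<oplus>\<^bsub>Ob T m\<^esub> y)) =
        (if r = f then gen m h v else \<zero>\<^bsub>Ob T m\<^esub>) \<oplus>\<^bsub>Ob T m\<^esub> gen m f (coord m f y)"
        using gen_props(2)[OF m R_in(1)[OF f] gc(2)[OF f hv] gc(2)[OF f add(4)]] other[OF f] by simp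
    qed (use gc add(4) hv in auto)
    also have "\<dots> = finsum (Ob T m) (\<lambda>f. if r = f then gen m h v else \<zero>\<^bsub>Ob T m\<^esub>) R \<oplus>\<^bsub>Ob T m\<^esub>
        finsum (Ob T m) (\<lambda>f. gen m f (coord m f y)) R"
      using gc add(4) hv by (intro M.M.finsum_addf) auto
    also have "finsum (Ob T m) (\<lambda>f. if r = f then gen m h v else \<zero>\<^bsub>Ob T m\<^esub>) R = gen m h v"
      using M.M.finsum_singleton[OF r R, of "\<lambda>_. gen m h v"] hv by simp
    finally show ?case using add(5) by simp
  qed
  also have "\<dots> = \<zero>\<^bsub>Ob T m\<^esub>"
  proof (rule M.M.add.finprod_one_eqI)
    fix f assume f: "f \<in> R"
    have "coord m f x = sc n \<zero> \<odot>\<^bsub>N\<^esub> \<zero>\<^bsub>N\<^esub>"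
      using z[OF R_in[OF f]] sc_closed[OF zero_closed] by simp
    then show "gen m f (coord m f x) = \<zero>\<^bsub>Ob T m\<^esub>"
      using gen_props(1,3)[OF m R_in(1)[OF f]] by simp
  qed
  finally show ?thesis .
qed

text \<open>The sum runs over all injections that \<open>d\<close> carries exactly to
  \<open>f\<close>, not over representatives. An orbit that \<open>d\<close> maps to the orbit of
  \<open>f\<close> has exactly one such member, so each orbit contributes once.\<close>

lemma coord_Mor:
  assumes m: "m \<ge> 1" and l: "l \<ge> 1" and d: "d \<in> C m l" and x: "x \<in> carrier (Ob T m)"
    and f: "f \<in> C n l" "inj_on f {1..n}"
  shows "coord l f (Mor T m l d x) =
    finsum N (\<lambda>f'. coord m f' x) {f' \<in> inj_mor m. compose {1..n} d f' = f}"
proof -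
  interpret M: lmodule k "Ob T m" by (rule lmodule_T[OF m])
  interpret Nk: lmodule k Nk by (rule lmodule_Nk)
  define U where "U = {f' \<in> inj_mor m. compose {1..n} d f' = f}"
  have U: "finite U" using finite_mor[of n m] by (simp add: U_def)
  have UD: "f' \<in> C n m" "inj_on f' {1..n}" "compose {1..n} d f' = f" if "f' \<in> U" for f'
    using that by (auto simp: U_def)
  have cc: "coord m f' y \<in> carrier N" if "f' \<in> U" "y \<in> carrier (Ob T m)" for f' y
    using mod_homD(1)[OF coord_props(1)[OF m UD(1,2)[OF that(1)]] that(2)] by simp
  note cM = mod_hom_comp[OF Mor_T_hom(1)[OF m l d] coord_props(1)[OF l f]]
  have "coord l f (Mor T m l d x) = finsum N (\<lambda>f'. coord m f' x) U"
    using m x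
  proof (induction rule: T_induct)
    case zero
    have "finsum N (\<lambda>f'. coord m f' \<zero>\<^bsub>Ob T m\<^esub>) U = \<zero>\<^bsub>N\<^esub>"
      using mod_hom_zero[OF M.left_module_axioms' Nk.left_module_axioms' coord_props(1)[OF m UD(1,2)]]
      by (intro N.M.add.finprod_one_eqI) auto
    then show ?case
      using mod_hom_zero[OF M.left_module_axioms' Nk.left_module_axioms' cM] by simp
  next
    case (add h v y)
    have hv: "gen m h v \<in> carrier (Ob T m)" using gen_props(1)[OF m add(1,3)] .
    have dh: "compose {1..n} d h \<in> C n l" using comp_closed[OF add(1) d] .
    have main: "coord l f (gen l (compose {1..n} d h) v) = finsum N (\<lambda>f'. coord m f' (gen m h v)) U"
    proof (cases "\<exists>g\<in>carrier (aut C n). compose {1..n} d h = compose {1..n} f g")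
      case True
      then obtain g where g: "g \<in> carrier (aut C n)" "compose {1..n} d h = compose {1..n} f g" by blast
      obtain g' where g': "g' \<in> carrier (aut C n)" "compose {1..n} g g' = (\<lambda>i\<in>{1..n}. i)"
        "compose {1..n} g' g = (\<lambda>i\<in>{1..n}. i)"
        using aut_inverse[OF g(1)] by blast
      note ag = aut_mem[OF g(1)] aut_mem[OF g'(1)]
      \<comment> \<open>The member of the orbit of \<open>h\<close> that \<open>d\<close> carries to
        \<open>f\<close> itself; the automorphism \<open>g\<close> that it differs by acts on
        \<open>v\<close>.\<close>
      define f1 where "f1 = compose {1..n} h g'"
      have h1: "h = compose {1..n} f1 g"
        unfolding f1_def using compose_assoc'[of g n n g' n h] ag g'(3) compose_id[OF add(1)] by simp
      have "compose {1..n} d f1 = compose {1..n} (compose {1..n} f g) g'"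
        unfolding f1_def g(2)[symmetric] using compose_assoc'[of g' n n h m d] ag add(1) by simp
      also have "\<dots> = f" using compose_assoc'[of g' n n g n f] ag g'(2) compose_id[OF f(1)] by simp
      finally have f1: "f1 \<in> U"
        using aut_comp[OF add(1) g'(1)] inj_on_compose_iff[of g' n n h] ag add(2) by (simp add: U_def f1_def)
      have "coord m f' (gen m h v) = (if f1 = f' then act g v else \<zero>\<^bsub>N\<^esub>)" if f': "f' \<in> U" for f'
      proof (cases "f1 = f'")
        case True
        then show ?thesis using coord_props(2)[OF m UD(1,2)[OF f1] add(3) g(1)] h1 by simp
      next
        case False
        have "h \<noteq> compose {1..n} f' b" if b: "b \<in> carrier (aut C n)" for b
        proof
          assume hb: "h = compose {1..n} f' b"
          then have "compose {1..n} f b = compose {1..n} f g"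
            using compose_assoc'[of b n n f' m d] aut_mem[OF b] UD[OF f'] g(2) by simp
          then have bg: "b = g" using aut_cancel[OF f] aut_mem[OF b] ag by blast
          have "f1 = compose {1..n} (compose {1..n} f' g) g'" using hb bg by (simp add: f1_def)
          then have "f1 = f'"
            using compose_assoc'[of g' n n g n f'] ag g'(2) compose_id[OF UD(1)[OF f']] by simp
          then show False using False by simp
        qed
        then show ?thesis using coord_props(4)[OF m UD(1,2)[OF f'] add(3,1)] False by simp
      qed
      then have "finsum N (\<lambda>f'. coord m f' (gen m h v)) U = finsum N (\<lambda>f'. if f1 = f' then act g v else \<zero>\<^bsub>N\<^esub>) U"
        using act_closed[OF g(1) add(3)] by (intro N.M.finsum_cong') auto
      also have "\<dots> = act g v"
        using N.M.finsum_singleton[OF f1 U, of "\<lambda>_. act g v"] act_closed[OF g(1) add(3)] by simp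
      also have "act g v = coord l f (gen l (compose {1..n} d h) v)"
        using coord_props(2)[OF l f add(3) g(1)] g(2) by simp
      finally show ?thesis by simp
    next
      case False
      then have "coord l f (gen l (compose {1..n} d h) v) = \<zero>\<^bsub>N\<^esub>"
        using coord_props(4)[OF l f add(3) dh] by blast
      moreover have "finsum N (\<lambda>f'. coord m f' (gen m h v)) U = \<zero>\<^bsub>N\<^esub>"
      proof (rule N.M.add.finprod_one_eqI)
        fix f' assume f': "f' \<in> U"
        have "h \<noteq> compose {1..n} f' b" if b: "b \<in> carrier (aut C n)" for b
          using compose_assoc'[of b n n f' m d] aut_mem[OF b] UD[OF f'] False b by metis
        then show "coord m f' (gen m h v) = \<zero>\<^bsub>N\<^esub>"
          using coord_props(4)[OF m UD(1,2)[OF f'] add(3,1)] by blast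
      qed
      ultimately show ?thesis by simp
    qed
    have "finsum N (\<lambda>f'. coord m f' (gen m h v \<oplus>\<^bsub>Ob T m\<^esub> y)) U =
      finsum N (\<lambda>f'. coord m f' (gen m h v) \<oplus>\<^bsub>N\<^esub> coord m f' y) U"
      using mod_homD(2)[OF coord_props(1)[OF m UD(1,2)] hv add(4)] cc hv add(4) by (intro N.M.finsum_cong') auto
    also have "\<dots> = finsum N (\<lambda>f'. coord m f' (gen m h v)) U \<oplus>\<^bsub>N\<^esub> finsum N (\<lambda>f'. coord m f' y) U"
      using cc hv add(4) by (intro N.M.finsum_addf) auto
    finally show ?case
      using mod_homD(2)[OF cM hv add(4)] main add(5) Mor_T_hom(2)[OF m l d add(1,3)] by simp
  qed
  then show ?thesis by (simp add: U_def)
qed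

end

section \<open>Degree \<open>n\<close>, generation from it, and elements killed by collapses\<close>

context Delta_rep
begin

lemma T_below: "1 \<le> m \<Longrightarrow> m < n \<Longrightarrow> carrier (Ob T m) = {\<zero>\<^bsub>Ob T m\<^esub>}"
proof -
  assume m: "1 \<le> m" "m < n"
  interpret M: lmodule k "Ob T m" by (rule lmodule_T[OF m(1)])
  have "x = \<zero>\<^bsub>Ob T m\<^esub>" if x: "x \<in> carrier (Ob T m)" for x
    using m(1) x by (induction rule: T_induct) (use inj_card[of _ n m] m(2) in auto)
  then show ?thesis using M.M.zero_closed by blast
qed

definition incl :: "'n \<Rightarrow> (((nat \<Rightarrow> nat) \<Rightarrow> 'k) set \<times> 'n \<Rightarrow> 'k) set" where
  "incl v = gen n (\<lambda>i\<in>{1..n}. i) v"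

lemma id_aut: "(\<lambda>i\<in>{1..n}. i) \<in> carrier (aut C n)"
  using monoid.one_closed[OF aut_monoid[of n]] by (simp add: aut_simps)

lemma incl_hom: "n \<ge> 1 \<Longrightarrow> incl \<in> mod_hom k Nk (Ob T n)"
  unfolding incl_def using gen_props[OF _ id_mem] by (intro mod_homI) auto

lemma gen_eq_incl: "n \<ge> 1 \<Longrightarrow> h \<in> carrier (aut C n) \<Longrightarrow> v \<in> carrier N \<Longrightarrow> gen n h v = incl (act h v)"
  unfolding incl_def using gen_props(4)[OF _ id_mem, of h v] id_compose[of h n n] aut_mem[of h] by simp

text \<open>Injective endomorphisms of \<open>[n]\<close> are automorphisms, and these move across
  the tensor sign, so degree \<open>n\<close> is a copy of \<open>N\<close>. The coordinate at the
  identity is a left inverse.\<close>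

lemma incl_bij:
  assumes n: "n \<ge> 1"
  shows "bij_betw incl (carrier N) (carrier (Ob T n))"
proof -
  have id: "(\<lambda>i\<in>{1..n}. i) \<in> C n n" "inj_on (\<lambda>i\<in>{1..n}. i) {1..n}"
    using aut_mem[OF id_aut] by auto
  note iD = mod_homD[OF incl_hom[OF n], simplified]
  interpret Nk: lmodule k Nk by (rule lmodule_Nk)
  interpret M: lmodule k "Ob T n" by (rule lmodule_T[OF n])
  have "inj_on incl (carrier N)"
    by (rule inj_on_inverseI[of _ "coord n (\<lambda>i\<in>{1..n}. i)"]) (simp add: incl_def coord_props(3)[OF n id])
  moreover have "x \<in> incl ` carrier N" if x: "x \<in> carrier (Ob T n)" for x
    using n x
  proof (induction rule: T_induct)
    case zero
    show ?case
      using mod_hom_zero[OF Nk.left_module_axioms' M.left_module_axioms' incl_hom[OF n]] N.M.zero_closed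
      by (metis imageI res_k_simps(2))
  next
    case (add h v z)
    then obtain w where w: "w \<in> carrier N" "z = incl w" by blast
    have h: "h \<in> carrier (aut C n)" using add by (simp add: carrier_aut)
    have "gen n h v \<oplus>\<^bsub>Ob T n\<^esub> z = incl (act h v \<oplus>\<^bsub>N\<^esub> w)"
      using gen_eq_incl[OF n h add(3)] iD(2) act_closed[OF h add(3)] w by simp
    then show ?case using act_closed[OF h add(3)] w by blast
  qed
  ultimately show ?thesis using iD(1) by (auto simp: bij_betw_def)
qed

lemma Mor_incl:
  assumes n: "n \<ge> 1" and v: "v \<in> carrier N"
  shows "h \<in> C n m \<Longrightarrow> m \<ge> 1 \<Longrightarrow> Mor T n m h (incl v) = gen m h v"
    and "h \<in> carrier (aut C n) \<Longrightarrow> Mor T n n h (incl v) = incl (act h v)"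
proof -
  show *: "Mor T n m h (incl v) = gen m h v" if "h \<in> C n m" "m \<ge> 1" for m h
    unfolding incl_def using Mor_T_hom(2)[OF n that(2,1) id_mem v] compose_id[OF that(1)] by simp
  show "h \<in> carrier (aut C n) \<Longrightarrow> Mor T n n h (incl v) = incl (act h v)"
    using *[OF _ n] gen_eq_incl[OF n _ v] aut_mem by metis
qed

text \<open>The degree \<open>n\<close> part of \<open>W\<close> pulls back to a submodule of
  \<open>N\<close> over the group algebra, hence to zero or to all of \<open>N\<close>. In the
  latter case \<open>W\<close> contains every \<open>gen m h v\<close>, since this is the image of
  \<open>incl v\<close> under \<open>h\<close>.\<close>

lemma cosimple_T:
  assumes n: "n \<ge> 1" and irr: "irreducible_module (kG n) N" and W: "csubmodule k C T W"
  shows "W n = {\<zero>\<^bsub>Ob T n\<^esub>} \<or> (\<forall>m\<ge>1. W m = carrier (Ob T m))"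
proof -
  interpret M: lmodule k "Ob T n" by (rule lmodule_T[OF n])
  note Wn = M.left_submoduleD[OF T.csubmoduleD(1)[OF W n]]
  note lN = lmodule.left_module_axioms'[OF lmodule_Nk]
  define S where "S = {v \<in> carrier Nk. incl v \<in> W n}"
  have S: "submodule S k Nk"
    unfolding S_def by (rule submodule_vimage[OF lN M.left_module_axioms' incl_hom[OF n] T.csubmoduleD(1)[OF W n]])
  have "submodule S (kG n) N"
  proof (rule kG_submoduleI[OF N.left_module_axioms' S])
    fix g v assume g: "g \<in> carrier (aut C n)" and v: "v \<in> S"
    then show "act g v \<in> S"
      using act_closed[OF g] Mor_incl(2)[OF n _ g, of v] T.csubmoduleD(2)[OF W n n, of g "incl v"] aut_mem[OF g]
      by (simp add: S_def)
  qed
  then consider "S = {\<zero>\<^bsub>N\<^esub>}" | "S = carrier N" using irr unfolding irreducible_module_def by blast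
  then show ?thesis
  proof cases
    case 1
    have "x = \<zero>\<^bsub>Ob T n\<^esub>" if x: "x \<in> W n" for x
    proof -
      obtain v where "v \<in> carrier N" "x = incl v" using x Wn(1) bij_betw_imp_surj_on[OF incl_bij[OF n]] by blast
      then have "v \<in> S" using x by (simp add: S_def)
      then show ?thesis
        using 1 \<open>x = incl v\<close> mod_hom_zero[OF lN M.left_module_axioms' incl_hom[OF n]] by simp
    qed
    then show ?thesis using Wn(2) by blast
  next
    case 2
    have "x \<in> W m" if m: "m \<ge> 1" and x: "x \<in> carrier (Ob T m)" for m x
      using m x
    proof (induction rule: T_induct)
      case zero
      show ?case using lmodule.left_submoduleD(2)[OF lmodule_T[OF m] T.csubmoduleD(1)[OF W m]] .
    next
      case (add h v z)
      have "incl v \<in> W n" using 2 add(3) by (auto simp: S_def)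
      then have "gen m h v \<in> W m" using T.csubmoduleD(2)[OF W n m add(1)] Mor_incl(1)[OF n add(3,1) m] by metis
      then show ?case using lmodule.left_submoduleD(3)[OF lmodule_T[OF m] T.csubmoduleD(1)[OF W m]] add(5) by blast
    qed
    moreover have "W m \<subseteq> carrier (Ob T m)" if "m \<ge> 1" for m
      using lmodule.left_submoduleD(1)[OF lmodule_T[OF that] T.csubmoduleD(1)[OF W that]] .
    ultimately show ?thesis by blast
  qed
qed

lemma nonzero_T:
  assumes n: "n \<ge> 1" and irr: "irreducible_module (kG n) N"
  shows "carrier (Ob T n) \<noteq> {\<zero>\<^bsub>Ob T n\<^esub>}"
proof
  assume z: "carrier (Ob T n) = {\<zero>\<^bsub>Ob T n\<^esub>}"
  have "v = \<zero>\<^bsub>N\<^esub>" if "v \<in> carrier N" for v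
  proof (rule inj_onD[OF bij_betw_imp_inj_on[OF incl_bij[OF n]] _ that N.M.zero_closed])
    show "incl v = incl \<zero>\<^bsub>N\<^esub>"
      using bij_betwE[OF incl_bij[OF n]] z that N.M.zero_closed by (metis singletonD)
  qed
  then have "carrier N = {\<zero>\<^bsub>N\<^esub>}" using N.M.zero_closed by blast
  then show False using irr unfolding irreducible_module_def by blast
qed

text \<open>An element killed by the collapse of \<open>i\<close> and \<open>i + 1\<close> has zero coordinates at injections
  missing both points, and exchanging a hit \<open>i\<close> with a missed \<open>i + 1\<close> changes the sign of its
  coordinates. If at least two points are missed, they can be made adjacent by such exchanges.\<close>

lemma collapse_imp_zero:
  assumes m: "Suc n \<le> m" and x: "x \<in> carrier (Ob T (Suc m))"
    and kill: "\<And>i. 1 \<le> i \<Longrightarrow> i \<le> m \<Longrightarrow> Mor T (Suc m) m (collapse m i) x = \<zero>\<^bsub>Ob T m\<^esub>"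
  shows "x = \<zero>\<^bsub>Ob T (Suc m)\<^esub>"
proof -
  interpret Nk: lmodule k Nk by (rule lmodule_Nk)
  have m1: "m \<ge> 1" "Suc m \<ge> 1" using m by auto
  interpret M: lmodule k "Ob T m" by (rule lmodule_T[OF m1(1)])
  \<comment> \<open>Coordinates are extended by zero to injections outside the category, so the
    exchanges below can be made without checking that they stay inside it.\<close>
  define y where "y f = (if f \<in> C n (Suc m) then coord (Suc m) f x else \<zero>\<^bsub>N\<^esub>)" for f
  have y_closed: "y f \<in> carrier N" if "inj_on f {1..n}" for f
    using mod_homD(1)[OF coord_props(1)[OF m1(2) _ that] x] by (simp add: y_def)
  have FA: "f z \<in> {1..Suc m}" if "f \<in> FA n (Suc m)" "z \<in> {1..n}" for f z
    using that by (auto simp: FA_def PiE_iff)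
  have FA_eqI: "f = f'" if "f \<in> FA n (Suc m)" "f' \<in> FA n (Suc m)" "\<And>z. z \<in> {1..n} \<Longrightarrow> f z = f' z" for f f'
    using that by (intro extensionalityI[of f "{1..n}" f']) (auto simp: FA_def PiE_iff)
  \<comment> \<open>If \<open>f\<close> does not hit both \<open>i\<close> and \<open>i + 1\<close>,
    the collapse keeps it injective, and the coordinate of the collapsed element there, which is
    zero, is the sum over the fibre by \<open>coord_Mor\<close>.\<close>
  have zero: "finsum N y {f' \<in> inj_mor (Suc m). compose {1..n} (collapse m i) f' = compose {1..n} (collapse m i) f} = \<zero>\<^bsub>N\<^esub>"
    if i: "1 \<le> i" "i \<le> m" and f: "f \<in> C n (Suc m)" "inj_on f {1..n}" and nb: "\<not> {i, Suc i} \<subseteq> f ` {1..n}" for i f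
  proof -
    let ?d = "collapse m i"
    have d: "?d \<in> C (Suc m) m" using collapse_OA[OF i] OA_subset by blast
    have df: "compose {1..n} ?d f \<in> C n m" using comp_closed[OF f(1) d] .
    have "inj_on (compose {1..n} ?d f) {1..n}"
    proof (rule inj_onI)
      fix u v assume uv: "u \<in> {1..n}" "v \<in> {1..n}" "compose {1..n} ?d f u = compose {1..n} ?d f v"
      then have "f u = f v \<or> {f u, f v} = {i, Suc i}"
        using collapse_eq_iff[OF morD(1)[OF f(1) uv(1)] morD(1)[OF f(1) uv(2)] i] by (simp add: compose_def)
      moreover have "{f u, f v} \<subseteq> f ` {1..n}" using uv by blast
      ultimately have "f u = f v" using nb by metis
      then show "u = v" using inj_onD[OF f(2)] uv by blast
    qed
    then have "finsum N (\<lambda>f'. coord (Suc m) f' x) {f' \<in> inj_mor (Suc m). compose {1..n} ?d f' = compose {1..n} ?d f} =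
      coord m (compose {1..n} ?d f) (\<zero>\<^bsub>Ob T m\<^esub>)"
      using coord_Mor[OF m1(2,1) d x df] kill[OF i] by simp
    also have "\<dots> = \<zero>\<^bsub>N\<^esub>"
      using mod_hom_zero[OF M.left_module_axioms' Nk.left_module_axioms' coord_props(1)[OF m1(1) df]]
        \<open>inj_on (compose {1..n} ?d f) {1..n}\<close> by simp
    finally have *: "finsum N (\<lambda>f'. coord (Suc m) f' x)
      {f' \<in> inj_mor (Suc m). compose {1..n} ?d f' = compose {1..n} ?d f} = \<zero>\<^bsub>N\<^esub>" .
    show ?thesis
    proof -
      let ?U = "{f' \<in> inj_mor (Suc m). compose {1..n} ?d f' = compose {1..n} ?d f}"
      have "finsum N y ?U = finsum N (\<lambda>f'. coord (Suc m) f' x) ?U"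
        using mod_homD(1)[OF coord_props(1)[OF m1(2)] x] by (intro N.M.finsum_cong') (auto simp: y_def)
      then show ?thesis using * by simp
    qed
  qed
  have fib: "f' z = f z \<or> {f' z, f z} = {i, Suc i}"
    if i: "1 \<le> i" "i \<le> m" and f: "f \<in> FA n (Suc m)" "f' \<in> FA n (Suc m)"
      and e: "compose {1..n} (collapse m i) f' = compose {1..n} (collapse m i) f" and z: "z \<in> {1..n}" for i f f' z
    using fun_cong[OF e, of z] z collapse_eq_iff[OF FA[OF f(2) z] FA[OF f(1) z] i] by (simp add: compose_def)
  \<comment> \<open>With both points missed, the fibre through \<open>f\<close> consists of
    \<open>f\<close> alone.\<close>
  have A: "y f = \<zero>\<^bsub>N\<^esub>"
    if i: "1 \<le> i" "i \<le> m" and f: "f \<in> FA n (Suc m)" "inj_on f {1..n}" and miss: "i \<notin> f ` {1..n}" "Suc i \<notin> f ` {1..n}" for i f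
  proof (cases "f \<in> C n (Suc m)")
    case True
    have "{f' \<in> inj_mor (Suc m). compose {1..n} (collapse m i) f' = compose {1..n} (collapse m i) f} = {f}"
    proof -
      have "f' = f" if f': "f' \<in> C n (Suc m)" "compose {1..n} (collapse m i) f' = compose {1..n} (collapse m i) f" for f'
      proof (rule FA_eqI[OF _ f(1)])
        show "f' \<in> FA n (Suc m)" using f' subset_FA by blast
        fix z assume z: "z \<in> {1..n}"
        then have "f z \<noteq> i" "f z \<noteq> Suc i" using miss by (metis imageI)+
        then show "f' z = f z" using fib[OF i f(1) \<open>f' \<in> FA n (Suc m)\<close> f'(2) z] by (auto simp: doubleton_eq_iff)
      qed
      then show ?thesis using True f(2) by auto
    qed
    then have "finsum N y {f} = \<zero>\<^bsub>N\<^esub>" using zero[OF i True f(2)] miss by auto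
    then show ?thesis using y_closed[OF f(2)] by simp
  qed (simp add: y_def)
  \<comment> \<open>The exchange: the point with value \<open>i\<close> is moved to the missed value
    \<open>i + 1\<close>.\<close>
  define s where "s i f = (\<lambda>z\<in>{1..n}. if f z = i then Suc i else f z)" for i and f :: "nat \<Rightarrow> nat"
  have s: "s i f \<in> FA n (Suc m)" "inj_on (s i f) {1..n}"
    if i: "1 \<le> i" "i \<le> m" and f: "f \<in> FA n (Suc m)" "inj_on f {1..n}" and miss: "Suc i \<notin> f ` {1..n}" for i f
  proof -
    show "s i f \<in> FA n (Suc m)" using FA[OF f(1)] i by (auto simp: s_def FA_def)
    show "inj_on (s i f) {1..n}"
    proof (rule inj_onI)
      fix u v assume uv: "u \<in> {1..n}" "v \<in> {1..n}" "s i f u = s i f v"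
      have "f u \<noteq> Suc i" "f v \<noteq> Suc i" using miss uv by (metis imageI)+
      then have "f u = f v" using uv by (simp add: s_def split: if_splits)
      then show "u = v" using inj_onD[OF f(2)] uv by blast
    qed
  qed
  \<comment> \<open>With only \<open>i\<close> hit, the fibre lies in \<open>{f, s i f}\<close>, so
    the two values sum to zero and vanish together.\<close>
  have B: "y f = \<zero>\<^bsub>N\<^esub>"
    if i: "1 \<le> i" "i \<le> m" and f: "f \<in> FA n (Suc m)" "inj_on f {1..n}"
      and hit: "i \<in> f ` {1..n}" and miss: "Suc i \<notin> f ` {1..n}" and ys: "y (s i f) = \<zero>\<^bsub>N\<^esub>" for i f
  proof (cases "f \<in> C n (Suc m)")
    case True
    let ?U = "{f' \<in> inj_mor (Suc m). compose {1..n} (collapse m i) f' = compose {1..n} (collapse m i) f}"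
    have sub: "f' \<in> {f, s i f}" if f': "f' \<in> ?U" for f'
    proof -
      have f'': "f' \<in> FA n (Suc m)" "compose {1..n} (collapse m i) f' = compose {1..n} (collapse m i) f"
        using f' subset_FA by auto
      obtain z0 where z0: "z0 \<in> {1..n}" "f z0 = i" using hit by auto
      have other: "f' z = f z" if "z \<in> {1..n}" "z \<noteq> z0" for z
      proof -
        have "f z \<noteq> Suc i" "f z \<noteq> i" using miss that z0 inj_onD[OF f(2), of z z0] by (metis imageI)+
        then show ?thesis using fib[OF i f(1) f'' that(1)] by (auto simp: doubleton_eq_iff)
      qed
      show ?thesis
      proof (cases "f' z0 = i")
        case True
        then have "f' z = f z" if "z \<in> {1..n}" for z using other[OF that] z0 by metis
        then have "f' = f" by (intro FA_eqI f'' f)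
        then show ?thesis by simp
      next
        case False
        then have "f' z0 = Suc i" using fib[OF i f(1) f'' z0(1)] z0 by (auto simp: doubleton_eq_iff)
        then have "f' z = s i f z" if "z \<in> {1..n}" for z
        proof (cases "z = z0")
          case True
          then show ?thesis using z0 \<open>f' z0 = Suc i\<close> by (simp add: s_def)
        next
          case False
          then have "f z \<noteq> i" using z0 inj_onD[OF f(2) _ that z0(1)] by auto
          then show ?thesis using other[OF that False] that by (simp add: s_def)
        qed
        then have "f' = s i f" by (intro FA_eqI f'' s(1)[OF i f miss])
        then show ?thesis by simp
      qed
    qed
    have "finsum N y ?U = y f"
    proof -
      have "finsum N y ?U = finsum N (\<lambda>f'. if f = f' then y f else \<zero>\<^bsub>N\<^esub>) ?U"
        using sub ys y_closed f(2) by (intro N.M.finsum_cong') auto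
      also have "\<dots> = y f"
        using True f(2) y_closed finite_mor[of n "Suc m"] N.M.finsum_singleton[of f ?U "\<lambda>_. y f"] by auto
      finally show ?thesis .
    qed
    then show ?thesis using zero[OF i True f(2)] miss by auto
  qed (simp add: y_def)
  \<comment> \<open>Induction on the gap between two missed points. If the point \<open>i\<close>
    just below the upper one is hit, the exchange makes \<open>i\<close> missed and leaves
    \<open>a\<close> missed, so the gap shrinks by one.\<close>
  have key: "y f = \<zero>\<^bsub>N\<^esub>"
    if "f \<in> FA n (Suc m)" "inj_on f {1..n}" "1 \<le> a" "Suc (a + e) \<le> Suc m" "a \<notin> f ` {1..n}" "Suc (a + e) \<notin> f ` {1..n}" for a e f
    using that
  proof (induction e arbitrary: f)
    case 0
    then show ?case by (intro A[of a f]) auto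
  next
    case (Suc e)
    define i where "i = Suc (a + e)"
    have i: "1 \<le> i" "i \<le> m" "a < i" "Suc i = Suc (a + Suc e)" using Suc.prems by (auto simp: i_def)
    show ?case
    proof (cases "i \<in> f ` {1..n}")
      case False
      then show ?thesis using Suc i by (auto simp: i_def)
    next
      case True
      have miss: "Suc i \<notin> f ` {1..n}" using Suc.prems i(4) by simp
      have "a \<notin> s i f ` {1..n}" "i \<notin> s i f ` {1..n}"
        using Suc.prems(5) i by (auto simp: s_def)
      then have "y (s i f) = \<zero>\<^bsub>N\<^esub>"
        using s[OF i(1,2) Suc.prems(1,2) miss] Suc.prems i by (intro Suc.IH) (auto simp: i_def)
      then show ?thesis using B[OF i(1,2) Suc.prems(1,2) True miss] by simp
    qed
  qed
  show ?thesis
  proof (rule coord_zero_imp_zero[OF m1(2) x])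
    fix f assume f: "f \<in> C n (Suc m)" "inj_on f {1..n}"
    have fF: "f \<in> FA n (Suc m)" using f subset_FA by blast
    have sub: "f ` {1..n} \<subseteq> {1..Suc m}" using FA[OF fF] by blast
    have "card ({1..Suc m} - f ` {1..n}) = Suc m - n"
      using card_Diff_subset[OF _ sub] card_image[OF f(2)] by simp
    \<comment> \<open>Here the degree enters: an injection of \<open>[n]\<close> into a set of at
      least \<open>n + 2\<close> points misses two of them.\<close>
    then have "2 \<le> card ({1..Suc m} - f ` {1..n})" using m by simp
    then obtain a b where ab: "{a, b} \<subseteq> {1..Suc m} - f ` {1..n}" "a \<noteq> b"
      by (metis obtain_subset_with_card_n card_2_iff)
    have "y f = \<zero>\<^bsub>N\<^esub>" if lt: "a < b" and ab: "{a, b} \<subseteq> {1..Suc m} - f ` {1..n}" for a b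
    proof -
      obtain e where "b = Suc (a + e)" using less_imp_Suc_add[OF lt] by blast
      moreover have "1 \<le> a" "b \<le> Suc m" "a \<notin> f ` {1..n}" "b \<notin> f ` {1..n}" using ab by auto
      ultimately show ?thesis using key[OF fF f(2), of a e] by blast
    qed
    from this[of a b] this[of b a] have "y f = \<zero>\<^bsub>N\<^esub>" using ab by (cases "a < b") (auto simp: insert_commute)
    then show "coord (Suc m) f x = \<zero>\<^bsub>N\<^esub>" using f by (simp add: y_def)
  qed
qed

text \<open>Consider the least degree in which the kernel is nonzero. It is not below
  \<open>n\<close>, where \<open>T\<close> is zero, nor \<open>n\<close> itself by
  \<open>tors_self\<close>. It is not above \<open>n + 1\<close> either, since collapses would then
  land in a zero kernel and \<open>collapse_imp_zero\<close> would apply.\<close>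

lemma tors_degree:
  assumes n: "n \<ge> 1" and m: "m \<ge> 1" "T.tors n m \<noteq> {\<zero>\<^bsub>Ob T m\<^esub>}"
  shows "T.tors n (n + 1) \<noteq> {\<zero>\<^bsub>Ob T (n + 1)\<^esub>}"
proof -
  define P where "P l \<longleftrightarrow> 1 \<le> l \<and> T.tors n l \<noteq> {\<zero>\<^bsub>Ob T l\<^esub>}" for l
  define l where "l = (LEAST l. P l)"
  have l: "P l" unfolding l_def using m by (intro LeastI[of P m]) (simp add: P_def)
  have small: "\<not> P r" if "r < l" for r using that not_less_Least unfolding l_def by blast
  have l1: "1 \<le> l" using l by (simp add: P_def)
  note tz = lmodule.left_submoduleD(2)[OF lmodule_T T.csubmoduleD(1)[OF T.csubmodule_tors[OF n]]]
  have "\<not> l < n"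
  proof
    assume "l < n"
    then have "T.tors n l = {\<zero>\<^bsub>Ob T l\<^esub>}" using T_below[OF l1] tz[OF l1 l1] by (auto simp: T.tors_def)
    then show False using l by (simp add: P_def)
  qed
  moreover have "l \<noteq> n" using l T.tors_self[OF n] by (auto simp: P_def)
  moreover have "\<not> n + 1 < l"
  proof
    assume gt: "n + 1 < l"
    define r where "r = l - 1"
    have r: "l = Suc r" "Suc n \<le> r" "1 \<le> r" "1 \<le> Suc r" using gt by (auto simp: r_def)
    have rz: "T.tors n r = {\<zero>\<^bsub>Ob T r\<^esub>}" using small[of r] r by (simp add: P_def)
    have "x = \<zero>\<^bsub>Ob T l\<^esub>" if x: "x \<in> T.tors n l" for x
      unfolding r(1)
    proof (rule collapse_imp_zero[OF r(2)])
      show "x \<in> carrier (Ob T (Suc r))" using x r(1) by (simp add: T.tors_def)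
      fix i assume i: "1 \<le> i" "i \<le> r"
      have "collapse r i \<in> C (Suc r) r" using collapse_OA[OF i] OA_subset by blast
      then have "Mor T (Suc r) r (collapse r i) x \<in> T.tors n r"
        using T.csubmoduleD(2)[OF T.csubmodule_tors[OF n] r(4,3)] x r(1) by blast
      then show "Mor T (Suc r) r (collapse r i) x = \<zero>\<^bsub>Ob T r\<^esub>" using rz by blast
    qed
    then have "T.tors n l = {\<zero>\<^bsub>Ob T l\<^esub>}" using tz[OF l1 l1] by blast
    then show False using l by (simp add: P_def)
  qed
  ultimately have "l = n + 1" by simp
  then show ?thesis using l by (simp add: P_def)
qed

text \<open>The Yoneda map that sends the identity of \<open>[n + 1]\<close> to \<open>y\<close>
  descends to the standard module because noninjective morphisms kill \<open>y\<close>.\<close>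

lemma hom_from_Delta:
  assumes n: "n \<ge> 1" and y: "y \<in> T.tors n (n + 1)" "y \<noteq> \<zero>\<^bsub>Ob T (n + 1)\<^esub>"
  obtains t x where "t \<in> cmod_hom k C (Delta k C (n + 1)) T" "x \<in> carrier (Ob (Delta k C (n + 1)) (n + 1))"
    "t (n + 1) x \<noteq> \<zero>\<^bsub>Ob T (n + 1)\<^esub>"
proof -
  let ?D = "Delta k C (n + 1)"
  let ?N = "n + 1"
  let ?c = "\<lambda>m \<phi>. noninj k C ?N m +>\<^bsub>free_mod k (C ?N m)\<^esub> \<phi>"
  have yc: "y \<in> carrier (Ob T ?N)" using y by (simp add: T.tors_def)
  have N1: "?N \<ge> 1" by simp
  let ?f = "\<lambda>m. free_lift (Ob T m) (\<lambda>h. Mor T ?N m h y)"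
  note lm = lmodule.left_module_axioms'[OF lmodule_T]
  have f: "?f m \<in> mod_hom k (free_mod k (C ?N m)) (Ob T m)" if "m \<ge> 1" for m
    using T.Mor_props(1)[OF N1 that] yc by (intro free_lift_hom[OF lm[OF that]]) auto
  have fs: "?f m (single k h) = Mor T ?N m h y" if "m \<ge> 1" "h \<in> C ?N m" for m h
    using T.Mor_props(1)[OF N1 that yc] by (subst free_lift_single[OF lm[OF that(1)]]) auto
  \<comment> \<open>The factorization passes through some \<open>r\<close> at most \<open>n\<close>.
    The image of \<open>y\<close> there lies in \<open>tors n r\<close>, which is zero: for
    \<open>r = n\<close> by \<open>tors_self\<close>, for smaller \<open>r\<close> since
    \<open>T\<close> is.\<close>
  have kill: "Mor T ?N m h y = \<zero>\<^bsub>Ob T m\<^esub>" if m: "m \<ge> 1" and h: "h \<in> C ?N m" "\<not> inj_on h {1..?N}" for m h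
  proof -
    obtain r p g where r: "1 \<le> r" "r < ?N" "p \<in> C ?N r" "g \<in> C r m" "h = compose {1..?N} g p"
      using noninj_factor[OF h] by metis
    have "Mor T ?N r p y \<in> T.tors n r" using T.csubmoduleD(2)[OF T.csubmodule_tors[OF n] N1 r(1,3)] y(1) .
    moreover have "T.tors n r \<subseteq> {\<zero>\<^bsub>Ob T r\<^esub>}"
      using r(2) T.tors_self[OF n] T_below[OF r(1)] by (cases "r = n") (auto simp: T.tors_def)
    ultimately have "Mor T ?N r p y = \<zero>\<^bsub>Ob T r\<^esub>" by blast
    then show ?thesis
      using T.Mor_comp[OF N1 r(1) m r(3,4) yc] T.Mor_props(4)[OF r(1) m r(4)] r(5) by simp
  qed
  have "\<exists>t\<in>mod_hom k (Ob ?D m) (Ob T m). \<forall>\<phi>\<in>fin_funs k (C ?N m). t (?c m \<phi>) = ?f m \<phi>" if m: "m \<ge> 1" for m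
  proof -
    have "?f m ` noninj k C ?N m \<subseteq> {\<zero>\<^bsub>Ob T m\<^esub>}"
      using fs[OF m] kill[OF m] by (intro noninj_image[OF lm[OF m] f[OF m] lmodule.submodule_zero[OF lmodule_T[OF m]]]) auto
    then have "\<And>w. w \<in> noninj k C ?N m \<Longrightarrow> ?f m w = \<zero>\<^bsub>Ob T m\<^esub>" by blast
    from quot_lift[OF left_module_free_mod submodule_noninj lm[OF m] f[OF m] this]
    show ?thesis unfolding Ob_Delta by (metis carrier_free_mod)
  qed
  then obtain t where t: "\<And>m. m \<ge> 1 \<Longrightarrow> t m \<in> mod_hom k (Ob ?D m) (Ob T m)"
    "\<And>m \<phi>. m \<ge> 1 \<Longrightarrow> \<phi> \<in> fin_funs k (C ?N m) \<Longrightarrow> t m (?c m \<phi>) = ?f m \<phi>"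
    by metis
  have th: "t \<in> cmod_hom k C ?D T"
    unfolding cmod_hom_def
  proof (intro CollectI conjI allI impI ballI t(1))
    fix m l :: nat and d X assume ml: "m \<ge> 1" "l \<ge> 1" "d \<in> C m l" and X: "X \<in> carrier (Ob ?D m)"
    obtain \<phi> where \<phi>: "\<phi> \<in> fin_funs k (C ?N m)" "X = ?c m \<phi>" using X by (rule Delta_cosetE)
    have "?f l (lin_ext k (compose {1..?N} d) \<phi>) = Mor T m l d (?f m \<phi>)"
    proof (rule mod_hom_free_eqI[OF lm[OF ml(2)] mod_hom_comp[OF Pmod_Mor_hom[OF ml(3)] f[OF ml(2)]]
          mod_hom_comp[OF f[OF ml(1)] Mor_T_hom(1)[OF ml]] _ \<phi>(1)])
      fix h assume h: "h \<in> C ?N m"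
      show "?f l (lin_ext k (compose {1..?N} d) (single k h)) = Mor T m l d (?f m (single k h))"
        using fs[OF ml(1) h] fs[OF ml(2) comp_closed[OF h ml(3)]] T.Mor_comp[OF N1 ml(1,2) h ml(3) yc] by simp
    qed
    moreover have "lin_ext k (compose {1..?N} d) \<phi> \<in> fin_funs k (C ?N l)"
      using mod_homD(1)[OF Pmod_Mor_hom[OF ml(3)]] \<phi>(1) by simp
    ultimately show "t l (Mor ?D m l d X) = Mor T m l d (t m X)"
      unfolding \<phi>(2) by (simp add: Mor_Delta_coset[OF ml \<phi>(1)] t(2)[OF ml(1) \<phi>(1)] t(2)[OF ml(2)])
  qed
  have "t ?N (dbasis ?N ?N (\<lambda>i\<in>{1..?N}. i)) = y"
    unfolding dbasis_def using t(2)[OF N1, of "single k (\<lambda>i\<in>{1..?N}. i)"] fs[OF N1 id_mem] T.Mor_id[OF N1 yc] id_mem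
    by simp
  then show ?thesis using that[OF th dbasis_closed[OF id_mem]] y(2) by simp
qed

end

text \<open>The map of tensor products induced by an injective \<iota> is injective: in coordinates
  it is \<iota>, and coordinates detect zero. Being natural, it carries the kernel of all morphisms
  to \<open>[n]\<close> into the corresponding kernel.\<close>

lemma tors_functorial:
  assumes "Delta_rep k C n N" "Delta_rep k C n N'"
    and n: "n \<ge> 1" and m: "m \<ge> 1"
    and \<iota>: "\<iota> \<in> mod_hom (group_algebra k (aut C n)) N N'" and inj: "\<And>v. v \<in> carrier N \<Longrightarrow> \<iota> v = \<zero>\<^bsub>N'\<^esub> \<Longrightarrow> v = \<zero>\<^bsub>N\<^esub>"
    and ne: "cat_module.tors C (Delta_tensor k C n N) n m \<noteq> {\<zero>\<^bsub>Ob (Delta_tensor k C n N) m\<^esub>}"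
  shows "cat_module.tors C (Delta_tensor k C n N') n m \<noteq> {\<zero>\<^bsub>Ob (Delta_tensor k C n N') m\<^esub>}"
proof -
  interpret D: Delta_rep k C n N by fact
  interpret D': Delta_rep k C n N' by fact
  note \<iota>D = mod_homD[OF \<iota>]
  have \<iota>k: "\<iota> \<in> mod_hom k D.Nk D'.Nk"
    using \<iota>D D.sc_closed by (intro mod_homI) auto
  have "\<exists>u\<in>mod_hom k (Ob D.T m) (Ob D'.T m). \<forall>h\<in>C n m. \<forall>v\<in>carrier N. u (D.gen m h v) = D'.gen m h (\<iota> v)" if m: "m \<ge> 1" for m
  proof -
    interpret t: tensor_data k "D.kG n" "Ob D.\<Delta> m" N "Delta_ract k C n m" by (rule D.tensor_data[OF m])
    interpret t': tensor_data k "D.kG n" "Ob D.\<Delta> m" N' "Delta_ract k C n m" by (rule D'.tensor_data[OF m])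
    obtain u where u: "u \<in> mod_hom k t.T t'.T" "\<And>X v. X \<in> carrier (Ob D.\<Delta> m) \<Longrightarrow> v \<in> carrier N \<Longrightarrow> u (t.tens X v) = t'.tens X (\<iota> v)"
      using t.tensor_lift[OF t'.T.left_module_axioms', of "\<lambda>X v. t'.tens X (\<iota> v)"]
        t'.tens_add_left t'.tens_add_right t'.tens_smult t'.tens_balanced t'.tens_closed \<iota>D
      by (smt (verit, ccfv_threshold))
    then show ?thesis
      using D.dbasis_closed by (intro bexI[of _ u]) (auto simp: D.Ob_T D'.Ob_T D.gen_def D'.gen_def)
  qed
  then obtain u where u: "\<And>m. m \<ge> 1 \<Longrightarrow> u m \<in> mod_hom k (Ob D.T m) (Ob D'.T m)"
    "\<And>m h v. m \<ge> 1 \<Longrightarrow> h \<in> C n m \<Longrightarrow> v \<in> carrier N \<Longrightarrow> u m (D.gen m h v) = D'.gen m h (\<iota> v)"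
    by metis
  note lm = lmodule.left_module_axioms'[OF D.lmodule_T] and lm' = lmodule.left_module_axioms'[OF D'.lmodule_T]
  obtain x where x: "x \<in> D.T.tors n m" "x \<noteq> \<zero>\<^bsub>Ob D.T m\<^esub>"
    using ne lmodule.left_submoduleD(2)[OF D.lmodule_T D.T.csubmoduleD(1)[OF D.T.csubmodule_tors[OF n]], OF m m] by blast
  have xc: "x \<in> carrier (Ob D.T m)" using x by (simp add: D.T.tors_def)
  have Mor: "u n (Mor D.T m n d x) = Mor D'.T m n d (u m x)" if d: "d \<in> C m n" for d
  proof (rule D.T_hom_eqI[OF m lm'[OF n] mod_hom_comp[OF D.Mor_T_hom(1)[OF m n d] u(1)[OF n]]
        mod_hom_comp[OF u(1)[OF m] D'.Mor_T_hom(1)[OF m n d]] _ xc])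
    fix h v assume h: "h \<in> C n m" and v: "v \<in> carrier N"
    show "u n (Mor D.T m n d (D.gen m h v)) = Mor D'.T m n d (u m (D.gen m h v))"
      using D.Mor_T_hom(2)[OF m n d h v] D'.Mor_T_hom(2)[OF m n d h] \<iota>D(1)[OF v] u(2)[OF m h v]
        u(2)[OF n D.comp_closed[OF h d] v] by simp
  qed
  have "u m x \<in> D'.T.tors n m"
    using x(1) Mor mod_homD(1)[OF u(1)[OF m] xc] mod_hom_zero[OF lm[OF n] lm'[OF n] u(1)[OF n]]
    by (simp add: D.T.tors_def D'.T.tors_def)
  moreover have "u m x \<noteq> \<zero>\<^bsub>Ob D'.T m\<^esub>"
  proof
    assume z: "u m x = \<zero>\<^bsub>Ob D'.T m\<^esub>"
    have "D.coord m f x = \<zero>\<^bsub>N\<^esub>" if f: "f \<in> C n m" "inj_on f {1..n}" for f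
    proof -
      note c = D.coord_props[OF m f] and c' = D'.coord_props[OF m f]
      note lk = lmodule.left_module_axioms'[OF D.lmodule_Nk] lmodule.left_module_axioms'[OF D'.lmodule_Nk]
      have "\<iota> (D.coord m f x) = D'.coord m f (u m x)"
      proof (rule D.T_hom_eqI[OF m lk(2) mod_hom_comp[OF c(1) \<iota>k] mod_hom_comp[OF u(1)[OF m] c'(1)] _ xc])
        fix h v assume h: "h \<in> C n m" and v: "v \<in> carrier N"
        show "\<iota> (D.coord m f (D.gen m h v)) = D'.coord m f (u m (D.gen m h v))"
        proof (cases "\<exists>g\<in>carrier (aut C n). h = compose {1..n} f g")
          case True
          then show ?thesis
            using c(2)[OF v] c'(2)[OF \<iota>D(1)[OF v]] \<iota>D(3)[OF D.single_kG v] u(2)[OF m h v] by auto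
        next
          case False
          then show ?thesis
            using c(4)[OF v h] c'(4)[OF \<iota>D(1)[OF v] h] u(2)[OF m h v] mod_hom_zero[OF lk \<iota>k] by auto
        qed
      qed
      also have "\<dots> = \<zero>\<^bsub>N'\<^esub>" using z mod_hom_zero[OF lm'[OF m] lk(2) c'(1)] by simp
      finally show ?thesis using inj mod_homD(1)[OF c(1) xc] by simp
    qed
    then show False using D.coord_zero_imp_zero[OF m xc] x(2) by blast
  qed
  ultimately show ?thesis by blast
qed

section \<open>Irreducible modules over a ring\<close>

lemma left_ideal_of_simps:
  "carrier (left_ideal_of A e) = {a \<otimes>\<^bsub>A\<^esub> e | a. a \<in> carrier A}"
  "\<zero>\<^bsub>left_ideal_of A e\<^esub> = \<zero>\<^bsub>A\<^esub>" "add (left_ideal_of A e) = add A" "smult (left_ideal_of A e) = mult A"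
  by (simp_all add: left_ideal_of_def)

lemma left_module_left_ideal_of:
  assumes "ring A" and e: "e \<in> carrier A"
  shows "left_module A (left_ideal_of A e)"
proof -
  interpret A: ring A by fact
  have "abelian_group (left_ideal_of A e)"
  proof (rule abelian_groupI)
    fix x y assume "x \<in> carrier (left_ideal_of A e)" "y \<in> carrier (left_ideal_of A e)"
    then obtain a b where "a \<in> carrier A" "b \<in> carrier A" "x = a \<otimes>\<^bsub>A\<^esub> e" "y = b \<otimes>\<^bsub>A\<^esub> e"
      by (auto simp: left_ideal_of_simps)
    then show "x \<oplus>\<^bsub>left_ideal_of A e\<^esub> y \<in> carrier (left_ideal_of A e)"
      using e by (auto simp: left_ideal_of_simps A.l_distr intro!: exI[of _ "a \<oplus>\<^bsub>A\<^esub> b"])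
  next
    show "\<zero>\<^bsub>left_ideal_of A e\<^esub> \<in> carrier (left_ideal_of A e)"
      using e by (auto simp: left_ideal_of_simps intro!: exI[of _ "\<zero>\<^bsub>A\<^esub>"])
  next
    fix x assume "x \<in> carrier (left_ideal_of A e)"
    then obtain a where "a \<in> carrier A" "x = a \<otimes>\<^bsub>A\<^esub> e" by (auto simp: left_ideal_of_simps)
    then show "\<exists>y\<in>carrier (left_ideal_of A e). y \<oplus>\<^bsub>left_ideal_of A e\<^esub> x = \<zero>\<^bsub>left_ideal_of A e\<^esub>"
      using e by (intro bexI[of _ "(\<ominus>\<^bsub>A\<^esub> a) \<otimes>\<^bsub>A\<^esub> e"])
        (auto simp: left_ideal_of_simps A.l_minus A.l_neg intro!: exI[of _ "\<ominus>\<^bsub>A\<^esub> a"])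
  qed (use e in \<open>auto simp: left_ideal_of_simps A.a_ac\<close>)
  then interpret M: abelian_group "left_ideal_of A e" .
  have carr: "x \<in> carrier A" if "x \<in> carrier (left_ideal_of A e)" for x
    using that e by (auto simp: left_ideal_of_simps(1))
  show ?thesis
  proof unfold_locales
    fix a x assume a: "a \<in> carrier A" and x: "x \<in> carrier (left_ideal_of A e)"
    then obtain b where b: "b \<in> carrier A" "x = b \<otimes>\<^bsub>A\<^esub> e" by (auto simp: left_ideal_of_simps(1))
    then have "a \<otimes>\<^bsub>A\<^esub> x = (a \<otimes>\<^bsub>A\<^esub> b) \<otimes>\<^bsub>A\<^esub> e" using a e by (simp add: A.m_assoc)
    then show "a \<odot>\<^bsub>left_ideal_of A e\<^esub> x \<in> carrier (left_ideal_of A e)"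
      using a b by (auto simp: left_ideal_of_simps)
  qed (simp_all add: left_ideal_of_simps(2-) carr A.l_distr A.r_distr A.m_assoc)
qed

lemma irreducible_nonzero:
  assumes "irreducible_module A M"
  obtains w where "w \<in> carrier M" "w \<noteq> \<zero>\<^bsub>M\<^esub>"
proof -
  interpret M: lmodule A M using assms by (auto simp: irreducible_module_def intro: lmodule.intro)
  show ?thesis using assms that M.M.zero_closed unfolding irreducible_module_def by blast
qed

text \<open>Schur's lemma: the kernel is a submodule and does not contain \<open>w\<close>.\<close>

lemma irreducible_hom_inj:
  assumes M: "irreducible_module A M" and N: "left_module A N" and f: "f \<in> mod_hom A M N"
    and w: "w \<in> carrier M" "f w \<noteq> \<zero>\<^bsub>N\<^esub>" and v: "v \<in> carrier M" "f v = \<zero>\<^bsub>N\<^esub>"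
  shows "v = \<zero>\<^bsub>M\<^esub>"
proof -
  have lM: "left_module A M" using M by (simp add: irreducible_module_def)
  interpret N: lmodule A N by (rule lmodule.intro) fact
  have "submodule {x \<in> carrier M. f x \<in> {\<zero>\<^bsub>N\<^esub>}} A M"
    by (rule submodule_vimage[OF lM N f N.submodule_zero])
  then have "{x \<in> carrier M. f x \<in> {\<zero>\<^bsub>N\<^esub>}} = {\<zero>\<^bsub>M\<^esub>} \<or> {x \<in> carrier M. f x \<in> {\<zero>\<^bsub>N\<^esub>}} = carrier M"
    using M unfolding irreducible_module_def by blast
  moreover have "{x \<in> carrier M. f x \<in> {\<zero>\<^bsub>N\<^esub>}} \<noteq> carrier M" using w by blast
  ultimately show ?thesis using v by blast
qed

lemma irreducible_mod_iso:
  assumes Q: "left_module A Q" and N: "irreducible_module A N"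
    and f: "f \<in> mod_hom A Q N" "bij_betw f (carrier Q) (carrier N)"
  shows "irreducible_module A Q"
proof -
  interpret Q: lmodule A Q by (rule lmodule.intro) fact
  have lN: "left_module A N" using N by (simp add: irreducible_module_def)
  note fz = mod_hom_zero[OF Q lN f(1)]
  have inj: "inj_on f (carrier Q)" and im: "f ` carrier Q = carrier N"
    using f(2) by (auto simp: bij_betw_def)
  have "W = {\<zero>\<^bsub>Q\<^esub>} \<or> W = carrier Q" if W: "submodule W A Q" for W
  proof -
    note WQ = Q.left_submoduleD(1)[OF W]
    have "f ` W = f ` {\<zero>\<^bsub>Q\<^esub>} \<or> f ` W = f ` carrier Q"
      using N submodule_image[OF Q lN f(1) W] im fz unfolding irreducible_module_def by simp
    then show ?thesis
      using inj_on_image_eq_iff[OF inj WQ, of "{\<zero>\<^bsub>Q\<^esub>}"] inj_on_image_eq_iff[OF inj WQ subset_refl] Q.M.zero_closed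
      by blast
  qed
  moreover have "carrier Q \<noteq> {\<zero>\<^bsub>Q\<^esub>}"
    using N im fz unfolding irreducible_module_def by force
  ultimately show ?thesis using Q by (auto simp: irreducible_module_def)
qed

text \<open>The test modules in the definition of completeness suffice: an irreducible module is the
  quotient of \<open>A\<close> by the annihilator of a nonzero element.\<close>

lemma complete_irreducibles_iso:
  fixes A :: "'a ring" and N :: "('a, 'v) module"
  assumes S: "complete_irreducibles A S" and N: "irreducible_module A N"
  obtains M where "M \<in> S" "mod_iso A N M"
proof -
  interpret N: lmodule A N using N by (auto simp: irreducible_module_def intro: lmodule.intro)
  obtain w where w: "w \<in> carrier N" "w \<noteq> \<zero>\<^bsub>N\<^esub>" using irreducible_nonzero[OF N] .
  \<comment> \<open>The ring as a left module over itself; its quotients have elements of type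
    \<open>'a set\<close>, the type of the test modules.\<close>
  let ?P = "left_ideal_of A \<one>\<^bsub>A\<^esub>"
  have P: "left_module A ?P" by (rule left_module_left_ideal_of) (auto intro: N.R.ring_axioms)
  interpret P: lmodule A ?P by (rule lmodule.intro) (rule P)
  have carr: "carrier ?P = carrier A" by (force simp: left_ideal_of_simps)
  define f where "f = (\<lambda>a. a \<odot>\<^bsub>N\<^esub> w)"
  have f: "f \<in> mod_hom A ?P N"
    using w unfolding f_def
    by (intro mod_homI) (auto simp only: carr left_ideal_of_simps(2-) N.smult_closed N.smult_l_distr N.smult_assoc)
  define I where "I = {a \<in> carrier ?P. f a \<in> {\<zero>\<^bsub>N\<^esub>}}"
  have I: "submodule I A ?P"
    unfolding I_def by (rule submodule_vimage[OF P N.left_module_axioms' f N.submodule_zero])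
  let ?Q = "quot_mod ?P I"
  obtain h where h: "h \<in> mod_hom A ?Q N" "\<And>a. a \<in> carrier ?P \<Longrightarrow> h (I +>\<^bsub>?P\<^esub> a) = f a"
    using quot_lift[OF P I N.left_module_axioms' f] by (auto simp: I_def)
  have "inj_on h (carrier ?Q)"
  proof (rule inj_onI)
    fix X Y assume "X \<in> carrier ?Q" "Y \<in> carrier ?Q" and eq: "h X = h Y"
    then obtain a b where ab: "a \<in> carrier ?P" "b \<in> carrier ?P" "X = I +>\<^bsub>?P\<^esub> a" "Y = I +>\<^bsub>?P\<^esub> b"
      by (auto simp: P.carrier_quot_mod)
    then have "f a = f b" using eq h(2) by simp
    then have "a \<ominus>\<^bsub>?P\<^esub> b \<in> I"
      using ab mod_hom_minus[OF P N.left_module_axioms' f] mod_homD(1)[OF f] by (simp add: I_def N.diff_eq_zero_iff)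
    then show "X = Y" using P.coset_eq_iff[OF I ab(1,2)] ab(3,4) by simp
  qed
  moreover have "h ` carrier ?Q = carrier N"
  proof -
    have lQ: "left_module A ?Q" by (rule P.left_module_quot_mod[OF I])
    have "submodule (h ` carrier ?Q) A N"
      by (rule submodule_image[OF lQ N.left_module_axioms' h(1) lmodule.submodule_carrier[OF lmodule.intro[OF lQ]]])
    moreover have "w \<in> h ` carrier ?Q"
      using h(2)[of "\<one>\<^bsub>A\<^esub>"] w N.smult_one by (force simp: P.carrier_quot_mod f_def carr)
    ultimately show ?thesis using N w unfolding irreducible_module_def by blast
  qed
  ultimately have bij: "bij_betw h (carrier ?Q) (carrier N)" by (simp add: bij_betw_def)
  have lQ: "left_module A ?Q" by (rule P.left_module_quot_mod[OF I])
  obtain M where M: "M \<in> S" "mod_iso A ?Q M"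
    using S irreducible_mod_iso[OF lQ N h(1) bij] unfolding complete_irreducibles_def by blast
  obtain g where g: "g \<in> mod_hom A ?Q M" "bij_betw g (carrier ?Q) (carrier M)"
    using M(2) by (auto simp: mod_iso_def)
  have "(\<lambda>x. g (inv_into (carrier ?Q) h x)) \<in> mod_hom A N M"
    by (rule mod_hom_comp[OF mod_hom_inv_into[OF lmodule.intro[OF lQ] h(1) bij] g(1)])
  moreover have "bij_betw (\<lambda>x. g (inv_into (carrier ?Q) h x)) (carrier N) (carrier M)"
    using bij_betw_trans[OF bij_betw_inv_into[OF bij] g(2)] by (simp add: comp_def)
  ultimately show ?thesis using that M(1) unfolding mod_iso_def by blast
qed

section \<open>Embedding an irreducible module into its projective cover\<close>

text \<open>By Zorn's lemma there is a submodule \<open>L\<close> maximal among those avoiding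
  \<open>w\<close>. It is a complement of the line through \<open>w\<close>, and the functional
  reads off the component along \<open>w\<close>. No basis or dimension enters.\<close>

lemma (in scalar_field) functional_exists:
  fixes V :: "('k, 'v) module"
  assumes V: "left_module k V" and w: "w \<in> carrier V" "w \<noteq> \<zero>\<^bsub>V\<^esub>"
  obtains \<phi> where "\<And>v. v \<in> carrier V \<Longrightarrow> \<phi> v \<in> carrier k"
    and "\<And>u v. u \<in> carrier V \<Longrightarrow> v \<in> carrier V \<Longrightarrow> \<phi> (u \<oplus>\<^bsub>V\<^esub> v) = \<phi> u \<oplus> \<phi> v"
    and "\<And>c v. c \<in> carrier k \<Longrightarrow> v \<in> carrier V \<Longrightarrow> \<phi> (c \<odot>\<^bsub>V\<^esub> v) = c \<otimes> \<phi> v"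
    and "\<phi> w = \<one>"
proof -
  interpret V: lmodule k V by (rule lmodule.intro) fact
  define S where "S = {L. submodule L k V \<and> w \<notin> L}"
  have "\<exists>L\<in>S. \<forall>X\<in>S. L \<subseteq> X \<longrightarrow> X = L"
  proof (rule subset_Zorn_nonempty)
    show "S \<noteq> {}" using V.submodule_zero w by (auto simp: S_def)
    fix X assume X: "X \<noteq> {}" "subset.chain S X"
    have sub: "submodule L k V" "w \<notin> L" if "L \<in> X" for L
      using X(2) that by (auto simp: S_def subset_chain_def)
    have "submodule (\<Union>X) k V"
    proof (rule V.left_submoduleI)
      show "\<Union>X \<subseteq> carrier V" using V.left_submoduleD(1)[OF sub(1)] by blast
      show "\<zero>\<^bsub>V\<^esub> \<in> \<Union>X" using V.left_submoduleD(2)[OF sub(1)] X(1) by blast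
      show "c \<odot>\<^bsub>V\<^esub> x \<in> \<Union>X" if "c \<in> carrier k" "x \<in> \<Union>X" for c x
        using V.left_submoduleD(4)[OF sub(1) that(1)] that(2) by blast
      fix x y assume "x \<in> \<Union>X" "y \<in> \<Union>X"
      then obtain L L' where L: "L \<in> X" "x \<in> L" "L' \<in> X" "y \<in> L'" by blast
      then have "L \<subseteq> L' \<or> L' \<subseteq> L" using X(2) by (auto simp: subset_chain_def)
      then show "x \<oplus>\<^bsub>V\<^esub> y \<in> \<Union>X"
        using L V.left_submoduleD(3)[OF sub(1)[OF L(1)]] V.left_submoduleD(3)[OF sub(1)[OF L(3)]] by blast
    qed
    then show "\<Union>X \<in> S" using sub(2) by (auto simp: S_def)
  qed
  then obtain L where L: "submodule L k V" "w \<notin> L"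
    and max: "\<And>X. submodule X k V \<Longrightarrow> w \<notin> X \<Longrightarrow> L \<subseteq> X \<Longrightarrow> X = L"
    unfolding S_def by blast
  note LD = V.left_submoduleD[OF L(1)]
  \<comment> \<open>The line and \<open>L\<close> together span: for \<open>v\<close> outside
    \<open>L\<close>, maximality puts \<open>w\<close> into the sum \<open>X\<close> of
    \<open>L\<close> and the line through \<open>v\<close>, and the equation can be solved for
    \<open>v\<close>.\<close>
  have ex: "\<exists>c\<in>carrier k. v \<oplus>\<^bsub>V\<^esub> c \<odot>\<^bsub>V\<^esub> w \<in> L" if v: "v \<in> carrier V" for v
  proof (cases "v \<in> L")
    case True
    then show ?thesis using v w by (intro bexI[of _ \<zero>]) auto
  next
    case False
    define X where "X = {l \<oplus>\<^bsub>V\<^esub> a \<odot>\<^bsub>V\<^esub> v | l a. l \<in> L \<and> a \<in> carrier k}"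
    have XI: "l \<oplus>\<^bsub>V\<^esub> a \<odot>\<^bsub>V\<^esub> v \<in> X" if "l \<in> L" "a \<in> carrier k" for l a using that by (auto simp: X_def)
    have Lc: "l \<in> carrier V" if "l \<in> L" for l using that LD(1) by blast
    have "submodule X k V"
    proof (rule V.left_submoduleI)
      show "X \<subseteq> carrier V" using Lc v by (auto simp: X_def V.smult_closed)
      show "\<zero>\<^bsub>V\<^esub> \<in> X" using XI[OF LD(2) zero_closed] v by simp
      show "x \<oplus>\<^bsub>V\<^esub> y \<in> X" if xy: "x \<in> X" "y \<in> X" for x y
      proof -
        obtain l a l' a' where *: "l \<in> L" "a \<in> carrier k" "l' \<in> L" "a' \<in> carrier k"
          "x = l \<oplus>\<^bsub>V\<^esub> a \<odot>\<^bsub>V\<^esub> v" "y = l' \<oplus>\<^bsub>V\<^esub> a' \<odot>\<^bsub>V\<^esub> v"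
          using xy by (auto simp: X_def)
        then have "x \<oplus>\<^bsub>V\<^esub> y = (l \<oplus>\<^bsub>V\<^esub> l') \<oplus>\<^bsub>V\<^esub> (a \<oplus> a') \<odot>\<^bsub>V\<^esub> v"
          using Lc v by (simp add: V.smult_l_distr V.smult_closed V.M.a_ac)
        then show ?thesis using XI[OF LD(3)] * by simp
      qed
      show "c \<odot>\<^bsub>V\<^esub> x \<in> X" if c: "c \<in> carrier k" "x \<in> X" for c x
      proof -
        obtain l a where *: "l \<in> L" "a \<in> carrier k" "x = l \<oplus>\<^bsub>V\<^esub> a \<odot>\<^bsub>V\<^esub> v"
          using c by (auto simp: X_def)
        then have "c \<odot>\<^bsub>V\<^esub> x = c \<odot>\<^bsub>V\<^esub> l \<oplus>\<^bsub>V\<^esub> (c \<otimes> a) \<odot>\<^bsub>V\<^esub> v"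
          using Lc v c by (simp add: V.smult_r_distr V.smult_closed V.smult_assoc)
        then show ?thesis using XI[OF LD(4)] * c by simp
      qed
    qed
    moreover have "L \<subseteq> X"
    proof
      fix l assume "l \<in> L"
      then show "l \<in> X" using XI[of l \<zero>] v Lc by simp
    qed
    moreover have "X \<noteq> L" using XI[OF LD(2) one_closed] v False by (auto simp: V.smult_one)
    ultimately have "w \<in> X" using max by blast
    then obtain l a where la: "l \<in> L" "a \<in> carrier k" "w = l \<oplus>\<^bsub>V\<^esub> a \<odot>\<^bsub>V\<^esub> v" by (auto simp: X_def)
    have "a \<noteq> \<zero>" using la L(2) Lc v by auto
    then have a: "a \<in> Units k" using la(2) field_Units by simp
    then have ia: "inv a \<in> carrier k" "inv a \<otimes> a = \<one>" by auto
    have "v \<oplus>\<^bsub>V\<^esub> (\<ominus> (inv a)) \<odot>\<^bsub>V\<^esub> w = (\<ominus> (inv a)) \<odot>\<^bsub>V\<^esub> l"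
    proof -
      have "(\<ominus> (inv a)) \<odot>\<^bsub>V\<^esub> w = (\<ominus> (inv a)) \<odot>\<^bsub>V\<^esub> l \<oplus>\<^bsub>V\<^esub> ((\<ominus> (inv a)) \<otimes> a) \<odot>\<^bsub>V\<^esub> v"
        unfolding la(3) using la ia Lc v by (simp add: V.smult_r_distr V.smult_closed V.smult_assoc)
      also have "((\<ominus> (inv a)) \<otimes> a) \<odot>\<^bsub>V\<^esub> v = \<ominus>\<^bsub>V\<^esub> v"
        using ia la(2) v by (simp add: l_minus V.smult_minus_one)
      finally show ?thesis
        using v ia Lc[OF la(1)] V.smult_closed[of "\<ominus> (inv a)" l]
        by (simp add: V.M.a_ac V.M.r_neg)
          (metis V.M.a_assoc V.M.a_comm V.M.a_inv_closed V.M.r_neg V.M.r_zero)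
    qed
    then show ?thesis using LD(4)[of "\<ominus> (inv a)" l] ia la(1) by (intro bexI[of _ "\<ominus> (inv a)"]) auto
  qed
  \<comment> \<open>Two different values of \<open>c\<close> would put a nonzero multiple of
    \<open>w\<close>, hence \<open>w\<close>, into \<open>L\<close>.\<close>
  have uniq: "c = c'" if c: "c \<in> carrier k" "c' \<in> carrier k" and v: "v \<in> carrier V"
    and L1: "v \<oplus>\<^bsub>V\<^esub> c \<odot>\<^bsub>V\<^esub> w \<in> L" "v \<oplus>\<^bsub>V\<^esub> c' \<odot>\<^bsub>V\<^esub> w \<in> L" for c c' v
  proof (rule ccontr)
    assume "c \<noteq> c'"
    then have nz: "c \<ominus> c' \<noteq> \<zero>" using c by (metis add.inv_solve_right' l_zero minus_eq zero_closed)
    then have a: "c \<ominus> c' \<in> Units k" using c field_Units by simp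
    have "(v \<oplus>\<^bsub>V\<^esub> c \<odot>\<^bsub>V\<^esub> w) \<oplus>\<^bsub>V\<^esub> (\<ominus> \<one>) \<odot>\<^bsub>V\<^esub> (v \<oplus>\<^bsub>V\<^esub> c' \<odot>\<^bsub>V\<^esub> w) \<in> L"
      using L1 LD(3,4) by simp
    also have "(\<ominus> \<one>) \<odot>\<^bsub>V\<^esub> (v \<oplus>\<^bsub>V\<^esub> c' \<odot>\<^bsub>V\<^esub> w) = \<ominus>\<^bsub>V\<^esub> v \<oplus>\<^bsub>V\<^esub> (\<ominus> c') \<odot>\<^bsub>V\<^esub> w"
      using v w c V.smult_assoc[of "\<ominus> \<one>" c' w] by (simp add: V.smult_r_distr V.smult_closed V.smult_minus_one l_minus)
    also have "(v \<oplus>\<^bsub>V\<^esub> c \<odot>\<^bsub>V\<^esub> w) \<oplus>\<^bsub>V\<^esub> (\<ominus>\<^bsub>V\<^esub> v \<oplus>\<^bsub>V\<^esub> (\<ominus> c') \<odot>\<^bsub>V\<^esub> w) =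
        (v \<oplus>\<^bsub>V\<^esub> \<ominus>\<^bsub>V\<^esub> v) \<oplus>\<^bsub>V\<^esub> (c \<odot>\<^bsub>V\<^esub> w \<oplus>\<^bsub>V\<^esub> (\<ominus> c') \<odot>\<^bsub>V\<^esub> w)"
      using v w c by (simp add: V.smult_closed V.M.a_ac)
    also have "\<dots> = (c \<ominus> c') \<odot>\<^bsub>V\<^esub> w"
      using v w c by (simp add: V.smult_closed V.M.r_neg V.smult_l_distr minus_eq)
    finally have "inv (c \<ominus> c') \<odot>\<^bsub>V\<^esub> ((c \<ominus> c') \<odot>\<^bsub>V\<^esub> w) \<in> L" using LD(4) a by simp
    moreover have "inv (c \<ominus> c') \<odot>\<^bsub>V\<^esub> ((c \<ominus> c') \<odot>\<^bsub>V\<^esub> w) = w"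
      using a w c V.smult_assoc[of "inv (c \<ominus> c')" "c \<ominus> c'" w] by (simp add: V.smult_one)
    ultimately show False using L(2) by simp
  qed
  \<comment> \<open>This is minus the component along \<open>w\<close>, which explains the sign in
    the functional supplied below.\<close>
  define \<psi> where "\<psi> v = (THE c. c \<in> carrier k \<and> v \<oplus>\<^bsub>V\<^esub> c \<odot>\<^bsub>V\<^esub> w \<in> L)" for v
  have \<psi>: "\<psi> v \<in> carrier k" "v \<oplus>\<^bsub>V\<^esub> \<psi> v \<odot>\<^bsub>V\<^esub> w \<in> L" if v: "v \<in> carrier V" for v
  proof -
    have "\<exists>!c. c \<in> carrier k \<and> v \<oplus>\<^bsub>V\<^esub> c \<odot>\<^bsub>V\<^esub> w \<in> L" using ex[OF v] uniq[OF _ _ v] by blast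
    from theI'[OF this] show "\<psi> v \<in> carrier k" "v \<oplus>\<^bsub>V\<^esub> \<psi> v \<odot>\<^bsub>V\<^esub> w \<in> L" by (simp_all add: \<psi>_def)
  qed
  have \<psi>_eq: "\<psi> v = c" if "v \<in> carrier V" "c \<in> carrier k" "v \<oplus>\<^bsub>V\<^esub> c \<odot>\<^bsub>V\<^esub> w \<in> L" for v c
    using uniq[OF \<psi>(1) that(2,1) \<psi>(2)] that by blast
  show ?thesis
  proof (rule that[of "\<lambda>v. \<ominus> \<psi> v"])
    show "\<ominus> \<psi> v \<in> carrier k" if "v \<in> carrier V" for v using \<psi>(1)[OF that] by simp
    show "\<ominus> \<psi> (u \<oplus>\<^bsub>V\<^esub> v) = \<ominus> \<psi> u \<oplus> \<ominus> \<psi> v" if u: "u \<in> carrier V" and v: "v \<in> carrier V" for u v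
    proof -
      have "(u \<oplus>\<^bsub>V\<^esub> \<psi> u \<odot>\<^bsub>V\<^esub> w) \<oplus>\<^bsub>V\<^esub> (v \<oplus>\<^bsub>V\<^esub> \<psi> v \<odot>\<^bsub>V\<^esub> w) \<in> L" using \<psi> u v LD(3) by blast
      also have "(u \<oplus>\<^bsub>V\<^esub> \<psi> u \<odot>\<^bsub>V\<^esub> w) \<oplus>\<^bsub>V\<^esub> (v \<oplus>\<^bsub>V\<^esub> \<psi> v \<odot>\<^bsub>V\<^esub> w) = (u \<oplus>\<^bsub>V\<^esub> v) \<oplus>\<^bsub>V\<^esub> (\<psi> u \<oplus> \<psi> v) \<odot>\<^bsub>V\<^esub> w"
        using u v w \<psi>(1)[OF u] \<psi>(1)[OF v] by (simp add: V.smult_closed V.smult_l_distr V.M.a_ac)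
      finally have "\<psi> (u \<oplus>\<^bsub>V\<^esub> v) = \<psi> u \<oplus> \<psi> v" using u v \<psi>(1) by (intro \<psi>_eq) auto
      then show ?thesis using \<psi>(1)[OF u] \<psi>(1)[OF v] by (simp add: minus_add)
    qed
    show "\<ominus> \<psi> (c \<odot>\<^bsub>V\<^esub> v) = c \<otimes> \<ominus> \<psi> v" if c: "c \<in> carrier k" and v: "v \<in> carrier V" for c v
    proof -
      have "c \<odot>\<^bsub>V\<^esub> (v \<oplus>\<^bsub>V\<^esub> \<psi> v \<odot>\<^bsub>V\<^esub> w) \<in> L" using \<psi> v c LD(4) by blast
      also have "c \<odot>\<^bsub>V\<^esub> (v \<oplus>\<^bsub>V\<^esub> \<psi> v \<odot>\<^bsub>V\<^esub> w) = c \<odot>\<^bsub>V\<^esub> v \<oplus>\<^bsub>V\<^esub> (c \<otimes> \<psi> v) \<odot>\<^bsub>V\<^esub> w"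
        using v w c \<psi>(1)[OF v] by (simp add: V.smult_closed V.smult_r_distr V.smult_assoc)
      finally have "\<psi> (c \<odot>\<^bsub>V\<^esub> v) = c \<otimes> \<psi> v" using v c \<psi>(1) V.smult_closed by (intro \<psi>_eq) auto
      then show ?thesis using \<psi>(1)[OF v] c by (simp add: r_minus)
    qed
    have "w \<oplus>\<^bsub>V\<^esub> (\<ominus> \<one>) \<odot>\<^bsub>V\<^esub> w \<in> L" using w LD(2) by (simp add: V.smult_minus_one V.M.r_neg)
    then have "\<psi> w = \<ominus> \<one>" using w by (intro \<psi>_eq) auto
    then show "\<ominus> \<psi> w = \<one>" by simp
  qed
qed

context cat_rep
begin

text \<open>Multiplication by a group element translates coefficients. Both sides are linear in
  \<open>a\<close>, so basis elements suffice.\<close>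

lemma conv_single:
  assumes a: "a \<in> carrier (kG n)" and h: "h \<in> carrier (aut C n)" and g: "g \<in> carrier (aut C n)"
  shows "(single k h \<otimes>\<^bsub>kG n\<^esub> a) g = a (inv\<^bsub>aut C n\<^esub> h \<otimes>\<^bsub>aut C n\<^esub> g)"
    and "(a \<otimes>\<^bsub>kG n\<^esub> single k h) g = a (g \<otimes>\<^bsub>aut C n\<^esub> inv\<^bsub>aut C n\<^esub> h)"
proof -
  interpret G: group "aut C n" by (rule group_aut)
  let ?F = "free_mod k (carrier (aut C n))"
  \<comment> \<open>The field as a module over itself, so that evaluation at a group element is a
    homomorphism of modules.\<close>
  define kk :: "('k, 'k) module" where "kk = \<lparr>carrier = carrier k, mult = undefined, one = undefined, zero = \<zero>, add = add k, smult = mult k\<rparr>"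
  have ab: "abelian_group kk"
    by (intro abelian_groupI) (auto simp: kk_def a_ac intro: l_neg bexI[of _ "\<ominus> _"] dest: add.l_inv_ex)
  have lk: "left_module k kk"
    using ab ring_axioms
    by (auto simp: left_module_def left_module_axioms_def) (auto simp: kk_def l_distr r_distr m_ac)
  have ev: "(\<lambda>a. a x) \<in> mod_hom k ?F kk" for x
    by (intro mod_homI) (auto simp: kk_def free_mod_simps fin_funsD(1)[of _ "carrier (aut C n)"])
  note a' = fin_funs_aut[OF a]
  have mult1: "(\<lambda>a. single k h \<otimes>\<^bsub>kG n\<^esub> a) \<in> mod_hom k ?F ?F"
    unfolding group_algebra_simps using h by (intro bilin_ext_hom2[of _ "carrier (aut C n)"]) auto
  have mult2: "(\<lambda>a. a \<otimes>\<^bsub>kG n\<^esub> single k h) \<in> mod_hom k ?F ?F"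
    unfolding group_algebra_simps using h by (intro bilin_ext_hom[of _ "carrier (aut C n)"]) auto
  show "(single k h \<otimes>\<^bsub>kG n\<^esub> a) g = a (inv\<^bsub>aut C n\<^esub> h \<otimes>\<^bsub>aut C n\<^esub> g)"
  proof (rule mod_hom_free_eqI[OF lk mod_hom_comp[OF mult1 ev] ev _ a'])
    fix b assume b: "b \<in> carrier (aut C n)"
    have "g = h \<otimes>\<^bsub>aut C n\<^esub> b \<longleftrightarrow> inv\<^bsub>aut C n\<^esub> h \<otimes>\<^bsub>aut C n\<^esub> g = b"
      using b h g G.inv_solve_left'[of b h g] by auto
    then show "(single k h \<otimes>\<^bsub>kG n\<^esub> single k b) g = single k b (inv\<^bsub>aut C n\<^esub> h \<otimes>\<^bsub>aut C n\<^esub> g)"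
      by (simp add: group_algebra_simps) (simp add: single_def)
  qed
  show "(a \<otimes>\<^bsub>kG n\<^esub> single k h) g = a (g \<otimes>\<^bsub>aut C n\<^esub> inv\<^bsub>aut C n\<^esub> h)"
  proof (rule mod_hom_free_eqI[OF lk mod_hom_comp[OF mult2 ev] ev _ a'])
    fix b assume b: "b \<in> carrier (aut C n)"
    have "g = b \<otimes>\<^bsub>aut C n\<^esub> h \<longleftrightarrow> g \<otimes>\<^bsub>aut C n\<^esub> inv\<^bsub>aut C n\<^esub> h = b"
      using b h g G.inv_solve_right'[of b g h] by auto
    then show "(single k b \<otimes>\<^bsub>kG n\<^esub> single k h) g = single k b (g \<otimes>\<^bsub>aut C n\<^esub> inv\<^bsub>aut C n\<^esub> h)"
      by (simp add: group_algebra_simps) (simp add: single_def)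
  qed
qed

text \<open>Since \<open>kG\<close> is a symmetric algebra, \<open>\<lambda>\<close> is a submodule of the projective cover \<open>kG e\<close>. A
  functional \<open>\<phi>\<close> on \<open>\<lambda>\<close> gives the homomorphism that sends \<open>v\<close> to \<open>\<Sum> \<phi> (g\<inverse> v) g e\<close>; the
  coefficient of 1 in the image of \<open>v\<close> is \<open>\<phi> (e v)\<close>, and this is not zero for a suitable \<open>v\<close>.\<close>

lemma embed_in_cover:
  assumes lam: "irreducible_module (kG n) lam" and e: "covering_idempotent (kG n) lam e"
  obtains \<iota> where "\<iota> \<in> mod_hom (kG n) lam (left_ideal_of (kG n) e)"
    "\<And>v. v \<in> carrier lam \<Longrightarrow> \<iota> v = \<zero>\<^bsub>left_ideal_of (kG n) e\<^esub> \<Longrightarrow> v = \<zero>\<^bsub>lam\<^esub>"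
proof -
  let ?G = "aut C n"
  let ?P = "left_ideal_of (kG n) e"
  interpret G: group ?G by (rule group_aut)
  interpret R: ring "kG n" by (rule ring_kG)
  interpret lam: lmodule "kG n" lam using lam by (auto simp: irreducible_module_def intro: lmodule.intro)
  note lres = left_module_res_k[OF lam.left_module_axioms']
  have ec: "e \<in> carrier (kG n)" "e \<otimes>\<^bsub>kG n\<^esub> e = e"
    using e by (auto simp: covering_idempotent_def primitive_idempotent_def)
  obtain \<pi> where \<pi>: "\<pi> \<in> mod_hom (kG n) ?P lam" "\<pi> ` carrier ?P = carrier lam"
    using e by (auto simp: covering_idempotent_def projective_cover_def)
  note lP = left_module_left_ideal_of[OF ring_kG ec(1)]
  have eP: "e \<in> carrier ?P" using ec by (auto simp: left_ideal_of_simps intro!: exI[of _ e])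
  \<comment> \<open>The image of the generator \<open>e\<close> of the cover. It is nonzero since
    \<pi> is onto a nonzero module, and \<open>e\<close> fixes it.\<close>
  define w where "w = \<pi> e"
  have w: "w \<in> carrier lam" using mod_homD(1)[OF \<pi>(1) eP] by (simp add: w_def)
  have ew: "e \<odot>\<^bsub>lam\<^esub> w = w"
    using mod_homD(3)[OF \<pi>(1) ec(1) eP] ec(2) by (simp add: w_def left_ideal_of_simps)
  have w0: "w \<noteq> \<zero>\<^bsub>lam\<^esub>"
  proof
    assume z: "w = \<zero>\<^bsub>lam\<^esub>"
    have "\<pi> x = \<zero>\<^bsub>lam\<^esub>" if x: "x \<in> carrier ?P" for x
    proof -
      obtain a where a: "a \<in> carrier (kG n)" "x = a \<otimes>\<^bsub>kG n\<^esub> e" using x by (auto simp: left_ideal_of_simps)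
      then show ?thesis using mod_homD(3)[OF \<pi>(1) a(1) eP] z by (simp add: w_def left_ideal_of_simps)
    qed
    then have "carrier lam \<subseteq> {\<zero>\<^bsub>lam\<^esub>}" using \<pi>(2) by force
    then show False using irreducible_nonzero[OF lam] by blast
  qed
  obtain \<phi> where \<phi>: "\<And>v. v \<in> carrier lam \<Longrightarrow> \<phi> v \<in> carrier k"
    "\<And>u v. u \<in> carrier lam \<Longrightarrow> v \<in> carrier lam \<Longrightarrow> \<phi> (u \<oplus>\<^bsub>lam\<^esub> v) = \<phi> u \<oplus> \<phi> v"
    "\<And>c v. c \<in> carrier k \<Longrightarrow> v \<in> carrier lam \<Longrightarrow> \<phi> (sc n c \<odot>\<^bsub>lam\<^esub> v) = c \<otimes> \<phi> v" "\<phi> w = \<one>"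
    using functional_exists[OF lres, of w] w w0 by (metis res_k_simps)
  let ?act = "\<lambda>g v. single k g \<odot>\<^bsub>lam\<^esub> v"
  have actc: "?act g v \<in> carrier lam" if "g \<in> carrier ?G" "v \<in> carrier lam" for g v
    using that lam.smult_closed single_kG by blast
  \<comment> \<open>The group algebra element whose coefficient at \<open>g\<close> is \<phi> of the
    inverse of \<open>g\<close> applied to \<open>v\<close>. Using the inverse makes
    \<open>A\<close> equivariant for left multiplication.\<close>
  define A where "A v = (\<lambda>g. if g \<in> carrier ?G then \<phi> (?act (inv\<^bsub>?G\<^esub> g) v) else \<zero>)" for v
  have A: "A v \<in> carrier (kG n)" if v: "v \<in> carrier lam" for v
  proof -
    have "finite {g. A v g \<noteq> \<zero>}" by (rule finite_subset[OF _ finite_aut[of n]]) (auto simp: A_def)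
    then show ?thesis using \<phi>(1) actc v by (auto simp: group_algebra_simps fin_funs_def A_def)
  qed
  have A_add: "A (u \<oplus>\<^bsub>lam\<^esub> v) = A u \<oplus>\<^bsub>kG n\<^esub> A v" if "u \<in> carrier lam" "v \<in> carrier lam" for u v
    using that actc single_kG by (auto simp: A_def group_algebra_simps(4) \<phi>(2) lam.smult_r_distr)
  have A_sc: "A (sc n c \<odot>\<^bsub>lam\<^esub> v) = sc n c \<otimes>\<^bsub>kG n\<^esub> A v" if c: "c \<in> carrier k" and v: "v \<in> carrier lam" for c v
  proof
    fix g
    have "?act h (sc n c \<odot>\<^bsub>lam\<^esub> v) = sc n c \<odot>\<^bsub>lam\<^esub> (?act h v)" if h: "h \<in> carrier ?G" for h
      using lam.smult_assoc[OF single_kG[OF h] sc_closed[OF c] v] lam.smult_assoc[OF sc_closed[OF c] single_kG[OF h] v]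
        sc_mult[OF c single_kG[OF h]] by simp
    then show "A (sc n c \<odot>\<^bsub>lam\<^esub> v) g = (sc n c \<otimes>\<^bsub>kG n\<^esub> A v) g"
      unfolding sc_mult(1)[OF c A[OF v]] using actc v c \<phi>(3) by (simp add: A_def)
  qed
  have A_act: "A (?act h v) = single k h \<otimes>\<^bsub>kG n\<^esub> A v" if h: "h \<in> carrier ?G" and v: "v \<in> carrier lam" for h v
  proof
    fix g
    have m: "single k h \<otimes>\<^bsub>kG n\<^esub> A v \<in> fin_funs k (carrier ?G)"
      using fin_funs_aut[OF R.m_closed[OF single_kG[OF h] A[OF v]]] .
    show "A (?act h v) g = (single k h \<otimes>\<^bsub>kG n\<^esub> A v) g"
    proof (cases "g \<in> carrier ?G")
      case True
      have "?act (inv\<^bsub>?G\<^esub> g) (?act h v) = ?act (inv\<^bsub>?G\<^esub> g \<otimes>\<^bsub>?G\<^esub> h) v"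
        using lam.smult_assoc[OF single_kG[of "inv\<^bsub>?G\<^esub> g"] single_kG[OF h] v] True by (simp add: group_algebra_simps)
      moreover have "inv\<^bsub>?G\<^esub> (inv\<^bsub>?G\<^esub> h \<otimes>\<^bsub>?G\<^esub> g) = inv\<^bsub>?G\<^esub> g \<otimes>\<^bsub>?G\<^esub> h"
        using True h by (simp add: G.inv_mult_group)
      ultimately show ?thesis
        unfolding conv_single(1)[OF A[OF v] h True] using True h by (simp add: A_def)
    next
      case False
      then have "(single k h \<otimes>\<^bsub>kG n\<^esub> A v) g = \<zero>" using fin_funsD(3)[OF m, of g] by blast
      then show ?thesis using False by (simp add: A_def)
    qed
  qed
  define \<iota> where "\<iota> v = A v \<otimes>\<^bsub>kG n\<^esub> e" for v
  have \<iota>: "\<iota> \<in> mod_hom (kG n) lam ?P"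
  proof (rule kG_homI[OF lam.left_module_axioms' lP])
    show "\<iota> \<in> mod_hom k (res_k n lam) (res_k n ?P)"
      using A A_add A_sc ec sc_closed
      by (intro mod_homI) (auto simp: \<iota>_def left_ideal_of_simps R.l_distr R.m_assoc)
    show "\<iota> (?act g v) = single k g \<odot>\<^bsub>?P\<^esub> \<iota> v" if "g \<in> carrier ?G" "v \<in> carrier lam" for g v
      using A_act[OF that] A[OF that(2)] single_kG[OF that(1)] ec(1) by (simp add: \<iota>_def left_ideal_of_simps R.m_assoc)
  qed
  \<comment> \<open>For \<open>b\<close> a group element \<open>g\<close>, the coefficient of 1 in
    \<open>A w\<close> times \<open>g\<close> is that of \<open>A w\<close> at the inverse of
    \<open>g\<close>, namely \<phi> of \<open>g\<close> applied to \<open>w\<close>. Taking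
    \<open>b = e\<close>, which fixes \<open>w\<close>, gives the value 1, so the image of
    \<open>w\<close> is nonzero and irreducibility yields injectivity.\<close>
  have trace: "(A w \<otimes>\<^bsub>kG n\<^esub> b) \<one>\<^bsub>?G\<^esub> = \<phi> (b \<odot>\<^bsub>lam\<^esub> w)" if b: "b \<in> carrier (kG n)" for b
    using b
  proof (induction rule: kG_induct)
    case zero
    have "\<phi> \<zero>\<^bsub>lam\<^esub> = \<zero>" using \<phi>(2)[of "\<zero>\<^bsub>lam\<^esub>" "\<zero>\<^bsub>lam\<^esub>"] \<phi>(1)[of "\<zero>\<^bsub>lam\<^esub>"] by (simp add: add.l_cancel_one')
    then show ?case using A[OF w] w by (simp add: R.r_null) (simp add: group_algebra_simps)
  next
    case (add c g b)
    note gk = single_kG[OF add(2)]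
    have "(A w \<otimes>\<^bsub>kG n\<^esub> (sc n c \<otimes>\<^bsub>kG n\<^esub> single k g)) = sc n c \<otimes>\<^bsub>kG n\<^esub> (A w \<otimes>\<^bsub>kG n\<^esub> single k g)"
      using R.m_assoc[OF A[OF w] sc_closed[OF add(1)] gk] R.m_assoc[OF sc_closed[OF add(1)] A[OF w] gk]
        sc_mult[OF add(1) A[OF w]] by simp
    also have "\<dots> = (\<lambda>x. c \<otimes> (A w \<otimes>\<^bsub>kG n\<^esub> single k g) x)"
      using sc_mult(1)[OF add(1) R.m_closed[OF A[OF w] gk]] .
    finally have 1: "(A w \<otimes>\<^bsub>kG n\<^esub> (sc n c \<otimes>\<^bsub>kG n\<^esub> single k g)) \<one>\<^bsub>?G\<^esub> = c \<otimes> \<phi> (?act g w)"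
      using conv_single(2)[OF A[OF w] add(2) G.one_closed] add(2) by (simp add: A_def)
    have "(A w \<otimes>\<^bsub>kG n\<^esub> (sc n c \<otimes>\<^bsub>kG n\<^esub> single k g \<oplus>\<^bsub>kG n\<^esub> b)) \<one>\<^bsub>?G\<^esub> = c \<otimes> \<phi> (?act g w) \<oplus> \<phi> (b \<odot>\<^bsub>lam\<^esub> w)"
      using A[OF w] sc_closed[OF add(1)] gk add(3,4) 1
      by (simp add: R.r_distr) (simp add: group_algebra_simps(4))
    also have "\<dots> = \<phi> ((sc n c \<otimes>\<^bsub>kG n\<^esub> single k g \<oplus>\<^bsub>kG n\<^esub> b) \<odot>\<^bsub>lam\<^esub> w)"
      using sc_closed[OF add(1)] gk add(1,3) w actc[OF add(2) w]
      by (simp add: lam.smult_l_distr lam.smult_assoc lam.smult_closed \<phi>(2,3))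
    finally show ?case .
  qed
  have "\<iota> w \<noteq> \<zero>\<^bsub>?P\<^esub>"
  proof
    assume "\<iota> w = \<zero>\<^bsub>?P\<^esub>"
    then have "(A w \<otimes>\<^bsub>kG n\<^esub> e) \<one>\<^bsub>?G\<^esub> = \<zero>" by (simp add: \<iota>_def left_ideal_of_simps group_algebra_simps(2))
    then show False using trace[OF ec(1)] ew \<phi>(4) by simp
  qed
  then show ?thesis using that[OF \<iota>] irreducible_hom_inj[OF lam lP \<iota> w] by blast
qed

text \<open>The kernel for \<lambda> is brought down to degree \<open>n + 1\<close> before it is
  transported along the embedding into the cover, where its nonzero elements give homomorphisms from
  the next standard module.\<close>

lemma tors_imp_singular:
  assumes n: "n \<ge> 1" and lam: "irreducible_module (kG n) lam" and e: "covering_idempotent (kG n) lam e"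
    and m: "m \<ge> 1" and ne: "cat_module.tors C (Delta_bar k C n lam) n m \<noteq> {\<zero>\<^bsub>Ob (Delta_bar k C n lam) m\<^esub>}"
  shows "singular k C n e"
proof -
  let ?P = "left_ideal_of (kG n) e"
  have lP: "left_module (kG n) ?P"
    using e by (intro left_module_left_ideal_of ring_kG) (auto simp: covering_idempotent_def primitive_idempotent_def)
  have D: "Delta_rep k C n lam" "Delta_rep k C n ?P"
    using lam lP cat_rep_axioms by (auto simp: Delta_rep_def irreducible_module_def intro: lmodule.intro)
  interpret P: Delta_rep k C n ?P by (rule D(2))
  obtain \<iota> where \<iota>: "\<iota> \<in> mod_hom (kG n) lam ?P" "\<And>v. v \<in> carrier lam \<Longrightarrow> \<iota> v = \<zero>\<^bsub>?P\<^esub> \<Longrightarrow> v = \<zero>\<^bsub>lam\<^esub>"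
    by (rule embed_in_cover[OF lam e]) blast
  have N1: "n + 1 \<ge> 1" by simp
  have "P.T.tors n (n + 1) \<noteq> {\<zero>\<^bsub>Ob P.T (n + 1)\<^esub>}"
    by (rule tors_functorial[OF D n N1 \<iota> Delta_rep.tors_degree[OF D(1) n m ne]])
  then obtain y where y: "y \<in> P.T.tors n (n + 1)" "y \<noteq> \<zero>\<^bsub>Ob P.T (n + 1)\<^esub>"
    using lmodule.left_submoduleD(2)[OF P.lmodule_T P.T.csubmoduleD(1)[OF P.T.csubmodule_tors[OF n]], OF N1 N1] by blast
  from P.hom_from_Delta[OF n this] show ?thesis
    unfolding singular_def Delta_proj_def using N1 by metis
qed

end

section \<open>The classification\<close>

context cat_module
begin

text \<open>The group algebra acts through the automorphisms of \<open>[n]\<close>, extended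
  linearly. This allows degree \<open>n\<close> of \<open>V\<close> to be compared with the given
  irreducible modules; \<open>deg_sc\<close> shows that restriction to the field returns the
  original scalars.\<close>

definition deg_module :: "nat \<Rightarrow> ((nat \<Rightarrow> nat) \<Rightarrow> 'k, 'v) module" where
  "deg_module n = \<lparr>carrier = carrier (Ob V n), mult = undefined, one = undefined, zero = zero (Ob V n),
     add = add (Ob V n), smult = (\<lambda>a v. free_lift (Ob V n) (\<lambda>g. Mor V n n g v) a)\<rparr>"

lemma deg_module_simps:
  "carrier (deg_module n) = carrier (Ob V n)" "zero (deg_module n) = zero (Ob V n)"
  "add (deg_module n) = add (Ob V n)"
  "smult (deg_module n) a v = free_lift (Ob V n) (\<lambda>g. Mor V n n g v) a"
  by (simp_all add: deg_module_def)

context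
  fixes n :: nat
  assumes n: "n \<ge> 1"
begin

lemma Mor_aut_closed: "g \<in> carrier (aut C n) \<Longrightarrow> v \<in> carrier (Ob V n) \<Longrightarrow> Mor V n n g v \<in> carrier (Ob V n)"
  using Mor_props(1)[OF n n] aut_mem by blast

lemma deg_hom:
  "v \<in> carrier (Ob V n) \<Longrightarrow>
   (\<lambda>a. a \<odot>\<^bsub>deg_module n\<^esub> v) \<in> mod_hom k (free_mod k (carrier (aut C n))) (Ob V n)"
  unfolding deg_module_simps using free_lift_hom[OF left_module_Ob[OF n], of "carrier (aut C n)"] Mor_aut_closed by simp

lemma deg_single:
  "g \<in> carrier (aut C n) \<Longrightarrow> v \<in> carrier (Ob V n) \<Longrightarrow> single k g \<odot>\<^bsub>deg_module n\<^esub> v = Mor V n n g v"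
  unfolding deg_module_simps by (rule free_lift_single[OF left_module_Ob[OF n]]) (rule Mor_aut_closed)

lemma left_module_deg: "left_module (kG n) (deg_module n)"
proof -
  interpret M: lmodule k "Ob V n" by (rule lmodule_Ob[OF n])
  interpret R: ring "kG n" by (rule ring_kG)
  interpret G: group "aut C n" by (rule group_aut)
  let ?F = "free_mod k (carrier (aut C n))"
  note lm = left_module_Ob[OF n]
  note hD = mod_homD[OF deg_hom]
  have "abelian_group (deg_module n)"
    by (intro abelian_groupI) (auto simp: deg_module_simps M.M.a_ac dest: M.M.add.l_inv_ex)
  then interpret D: abelian_group "deg_module n" .
  have add_v: "a \<odot>\<^bsub>deg_module n\<^esub> (v \<oplus>\<^bsub>Ob V n\<^esub> w) = a \<odot>\<^bsub>deg_module n\<^esub> v \<oplus>\<^bsub>Ob V n\<^esub> a \<odot>\<^bsub>deg_module n\<^esub> w"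
    if a: "a \<in> carrier (kG n)" and vw: "v \<in> carrier (Ob V n)" "w \<in> carrier (Ob V n)" for a v w
  proof (rule mod_hom_free_eqI[OF lm deg_hom _ _ fin_funs_aut[OF a]])
    show "v \<oplus>\<^bsub>Ob V n\<^esub> w \<in> carrier (Ob V n)" using vw by simp
    show "(\<lambda>a. a \<odot>\<^bsub>deg_module n\<^esub> v \<oplus>\<^bsub>Ob V n\<^esub> a \<odot>\<^bsub>deg_module n\<^esub> w) \<in> mod_hom k ?F (Ob V n)"
      using hD[OF vw(1)] hD[OF vw(2)] by (intro mod_homI) (auto simp: M.M.a_ac M.smult_r_distr)
    fix g assume g: "g \<in> carrier (aut C n)"
    show "single k g \<odot>\<^bsub>deg_module n\<^esub> (v \<oplus>\<^bsub>Ob V n\<^esub> w) =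
      single k g \<odot>\<^bsub>deg_module n\<^esub> v \<oplus>\<^bsub>Ob V n\<^esub> single k g \<odot>\<^bsub>deg_module n\<^esub> w"
      using deg_single[OF g] vw Mor_props(2)[OF n n, of g v w] aut_mem[OF g] by simp
  qed
  have assoc: "(a \<otimes>\<^bsub>kG n\<^esub> b) \<odot>\<^bsub>deg_module n\<^esub> v = a \<odot>\<^bsub>deg_module n\<^esub> (b \<odot>\<^bsub>deg_module n\<^esub> v)"
    if a: "a \<in> carrier (kG n)" and b: "b \<in> carrier (kG n)" and v: "v \<in> carrier (Ob V n)" for a b v
  proof -
    have mult1: "(\<lambda>b. single k h \<otimes>\<^bsub>kG n\<^esub> b) \<in> mod_hom k ?F ?F" if "h \<in> carrier (aut C n)" for h
      unfolding group_algebra_simps using that by (intro bilin_ext_hom2[of _ "carrier (aut C n)"]) auto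
    have mult2: "(\<lambda>a. a \<otimes>\<^bsub>kG n\<^esub> b) \<in> mod_hom k ?F ?F"
      unfolding group_algebra_simps by (intro bilin_ext_hom[OF fin_funs_aut[OF b]]) auto
    have 1: "(single k h \<otimes>\<^bsub>kG n\<^esub> b) \<odot>\<^bsub>deg_module n\<^esub> v = Mor V n n h (b \<odot>\<^bsub>deg_module n\<^esub> v)"
      if h: "h \<in> carrier (aut C n)" for h
    proof (rule mod_hom_free_eqI[OF lm mod_hom_comp[OF mult1[OF h] deg_hom[OF v]]
          mod_hom_comp[OF deg_hom[OF v] Mor_hom[OF n n]] _ fin_funs_aut[OF b]])
      show "h \<in> C n n" using aut_mem[OF h] by blast
      fix g assume g: "g \<in> carrier (aut C n)"
      show "(single k h \<otimes>\<^bsub>kG n\<^esub> single k g) \<odot>\<^bsub>deg_module n\<^esub> v = Mor V n n h (single k g \<odot>\<^bsub>deg_module n\<^esub> v)"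
        using deg_single[OF _ v] G.m_closed[OF h g] g v Mor_comp[OF n n n, of g h v] aut_mem[OF g] aut_mem[OF h]
        by (simp add: single_mult_kG aut_simps)
    qed
    have bv: "b \<odot>\<^bsub>deg_module n\<^esub> v \<in> carrier (Ob V n)" using hD(1)[OF v] fin_funs_aut[OF b] by simp
    show ?thesis
      using mod_hom_free_eqI[OF lm mod_hom_comp[OF mult2 deg_hom[OF v]] deg_hom[OF bv] _ fin_funs_aut[OF a]]
        1 deg_single[OF _ bv] by simp
  qed
  show ?thesis
  proof unfold_locales
    show "a \<odot>\<^bsub>deg_module n\<^esub> x \<in> carrier (deg_module n)" if "a \<in> carrier (kG n)" "x \<in> carrier (deg_module n)" for a x
      using hD(1)[of x a] that fin_funs_aut by (simp add: deg_module_simps(1))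
    show "(a \<oplus>\<^bsub>kG n\<^esub> b) \<odot>\<^bsub>deg_module n\<^esub> x = a \<odot>\<^bsub>deg_module n\<^esub> x \<oplus>\<^bsub>deg_module n\<^esub> b \<odot>\<^bsub>deg_module n\<^esub> x"
      if "a \<in> carrier (kG n)" "b \<in> carrier (kG n)" "x \<in> carrier (deg_module n)" for a b x
      using hD(2)[of x a b] that fin_funs_aut by (simp add: deg_module_simps(1,3) free_mod_simps group_algebra_simps(4))
    show "\<one>\<^bsub>kG n\<^esub> \<odot>\<^bsub>deg_module n\<^esub> x = x" if "x \<in> carrier (deg_module n)" for x
      using deg_single[OF G.one_closed, of x] that Mor_id[OF n, of x]
      by (simp add: deg_module_simps(1) group_algebra_simps(3) aut_simps)
  qed (use add_v assoc in \<open>simp_all add: deg_module_simps(1,3)\<close>)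
qed

lemma deg_sc: "c \<in> carrier k \<Longrightarrow> v \<in> carrier (Ob V n) \<Longrightarrow> sc n c \<odot>\<^bsub>deg_module n\<^esub> v = c \<odot>\<^bsub>Ob V n\<^esub> v"
proof -
  assume c: "c \<in> carrier k" and v: "v \<in> carrier (Ob V n)"
  interpret D: lmodule "kG n" "deg_module n" by (rule lmodule.intro) (rule left_module_deg)
  have "sc n c = c \<odot>\<^bsub>free_mod k (carrier (aut C n))\<^esub> \<one>\<^bsub>kG n\<^esub>" by (simp add: sc_def free_mod_simps)
  then show ?thesis
    using mod_homD(3)[OF deg_hom[OF v] c, of "\<one>\<^bsub>kG n\<^esub>"] one_kG_closed D.smult_one[of v] v
    by (simp add: deg_module_simps(1))
qed

text \<open>Such a morphism factors through a smaller object, where \<open>V\<close> is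
  zero.\<close>

lemma noninj_kills:
  assumes below: "\<And>m. 1 \<le> m \<Longrightarrow> m < n \<Longrightarrow> carrier (Ob V m) = {\<zero>\<^bsub>Ob V m\<^esub>}"
    and h: "h \<in> C n l" "\<not> inj_on h {1..n}" and l: "l \<ge> 1" and x: "x \<in> carrier (Ob V n)"
  shows "Mor V n l h x = \<zero>\<^bsub>Ob V l\<^esub>"
proof -
  obtain r p g where r: "1 \<le> r" "r < n" "p \<in> C n r" "g \<in> C r l" "h = compose {1..n} g p"
    using noninj_factor[OF h] by metis
  have "Mor V n r p x = \<zero>\<^bsub>Ob V r\<^esub>" using Mor_props(1)[OF n r(1,3) x] below[OF r(1,2)] by blast
  then show ?thesis using Mor_comp[OF n r(1) l r(3,4) x] Mor_props(4)[OF r(1) l r(4)] r(5) by simp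
qed

text \<open>A submodule of degree \<open>n\<close> must come from a submodule of \<open>V\<close>.
  In the lowest nonzero degree noninjective endomorphisms act by zero, so the action of the group
  controls that of all endomorphisms.\<close>

lemma irreducible_deg:
  assumes irr: "irreducible_cmodule k C V" and ne: "carrier (Ob V n) \<noteq> {\<zero>\<^bsub>Ob V n\<^esub>}"
    and below: "\<And>m. 1 \<le> m \<Longrightarrow> m < n \<Longrightarrow> carrier (Ob V m) = {\<zero>\<^bsub>Ob V m\<^esub>}"
  shows "irreducible_module (kG n) (deg_module n)"
proof -
  interpret D: lmodule "kG n" "deg_module n" by (rule lmodule.intro) (rule left_module_deg)
  interpret N: lmodule k "Ob V n" by (rule lmodule_Ob[OF n])
  have "S = {\<zero>\<^bsub>deg_module n\<^esub>} \<or> S = carrier (deg_module n)" if S: "submodule S (kG n) (deg_module n)" for S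
  proof -
    note SD = D.left_submoduleD[OF S, unfolded deg_module_simps(1-3)]
    have Sk: "submodule S k (Ob V n)"
      using SD deg_sc sc_closed by (intro N.left_submoduleI) (auto dest: subsetD simp flip: deg_sc)
    \<comment> \<open>The largest submodule of \<open>V\<close> whose degree \<open>n\<close> part
      lies in \<open>S\<close>; it meets degree \<open>n\<close> in exactly
      \<open>S\<close>.\<close>
    define W where "W m = {x \<in> carrier (Ob V m). \<forall>h\<in>C m n. Mor V m n h x \<in> S}" for m
    have W: "csubmodule k C V W"
    proof (rule csubmoduleI)
      fix m :: nat assume m: "m \<ge> 1"
      interpret M: lmodule k "Ob V m" by (rule lmodule_Ob[OF m])
      note S' = N.left_submoduleD[OF Sk]
      show "W m \<subseteq> carrier (Ob V m)" by (auto simp: W_def)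
      show "\<zero>\<^bsub>Ob V m\<^esub> \<in> W m" using Mor_props(4)[OF m n] S' by (auto simp: W_def)
      show "x \<oplus>\<^bsub>Ob V m\<^esub> y \<in> W m" if "x \<in> W m" "y \<in> W m" for x y
        using that Mor_props(2)[OF m n] S' by (auto simp: W_def)
      show "c \<odot>\<^bsub>Ob V m\<^esub> x \<in> W m" if "c \<in> carrier k" "x \<in> W m" for c x
        using that Mor_props(3)[OF m n] S' by (auto simp: W_def M.smult_closed)
      show "Mor V m l f x \<in> W l" if "l \<ge> 1" "f \<in> C m l" "x \<in> W m" for l f x
        using that Mor_comp[OF m that(1) n that(2)] Mor_props(1)[OF m that(1,2)] comp_closed[OF that(2)]
        by (auto simp: W_def)
    qed
    have "W n = S"
    proof
      show "W n \<subseteq> S" using id_mem[of n] Mor_id[OF n] by (auto simp: W_def)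
      show "S \<subseteq> W n"
      proof
        fix x assume x: "x \<in> S"
        then have xc: "x \<in> carrier (Ob V n)" using SD(1) by blast
        have "Mor V n n h x \<in> S" if h: "h \<in> C n n" for h
        proof (cases "inj_on h {1..n}")
          case True
          then have h': "h \<in> carrier (aut C n)" using h by (simp add: carrier_aut)
          then show ?thesis using SD(4)[OF single_kG[OF h'] x] deg_single[OF h' xc] by simp
        next
          case False
          then show ?thesis using noninj_kills[OF below h _ n xc] SD(2) by simp
        qed
        then show "x \<in> W n" using xc by (simp add: W_def)
      qed
    qed
    then show ?thesis using irr W n unfolding irreducible_cmodule_def deg_module_simps by blast
  qed
  then show ?thesis
    using left_module_deg ne unfolding irreducible_module_def deg_module_simps by blast
qed

end

end

section \<open>Tops of the modules with irreducible coefficients\<close>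

locale irreducible_rep = Delta_rep k C n lam
  for k :: "'k ring" (structure) and C :: cat and n :: nat
    and lam :: "((nat \<Rightarrow> nat) \<Rightarrow> 'k, 'n) module" +
  assumes n: "n \<ge> 1" and irr: "irreducible_module (kG n) lam"
begin

abbreviation "L \<equiv> cmod_top k C T"

lemmas top_facts = n nonzero_T[OF n irr] cosimple_T[OF n irr]

lemma irreducible_L: "irreducible_cmodule k C L"
  by (rule T.irreducible_cmod_top[OF top_facts])

sublocale L: cat_module k C L
  using irreducible_L by unfold_locales (simp add: irreducible_cmodule_def)

lemma csubmodule_rad: "csubmodule k C T (cmod_rad k C T)"
  by (rule T.csubmodule_rad[OF top_facts])

lemma rad_eq: "m \<ge> 1 \<Longrightarrow> cmod_rad k C T m = T.tors n m"
  by (rule T.cmod_rad_eq_tors[OF top_facts])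

lemma Ob_L: "Ob L m = quot_mod (Ob T m) (cmod_rad k C T m)"
  by (simp add: cmod_top_def cmod_quot_def)

lemma L_below: "1 \<le> m \<Longrightarrow> m < n \<Longrightarrow> carrier (Ob L m) = {\<zero>\<^bsub>Ob L m\<^esub>}"
  using T_below[of m] lmodule.coset_zero[OF lmodule_T T.csubmoduleD(1)[OF csubmodule_rad], of m]
  by (simp add: Ob_L lmodule.carrier_quot_mod[OF lmodule_T] lmodule.zero_quot_mod[OF lmodule_T])

definition emb :: "'n \<Rightarrow> (((nat \<Rightarrow> nat) \<Rightarrow> 'k) set \<times> 'n \<Rightarrow> 'k) set set" where
  "emb v = cmod_rad k C T n +>\<^bsub>Ob T n\<^esub> incl v"

lemma emb_hom: "emb \<in> mod_hom k Nk (Ob L n)"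
  unfolding emb_def Ob_L
  by (rule mod_hom_comp[OF incl_hom[OF n] lmodule.quot_proj_hom[OF lmodule_T[OF n] T.csubmoduleD(1)[OF csubmodule_rad n]]])

text \<open>The radical vanishes in degree \<open>n\<close>, so the copy of \<lambda> there passes
  unchanged to the top.\<close>

lemma emb_bij: "bij_betw emb (carrier lam) (carrier (Ob L n))"
proof -
  interpret M: lmodule k "Ob T n" by (rule lmodule_T[OF n])
  let ?K = "cmod_rad k C T n"
  have K: "submodule ?K k (Ob T n)" "?K = {\<zero>\<^bsub>Ob T n\<^esub>}"
    using T.csubmoduleD(1)[OF csubmodule_rad n] rad_eq[OF n] T.tors_self[OF n] by auto
  have "bij_betw (\<lambda>x. ?K +>\<^bsub>Ob T n\<^esub> x) (carrier (Ob T n)) (carrier (Ob L n))"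
    unfolding Ob_L M.carrier_quot_mod
  proof (rule inj_on_imp_bij_betw, rule inj_onI)
    fix x y assume "x \<in> carrier (Ob T n)" "y \<in> carrier (Ob T n)" "?K +>\<^bsub>Ob T n\<^esub> x = ?K +>\<^bsub>Ob T n\<^esub> y"
    then have "x \<in> carrier (Ob T n)" "y \<in> carrier (Ob T n)" "x \<ominus>\<^bsub>Ob T n\<^esub> y \<in> ?K"
      using M.coset_eq_iff[OF K(1), of x y] by simp_all
    then show "x = y" unfolding K(2) by (simp add: M.diff_eq_zero_iff)
  qed
  from bij_betw_trans[OF incl_bij[OF n] this] show ?thesis by (simp add: comp_def emb_def[abs_def])
qed

lemma L_nonzero: "carrier (Ob L n) \<noteq> {\<zero>\<^bsub>Ob L n\<^esub>}"
proof
  assume z: "carrier (Ob L n) = {\<zero>\<^bsub>Ob L n\<^esub>}"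
  obtain w where w: "w \<in> carrier lam" "w \<noteq> \<zero>\<^bsub>lam\<^esub>" using irreducible_nonzero[OF irr] .
  have "emb w = emb \<zero>\<^bsub>lam\<^esub>" using bij_betwE[OF emb_bij] z w N.M.zero_closed by (metis singletonD)
  then show False using inj_onD[OF bij_betw_imp_inj_on[OF emb_bij]] w N.M.zero_closed by blast
qed

lemma Mor_emb:
  assumes g: "g \<in> carrier (aut C n)" and v: "v \<in> carrier lam"
  shows "Mor L n n g (emb v) = emb (act g v)"
  using T.cmodule_quot(2)[OF csubmodule_rad n n, of g "incl v"] Mor_incl(2)[OF n v g] aut_mem[OF g]
    mod_homD(1)[OF incl_hom[OF n]] v
  by (simp add: cmod_top_def emb_def)

text \<open>An isomorphism of modules over the group algebra is compatible with automorphisms of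
  \<open>[n]\<close>. The other endomorphisms act as zero on both sides, as both modules vanish in
  lower degrees, so compatibility holds for all endomorphisms and the irreducible modules are
  isomorphic.\<close>

lemma iso_of_degree:
  assumes V: "irreducible_cmodule k C V" and ne: "carrier (Ob V n) \<noteq> {\<zero>\<^bsub>Ob V n\<^esub>}"
    and below: "\<And>m. 1 \<le> m \<Longrightarrow> m < n \<Longrightarrow> carrier (Ob V m) = {\<zero>\<^bsub>Ob V m\<^esub>}"
    and iso: "mod_iso (kG n) (cat_module.deg_module k V n) lam"
  shows "cmod_iso k C V L"
proof -
  interpret V: cat_module k C V using V by unfold_locales (simp add: irreducible_cmodule_def)
  obtain f where f: "f \<in> mod_hom (kG n) (V.deg_module n) lam" "bij_betw f (carrier (Ob V n)) (carrier lam)"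
    using iso by (auto simp: mod_iso_def V.deg_module_simps)
  note fD = mod_homD[OF f(1), unfolded V.deg_module_simps(1,3)]
  have fk: "f \<in> mod_hom k (Ob V n) Nk"
    using fD sc_closed V.deg_sc[OF n] by (intro mod_homI) (auto simp flip: V.deg_sc[OF n])
  have "f \<zero>\<^bsub>Ob V n\<^esub> = \<zero>\<^bsub>Nk\<^esub>"
    by (rule mod_hom_zero[OF V.left_module_Ob[OF n] lmodule.left_module_axioms'[OF lmodule_Nk] fk])
  show ?thesis
  proof (rule irreducible_iso_of_degree[OF V irreducible_L n ne])
    show "(\<lambda>x. emb (f x)) \<in> mod_hom k (Ob V n) (Ob L n)" by (rule mod_hom_comp[OF fk emb_hom])
    show "bij_betw (\<lambda>x. emb (f x)) (carrier (Ob V n)) (carrier (Ob L n))"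
      using bij_betw_trans[OF f(2) emb_bij] by (simp add: comp_def)
    fix h x assume h: "h \<in> C n n" and x: "x \<in> carrier (Ob V n)"
    show "emb (f (Mor V n n h x)) = Mor L n n h (emb (f x))"
    proof (cases "inj_on h {1..n}")
      case True
      then have h': "h \<in> carrier (aut C n)" using h by (simp add: carrier_aut)
      have "f (Mor V n n h x) = act h (f x)"
        using fD(3)[OF single_kG[OF h'] x] V.deg_single[OF n h' x] by simp
      then show ?thesis using Mor_emb[OF h' fD(1)[OF x]] by simp
    next
      case False
      have "emb (f x) \<in> carrier (Ob L n)" using bij_betwE[OF emb_bij] fD(1)[OF x] by blast
      then have "Mor L n n h (emb (f x)) = \<zero>\<^bsub>Ob L n\<^esub>" using L.noninj_kills[OF n L_below h False n] by blast
      moreover have "Mor V n n h x = \<zero>\<^bsub>Ob V n\<^esub>" using V.noninj_kills[OF n below h False n x] by blast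
      moreover have "emb (f \<zero>\<^bsub>Ob V n\<^esub>) = \<zero>\<^bsub>Ob L n\<^esub>"
        by (rule mod_hom_zero[OF V.left_module_Ob[OF n] L.left_module_Ob[OF n] mod_hom_comp[OF fk emb_hom]])
      ultimately show ?thesis by simp
    qed
  qed
qed

text \<open>If the radical were nonzero in some degree, \<lambda> would be singular; so the
  projection to the top is an isomorphism.\<close>

lemma regular_iso:
  assumes e: "covering_idempotent (kG n) lam e" and reg: "regular k C n e"
  shows "cmod_iso k C L (Delta_bar k C n lam)"
proof -
  have "cmod_rad k C T m = {\<zero>\<^bsub>Ob T m\<^esub>}" if "m \<ge> 1" for m
    using tors_imp_singular[OF n irr e that] reg rad_eq[OF that] by auto
  from T.cmod_iso_quot_zero[OF csubmodule_rad this]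
  show ?thesis unfolding cmod_top_def[symmetric] by (rule T.cmod_iso_sym)
qed

end

text \<open>The lowest nonzero degree is invariant under isomorphism and recovers \<open>n\<close>;
  the isomorphism in that degree, read through the two embeddings \<open>emb\<close>, recovers the
  module over the group.\<close>

lemma irreducible_reps_iso:
  assumes "irreducible_rep k C n lam" "irreducible_rep k C m mu"
    and iso: "cmod_iso k C (cmod_top k C (Delta_bar k C n lam)) (cmod_top k C (Delta_bar k C m mu))"
  shows "n = m" and "n = m \<Longrightarrow> mod_iso (group_algebra k (aut C n)) lam mu"
proof -
  interpret l: irreducible_rep k C n lam by fact
  interpret m: irreducible_rep k C m mu by fact
  obtain t where t: "t \<in> cmod_hom k C l.L m.L" "\<And>r. r \<ge> 1 \<Longrightarrow> bij_betw (t r) (carrier (Ob l.L r)) (carrier (Ob m.L r))"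
    using iso by (auto simp: cmod_iso_def)
  have z: "carrier (Ob l.L r) = {\<zero>\<^bsub>Ob l.L r\<^esub>} \<longleftrightarrow> carrier (Ob m.L r) = {\<zero>\<^bsub>Ob m.L r\<^esub>}" if r: "r \<ge> 1" for r
  proof -
    interpret lr: lmodule k "Ob l.L r" by (rule l.L.lmodule_Ob[OF r])
    interpret mr: lmodule k "Ob m.L r" by (rule m.L.lmodule_Ob[OF r])
    have t0: "t r \<zero>\<^bsub>Ob l.L r\<^esub> = \<zero>\<^bsub>Ob m.L r\<^esub>"
      by (rule mod_hom_zero[OF lr.left_module_axioms' mr.left_module_axioms' cmod_homD(1)[OF t(1) r]])
    have im: "t r ` carrier (Ob l.L r) = carrier (Ob m.L r)" and inj: "inj_on (t r) (carrier (Ob l.L r))"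
      using t(2)[OF r] by (auto simp: bij_betw_def)
    have "t r ` carrier (Ob l.L r) = t r ` {\<zero>\<^bsub>Ob l.L r\<^esub>} \<longleftrightarrow> carrier (Ob l.L r) = {\<zero>\<^bsub>Ob l.L r\<^esub>}"
      by (rule inj_on_image_eq_iff[OF inj subset_refl]) (use lr.M.zero_closed in simp)
    then show ?thesis using im t0 by simp
  qed
  show "n = m"
    using z[OF l.n] z[OF m.n] l.L_nonzero m.L_nonzero l.L_below[OF m.n] m.L_below[OF l.n]
    by (metis linorder_neqE_nat)
  assume nm: "n = m"
  let ?g = "\<lambda>v. inv_into (carrier mu) m.emb (t n (l.emb v))"
  have t': "bij_betw (t n) (carrier (Ob l.L n)) (carrier (Ob m.L m))" using t(2)[OF l.n] nm by simp
  have bij: "bij_betw ?g (carrier lam) (carrier mu)"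
    using bij_betw_trans[OF bij_betw_trans[OF l.emb_bij t'] bij_betw_inv_into[OF m.emb_bij]] by (simp add: comp_def)
  have emb_g: "m.emb (?g v) = t n (l.emb v)" if "v \<in> carrier lam" for v
    using bij_betwE[OF bij_betw_trans[OF l.emb_bij t']] that bij_betw_inv_into_right[OF m.emb_bij] by simp
  have g_eqI: "?g v = u" if "v \<in> carrier lam" "u \<in> carrier mu" "m.emb u = t n (l.emb v)" for u v
    using emb_g[OF that(1)] that bij_betwE[OF bij] inj_onD[OF bij_betw_imp_inj_on[OF m.emb_bij]] by metis
  have "?g \<in> mod_hom (l.kG n) lam mu"
  proof (rule l.kG_homI)
    show "left_module (l.kG n) lam" by (rule l.N.left_module_axioms')
    show "left_module (l.kG n) mu" using m.N.left_module_axioms' nm by simp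
    have "t n \<in> mod_hom k (Ob l.L n) (Ob m.L m)" using cmod_homD(1)[OF t(1) l.n] nm by simp
    moreover have "inv_into (carrier mu) m.emb \<in> mod_hom k (Ob m.L m) m.Nk"
      using mod_hom_inv_into[OF m.lmodule_Nk m.emb_hom] m.emb_bij by simp
    ultimately have "?g \<in> mod_hom k (l.res_k n lam) m.Nk"
      by (intro mod_hom_comp[OF mod_hom_comp[OF l.emb_hom]])
    then show "?g \<in> mod_hom k (l.res_k n lam) (l.res_k n mu)" using nm by simp
    fix g v assume g: "g \<in> carrier (aut C n)" and v: "v \<in> carrier lam"
    have gm: "g \<in> carrier (aut C m)" using g nm by simp
    have gv: "?g v \<in> carrier mu" using bij_betwE[OF bij] v by blast
    have ev: "l.emb v \<in> carrier (Ob l.L n)" using bij_betwE[OF l.emb_bij] v by blast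
    show "?g (l.act g v) = single k g \<odot>\<^bsub>mu\<^esub> ?g v"
    proof (rule g_eqI)
      show "l.act g v \<in> carrier lam" using l.act_closed[OF g v] .
      show "single k g \<odot>\<^bsub>mu\<^esub> ?g v \<in> carrier mu" using m.act_closed[OF gm gv] .
      have "m.emb (m.act g (?g v)) = Mor m.L n n g (t n (l.emb v))"
        using m.Mor_emb[OF gm gv] emb_g[OF v] nm by simp
      also have "\<dots> = t n (l.emb (l.act g v))"
        using cmod_homD(2)[OF t(1) l.n l.n, of g "l.emb v"] l.aut_mem[OF g] ev l.Mor_emb[OF g v] by simp
      finally show "m.emb (single k g \<odot>\<^bsub>mu\<^esub> ?g v) = t n (l.emb (l.act g v))" .
    qed
  qed
  then show "mod_iso (group_algebra k (aut C n)) lam mu"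
    unfolding mod_iso_def using bij by blast
qed

theorem corollary1p8:
  fixes k :: "'k ring" and C :: cat
    and Irr :: "nat \<Rightarrow> ((nat \<Rightarrow> nat) \<Rightarrow> 'k, 'w) module set"
  assumes "field k"
    and "C \<in> {FA, OA, CA, BA, SA}"
    and "\<And>n. n \<ge> 1 \<Longrightarrow> complete_irreducibles (group_algebra k (aut C n)) (Irr n)"
  shows "\<exists>L :: nat \<Rightarrow> ((nat \<Rightarrow> nat) \<Rightarrow> 'k, 'w) module \<Rightarrow>
                ('k, (((nat \<Rightarrow> nat) \<Rightarrow> 'k) set \<times> 'w \<Rightarrow> 'k) set set) cmod.
      (\<forall>n\<ge>1. \<forall>lam \<in> Irr n. irreducible_cmodule k C (L n lam)) \<and>
      (\<forall>n\<ge>1. \<forall>lam \<in> Irr n. \<forall>m\<ge>1. \<forall>mu \<in> Irr m.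
         cmod_iso k C (L n lam) (L m mu) \<longrightarrow> n = m \<and> lam = mu) \<and>
      (\<forall>V :: ('k, 'v) cmod. irreducible_cmodule k C V \<longrightarrow>
         (\<exists>n\<ge>1. \<exists>lam \<in> Irr n. cmod_iso k C V (L n lam))) \<and>
      (\<forall>n\<ge>1. \<forall>lam \<in> Irr n. \<forall>e. covering_idempotent (group_algebra k (aut C n)) lam e \<longrightarrow>
         (regular k C n e \<longrightarrow> cmod_iso k C (L n lam) (Delta_bar k C n lam)) \<and>
         (singular k C n e \<longrightarrow> cmod_iso k C (L n lam) (cmod_top k C (Delta_bar k C n lam))))"
proof -
  interpret cat_rep k C
    using assms(1) shape_category_five[OF assms(2)] by (simp add: cat_rep_def scalar_field_def)
  have rep: "irreducible_rep k C n lam" if "n \<ge> 1" "lam \<in> Irr n" for n lam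
  proof -
    have irr: "irreducible_module (kG n) lam" using assms(3)[OF that(1)] that(2) by (simp add: complete_irreducibles_def)
    then have "lmodule (kG n) lam" by (auto simp: irreducible_module_def intro: lmodule.intro)
    then show ?thesis
      using irr that(1) cat_rep_axioms
      by (simp add: irreducible_rep_def irreducible_rep_axioms_def Delta_rep_def)
  qed
  \<comment> \<open>One formula serves both cases: the statement for singular \<lambda> becomes
    reflexivity, and that for regular \<lambda> is \<open>regular_iso\<close>.\<close>
  let ?L = "\<lambda>n (lam :: ((nat \<Rightarrow> nat) \<Rightarrow> 'k, 'w) module). cmod_top k C (Delta_bar k C n lam)"
  show ?thesis
  proof (intro exI[of _ ?L] conjI allI impI ballI)
    fix n lam assume nl: "n \<ge> 1" "lam \<in> Irr n"
    interpret l: irreducible_rep k C n lam by (rule rep[OF nl])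
    show "irreducible_cmodule k C (?L n lam)" by (rule l.irreducible_L)
    have "cmod_iso k C (?L n lam) (?L n lam)"
      unfolding cmod_iso_def cmod_hom_def
      by (intro bexI[of _ "\<lambda>_ x. x"]) (auto simp: id_hom bij_betw_def)
    then show "cmod_iso k C (?L n lam) (?L n lam)" .
    fix e assume e: "covering_idempotent (kG n) lam e"
    show "cmod_iso k C (?L n lam) (Delta_bar k C n lam)" if "regular k C n e" by (rule l.regular_iso[OF e that])
  next
    fix n lam m mu assume nl: "n \<ge> 1" "lam \<in> Irr n" and mm: "m \<ge> 1" "mu \<in> Irr m"
      and iso: "cmod_iso k C (?L n lam) (?L m mu)"
    note r = irreducible_reps_iso[OF rep[OF nl] rep[OF mm] iso]
    show "n = m" by (rule r(1))
    show "lam = mu" using r nl mm(2) assms(3)[OF nl(1)] by (auto simp: complete_irreducibles_def)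
  next
    fix V :: "('k, 'v) cmod" assume V: "irreducible_cmodule k C V"
    interpret V: cat_module k C V using V by unfold_locales (simp add: irreducible_cmodule_def)
    define P where "P m \<longleftrightarrow> 1 \<le> m \<and> carrier (Ob V m) \<noteq> {\<zero>\<^bsub>Ob V m\<^esub>}" for m
    \<comment> \<open>The lowest nonzero degree of \<open>V\<close>, where the module over the group
      is irreducible and names the pair.\<close>
    define n where "n = (LEAST m. P m)"
    have "\<exists>m. P m" using V by (auto simp: irreducible_cmodule_def P_def)
    then have n: "P n" unfolding n_def by (rule LeastI_ex)
    have below: "carrier (Ob V m) = {\<zero>\<^bsub>Ob V m\<^esub>}" if "1 \<le> m" "m < n" for m
      using not_less_Least[of m P] that by (auto simp: n_def P_def)
    have n1: "n \<ge> 1" and ne: "carrier (Ob V n) \<noteq> {\<zero>\<^bsub>Ob V n\<^esub>}" using n by (auto simp: P_def)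
    obtain lam where lam: "lam \<in> Irr n" "mod_iso (kG n) (V.deg_module n) lam"
      using complete_irreducibles_iso[OF assms(3)[OF n1] V.irreducible_deg[OF n1 V ne below]] by blast
    interpret l: irreducible_rep k C n lam by (rule rep[OF n1 lam(1)])
    show "\<exists>n\<ge>1. \<exists>lam\<in>Irr n. cmod_iso k C V (?L n lam)"
      using l.iso_of_degree[OF V ne below lam(2)] n1 lam(1) by blast
  qed
qed

end
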